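(* Let $Q\subset\mathbb{R}^2$ be a polygon such that all the holes of $Q$ have non-zero minimal diameters. Suppose the edges of $Q$ are indexed by a finite set $\mathcal{A}$. Then for any non-periodic sequence $\alpha\in\mathcal{A}^{\mathbb{N}}$, the set $X(\alpha)$ contains at most one point; that is, there is at most one phase point whose edge coding is equal to $\alpha$.
   Context: A polygon is a bounded connected region in $\mathbb{R}^2$ bounded by finitely many straight line segments, called edges; the end points of the edges are called vertices. The union of the edges of $Q$ is the boundary $\partial Q$. A polygon need not be convex or simply connected. The complement of the interior of $Q$ in $\mathbb{R}^2$ contains finitely many bounded connected components; each of these is called a hole of $Q$. The minimal diameter of a hole is its minimal width (the minimum distance between two parallel lines enclosing it). Thus a hole with non-zero minimal diameter may have empty interior (for example a broken line), but it is not reduced to a single straight segment (a slit). Let $TQ=Q\times S^1$ be the set of couples $(x,v)$ with $x\in Q$ and $v$ a unit vector. The billiard flow moves $x$ along a straight line in the direction $v$ with unit speed; whenever the trajectory hits $\partial Q$, the direction is reflected elastically (angle of incidence equals angle of reflection). The motion is determined for all positive time unless the trajectory reaches a vertex. The phase space $V\subset TQ$ is the set of $(x,v)$ with $x\in\partial Q$ and $v$ pointing strictly into $Q$; its elements are called phase points. The billiard map $f$ is the first return map of the billiard flow to $V$. Let $\{e_a\mid a\in\mathcal{A}\}$ be the edges of $Q$, and let $E_a\subset V$ be the set of phase points $(x,v)$ with $x$ in the interior of the edge $e_a$ (i.e. $e_a$ minus its end points). A phase point $p$ has edge coding $\alpha=(\alpha_n)_{n\ge 0}\in\mathcal{A}^{\mathbb{N}}$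 if $f^n(p)$ is defined for all $n\geq 0$ and $f^n(p)\in E_{\alpha_n}$ for all $n\ge 0$. The set $X(\alpha)$ is the set of phase points whose edge coding is $\alpha$. A sequence $\alpha$ is periodic if there is $T\ge 1$ with $\alpha_{n+T}=\alpha_n$ for all $n\ge 0$. *)

theory Defs
  imports "HOL-Analysis.Analysis"
begin

type_synonym plane = "real^2"

text \<open>The edges are indexed by \<open>A\<close>; \<open>e a\<close> is the pair of end points of the edge with index \<open>a\<close>.\<close>

definition edge_seg :: "('i \<Rightarrow> plane \<times> plane) \<Rightarrow> 'i \<Rightarrow> plane set" where
  "edge_seg e a = closed_segment (fst (e a)) (snd (e a))"

definition edge_interior :: "('i \<Rightarrow> plane \<times> plane) \<Rightarrow> 'i \<Rightarrow> plane set" where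
  "edge_interior e a = open_segment (fst (e a)) (snd (e a))"

definition edge_ends :: "('i \<Rightarrow> plane \<times> plane) \<Rightarrow> 'i \<Rightarrow> plane set" where
  "edge_ends e a = {fst (e a), snd (e a)}"

definition boundary :: "'i set \<Rightarrow> ('i \<Rightarrow> plane \<times> plane) \<Rightarrow> plane set" where
  "boundary A e = (\<Union>a\<in>A. edge_seg e a)"

text \<open>
  The interior of \<open>Q\<close> is \<open>Q\<close> minus the union of its edges, which may be smaller than the
  topological interior: an edge may have \<open>Q\<close> on both of its sides, as happens for a hole that
  is a broken line.
\<close>

definition poly_interior :: "'i set \<Rightarrow> ('i \<Rightarrow> plane \<times> plane) \<Rightarrow> plane set \<Rightarrow> plane set" where
  "poly_interior A e Q = Q - boundary A e"

text \<open>
  Since distinct indices give segments that meet at most in common end points, the indexing is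
  injective and no vertex lies in the interior of an edge.
\<close>

definition is_polygon :: "'i set \<Rightarrow> ('i \<Rightarrow> plane \<times> plane) \<Rightarrow> plane set \<Rightarrow> bool" where
  "is_polygon A e Q \<longleftrightarrow>
     finite A \<and>
     (\<forall>a\<in>A. fst (e a) \<noteq> snd (e a)) \<and>
     (\<forall>a\<in>A. \<forall>b\<in>A. a \<noteq> b \<longrightarrow> edge_seg e a \<inter> edge_seg e b \<subseteq> edge_ends e a \<inter> edge_ends e b) \<and>
     bounded Q \<and>
     boundary A e \<subseteq> Q \<and>
     poly_interior A e Q \<noteq> {} \<and>
     open (poly_interior A e Q) \<and>
     connected (poly_interior A e Q) \<and>
     frontier (poly_interior A e Q) = boundary A e"

definition holes :: "'i set \<Rightarrow> ('i \<Rightarrow> plane \<times> plane) \<Rightarrow> plane set \<Rightarrow> plane set set" where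
  "holes A e Q = {H \<in> components (- poly_interior A e Q). bounded H}"

text \<open>
  The parallel lines \<open>{x. u \<bullet> x = a}\<close> and \<open>{x. u \<bullet> x = b}\<close>, with \<open>u\<close> a unit normal
  vector, enclose \<open>H\<close> and are at distance \<open>b - a\<close>.
\<close>

definition minimal_diameter :: "plane set \<Rightarrow> real" where
  "minimal_diameter H =
     Inf {b - a | u a b. norm u = 1 \<and> a \<le> b \<and> (\<forall>x\<in>H. a \<le> u \<bullet> x \<and> u \<bullet> x \<le> b)}"

type_synonym state = "plane \<times> plane"

definition points_into :: "'i set \<Rightarrow> ('i \<Rightarrow> plane \<times> plane) \<Rightarrow> plane set \<Rightarrow> plane \<Rightarrow> plane \<Rightarrow> bool" where
  "points_into A e Q x v \<longleftrightarrow>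
     (\<exists>\<epsilon>>0. \<forall>t. 0 < t \<and> t < \<epsilon> \<longrightarrow> x + t *\<^sub>R v \<in> poly_interior A e Q)"

definition phase_space :: "'i set \<Rightarrow> ('i \<Rightarrow> plane \<times> plane) \<Rightarrow> plane set \<Rightarrow> state set" where
  "phase_space A e Q =
     {(x, v). x \<in> boundary A e \<and> norm v = 1 \<and> points_into A e Q x v}"

definition phase_on_edge ::
    "'i set \<Rightarrow> ('i \<Rightarrow> plane \<times> plane) \<Rightarrow> plane set \<Rightarrow> 'i \<Rightarrow> state set" where
  "phase_on_edge A e Q a = {(x, v) \<in> phase_space A e Q. x \<in> edge_interior e a}"

text \<open>Elastic reflection in a line of direction \<open>d \<noteq> 0\<close>: the component of \<open>v\<close> along \<open>d\<close> is
  kept and the orthogonal one is reversed.\<close>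

definition reflect :: "plane \<Rightarrow> plane \<Rightarrow> plane" where
  "reflect d v = (2 * (v \<bullet> d) / (d \<bullet> d)) *\<^sub>R d - v"

text \<open>
  \<open>flow A e Q p t q\<close>: the state \<open>p\<close> is moved to \<open>q\<close> in time \<open>t\<close>. At a collision time the
  direction is the outgoing one. No rule applies at or beyond the time at which a vertex is hit,
  so there the flow is undefined.
\<close>

inductive flow ::
    "'i set \<Rightarrow> ('i \<Rightarrow> plane \<times> plane) \<Rightarrow> plane set \<Rightarrow> state \<Rightarrow> real \<Rightarrow> state \<Rightarrow> bool"
  for A e Q where
  start: "flow A e Q p 0 p"
| move: "\<lbrakk>flow A e Q p s (x, v); 0 < t;
          \<forall>r. 0 < r \<and> r \<le> t \<longrightarrow> x + r *\<^sub>R v \<in> poly_interior A e Q\<rbrakk>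
         \<Longrightarrow> flow A e Q p (s + t) (x + t *\<^sub>R v, v)"
| bounce: "\<lbrakk>flow A e Q p s (x, v); 0 < t;
            \<forall>r. 0 < r \<and> r < t \<longrightarrow> x + r *\<^sub>R v \<in> poly_interior A e Q;
            a \<in> A; x + t *\<^sub>R v \<in> edge_interior e a\<rbrakk>
           \<Longrightarrow> flow A e Q p (s + t) (x + t *\<^sub>R v, reflect (snd (e a) - fst (e a)) v)"

text \<open>The billiard map is a partial function on the phase space, given here by its graph.\<close>

definition billiard_map ::
    "'i set \<Rightarrow> ('i \<Rightarrow> plane \<times> plane) \<Rightarrow> plane set \<Rightarrow> (state \<times> state) set" where
  "billiard_map A e Q =
     {(p, q). p \<in> phase_space A e Q \<and> q \<in> phase_space A e Q \<and>
        (\<exists>t>0. flow A e Q p t q \<and>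
           (\<forall>s r. 0 < s \<and> s < t \<and> flow A e Q p s r \<longrightarrow> r \<notin> phase_space A e Q))}"

definition has_edge_coding ::
    "'i set \<Rightarrow> ('i \<Rightarrow> plane \<times> plane) \<Rightarrow> plane set \<Rightarrow> state \<Rightarrow> (nat \<Rightarrow> 'i) \<Rightarrow> bool" where
  "has_edge_coding A e Q p \<alpha> \<longleftrightarrow>
     (\<forall>n. \<exists>q. (p, q) \<in> billiard_map A e Q ^^ n \<and> q \<in> phase_on_edge A e Q (\<alpha> n))"

definition coding_set ::
    "'i set \<Rightarrow> ('i \<Rightarrow> plane \<times> plane) \<Rightarrow> plane set \<Rightarrow> (nat \<Rightarrow> 'i) \<Rightarrow> state set" where
  "coding_set A e Q \<alpha> = {p \<in> phase_space A e Q. has_edge_coding A e Q p \<alpha>}"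

definition periodic :: "(nat \<Rightarrow> 'i) \<Rightarrow> bool" where
  "periodic \<alpha> \<longleftrightarrow> (\<exists>T\<ge>1. \<forall>n. \<alpha> (n + T) = \<alpha> n)"

end

theory Submission
  imports Defs
begin

text \<open>
  Two orbits with the same coding have the same directions: otherwise their mutual offset would
  grow linearly with the length of the orbit. Hence two distinct phase points with coding \<open>\<alpha>\<close>
  give two parallel orbits at a constant distance, the two sides of a moving rod.

  Let \<open>W\<close> be the supremum of the widths of the strips that arbitrarily long words occurring
  arbitrarily late in \<open>\<alpha>\<close> admit. If two positions of the rod share a long word and separate after
  it, then, by maximality of \<open>W\<close> and in the limit of ever longer words, one of them encircles an
  end of the edge hit by the other, so their lines cross close to the place of separation. Two
  lines that cross near both ends of a long word are impossible. So a long word of near maximal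
  width cannot be preceded and followed by different letters at two places, and by the pigeonhole
  principle \<open>\<alpha>\<close> contains arbitrarily long runs of bounded period. Along a long run of even period
  the direction returns exactly, since only finitely many rotations occur, and the rod is displaced
  by less than its width; two overlapping positions of a rod cannot separate, so the run never
  ends. Finally the bounded infinite run forces a periodic orbit, and by reversibility \<open>\<alpha>\<close> is
  periodic from the beginning.

  Nothing is unfolded: the reflections act on the directions, and \<open>wedge (y n - x n) (v n)\<close> is
  the signed distance of the two lines, which changes its sign at each bounce.
\<close>

section \<open>The plane\<close>

text \<open>Why maximality forces encircling: let a common tail be entered from two edges
  \<open>c\<close> and \<open>c'\<close>, and take strips of near maximal width over both words.
  Their limits coincide on the common edge, since otherwise their outermost sides would bound a
  strip wider than \<open>W\<close>. So \<open>c\<close> and \<open>c'\<close> both extend across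
  one strip, and as edges do not cross, one lies in front of the other throughout. The rod that hits
  the farther edge must have the nearer one between its two sides, while the rod that hits the
  nearer one has both sides stopped by it. Rods of equal width can do this only with different
  directions.

  The obstacle is that edges may share end points: a single flight may be arbitrarily short, and
  strict inequalities can fail on the sides of a limiting strip. Hence lengths are estimated for two
  parallel flights at once, and heights are compared on the midline of the rod, which stays strictly
  inside the strip.

  Doubling the period makes the product of the reflections a rotation, whose angle does not depend
  on the direction, and preserves the sign of the offset.\<close>

definition wedge :: "plane \<Rightarrow> plane \<Rightarrow> real" where
  "wedge u w = u $ 1 * w $ 2 - u $ 2 * w $ 1"

lemma inner_plane: "(u::plane) \<bullet> w = u $ 1 * w $ 1 + u $ 2 * w $ 2"
  by (simp add: inner_vec_def sum_2)

lemma plane_eq_iff: "(u::plane) = w \<longleftrightarrow> u $ 1 = w $ 1 \<and> u $ 2 = w $ 2"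
  by (simp add: vec_eq_iff forall_2)

lemma wedge_simps [simp]:
  "wedge 0 w = 0" "wedge u 0 = 0" "wedge u u = 0"
  "wedge (- u) w = - wedge u w" "wedge u (- w) = - wedge u w"
  "wedge (c *\<^sub>R u) w = c * wedge u w" "wedge u (c *\<^sub>R w) = c * wedge u w"
  by (simp_all add: wedge_def algebra_simps)

lemma wedge_add: "wedge (u + u') w = wedge u w + wedge u' w"
  and wedge_diff: "wedge (u - u') w = wedge u w - wedge u' w"
  and wedge_diff_right: "wedge u (w - w') = wedge u w - wedge u w'"
  by (simp_all add: wedge_def algebra_simps)

lemma wedge_swap: "wedge w u = - wedge u w"
  by (simp add: wedge_def)

lemma lagrange_plane: "(wedge u w)\<^sup>2 + (u \<bullet> w)\<^sup>2 = (u \<bullet> u) * (w \<bullet> w)"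
  unfolding wedge_def inner_plane by algebra

lemma abs_wedge_le: "\<bar>wedge u w\<bar> \<le> norm u * norm w"
proof -
  have "(wedge u w)\<^sup>2 \<le> (norm u * norm w)\<^sup>2"
    using lagrange_plane[of u w] by (simp add: power_mult_distrib power2_norm_eq_inner)
      (smt (verit) zero_le_power2)
  thus ?thesis by (metis abs_le_square_iff abs_mult abs_norm_cancel)
qed

lemma wedge_zero_parallel:
  assumes "wedge u w = 0" "norm w = 1"
  shows "u = (u \<bullet> w) *\<^sub>R w"
proof -
  have n: "w $ 1 * w $ 1 + w $ 2 * w $ 2 = 1"
    using assms(2) by (metis inner_plane norm_eq_1)
  have c: "u $ 1 * w $ 2 = u $ 2 * w $ 1" using assms(1) by (simp add: wedge_def)
  have "u $ 1 = (u $ 1 * w $ 1 + u $ 2 * w $ 2) * w $ 1"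
       "u $ 2 = (u $ 1 * w $ 1 + u $ 2 * w $ 2) * w $ 2"
    using n c by algebra+
  thus ?thesis by (simp add: plane_eq_iff inner_plane)
qed

lemma unit_parallel_eq:
  fixes u w :: plane
  assumes "wedge u w = 0" "0 \<le> u \<bullet> w" "norm u = 1" "norm w = 1"
  shows "u = w"
proof -
  have "u = (u \<bullet> w) *\<^sub>R w" using wedge_zero_parallel assms by blast
  moreover from this have "\<bar>u \<bullet> w\<bar> = 1" using assms(3,4) by (metis mult.right_neutral norm_scaleR)
  ultimately show ?thesis using assms(2) by simp
qed

lemma reflect_uminus: "reflect d (- u) = - reflect d u"
  by (simp add: reflect_def)

lemma reflect_self: "d \<noteq> 0 \<Longrightarrow> reflect d (c *\<^sub>R d) = c *\<^sub>R d"
  by (simp add: reflect_def flip: scaleR_left_diff_distrib)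

lemma reflect_inner:
  assumes "d \<noteq> 0" shows "reflect d u \<bullet> reflect d w = u \<bullet> w"
proof -
  have "d \<bullet> d \<noteq> 0" using assms by simp
  thus ?thesis
    by (simp add: reflect_def inner_diff_left inner_diff_right field_simps inner_commute)
qed

lemma reflect_norm: "d \<noteq> 0 \<Longrightarrow> norm (reflect d u) = norm u"
  by (simp add: norm_eq_sqrt_inner reflect_inner)

lemma reflect_reflect:
  assumes "d \<noteq> 0" shows "reflect d (reflect d u) = u"
proof -
  have "d \<bullet> d \<noteq> 0" using assms by simp
  thus ?thesis
    by (simp add: reflect_def inner_diff_left field_simps)
qed

lemma reflect_wedge:
  assumes "d \<noteq> 0" shows "wedge (reflect d u) (reflect d w) = - wedge u w"
proof -
  have "d \<bullet> d \<noteq> 0" using assms by simp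
  then obtain k where k: "k * (d \<bullet> d) = 1" by (metis nonzero_divide_eq_eq)
  have r: "reflect d u = (2 * (u \<bullet> d) * k) *\<^sub>R d - u" for u
    using k by (simp add: reflect_def) (metis \<open>d \<bullet> d \<noteq> 0\<close> divide_inverse inverse_unique mult.commute)
  show ?thesis
    using k unfolding r by (simp add: wedge_def inner_plane) algebra
qed

text \<open>A vector along the mirror is fixed by the reflection, so reflecting the other argument
  alone already reverses the orientation. Offsets between two points of one edge pass through a
  bounce in this way.\<close>

lemma wedge_reflect_parallel:
  assumes "d \<noteq> 0" "u = c *\<^sub>R d" shows "wedge u (reflect d w) = - wedge u w"
  using reflect_wedge[OF assms(1), of u w] assms by (simp add: reflect_self)

lemma inner_reflect_parallel:
  assumes "d \<noteq> 0" "u = c *\<^sub>R d" shows "u \<bullet> reflect d w = u \<bullet> w"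
  using reflect_inner[OF assms(1), of u w] assms by (simp add: reflect_self)

lemma wedge_reflect_self: "wedge d (reflect d w) = - wedge d w"
  by (simp add: reflect_def wedge_diff_right)

lemma continuous_wedge [tendsto_intros]:
  assumes "(f \<longlongrightarrow> a) F" "(g \<longlongrightarrow> b) F"
  shows "((\<lambda>x. wedge (f x) (g x)) \<longlongrightarrow> wedge a b) F"
  unfolding wedge_def by (intro tendsto_intros assms)

lemma tendsto_reflect:
  assumes "(f \<longlongrightarrow> a) F" shows "((\<lambda>x. reflect d (f x)) \<longlongrightarrow> reflect d a) F"
proof (cases "d = 0")
  case True thus ?thesis using assms by (simp add: reflect_def tendsto_minus)
next
  case False thus ?thesis unfolding reflect_def by (intro tendsto_intros assms) auto
qed

lemma closed_segment_diff_parallel: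
  fixes a b x y :: plane
  assumes "x \<in> closed_segment a b" "y \<in> closed_segment a b"
  shows "\<exists>c. x - y = c *\<^sub>R (b - a)"
proof -
  obtain s t where st: "x = (1 - s) *\<^sub>R a + s *\<^sub>R b" "y = (1 - t) *\<^sub>R a + t *\<^sub>R b"
    using assms by (auto simp: in_segment)
  have "x - y = (s - t) *\<^sub>R (b - a)" unfolding st by (simp add: algebra_simps)
  thus ?thesis ..
qed

lemma segment_affine_mem:
  fixes a b :: "'v::real_vector"
  assumes "0 \<le> s" "s \<le> 1" shows "a + s *\<^sub>R (b - a) \<in> closed_segment a b"
  using assms by (auto simp: in_segment algebra_simps intro!: exI[of _ s])

lemma segment_affine_mem_open:
  fixes a b :: "'v::real_vector"
  assumes "0 < s" "s < 1" "a \<noteq> b" shows "a + s *\<^sub>R (b - a) \<in> open_segment a b"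
  using assms by (auto simp: in_segment algebra_simps intro!: exI[of _ s])

text \<open>Two segments, viewed as graphs over the offset from a line of direction \<open>u\<close>, whose height
  difference changes sign.\<close>

lemma segments_cross:
  fixes p q p' q' u :: plane
  assumes "p' - p = f0 *\<^sub>R u" "q' - q = f1 *\<^sub>R u" "f0 \<le> 0" "0 \<le> f1"
  shows "closed_segment p q \<inter> closed_segment p' q' \<noteq> {}"
proof (cases "f0 = 0")
  case True
  hence "p' = p" using assms by simp
  thus ?thesis by auto
next
  case False
  define s where "s = - f0 / (f1 - f0)"
  have d: "f1 - f0 > 0" using False assms by linarith
  have s: "0 \<le> s" "s \<le> 1" using d assms by (auto simp: s_def field_simps)
  have "f0 + s * (f1 - f0) = 0" using d by (simp add: s_def)
  moreover have "p' + s *\<^sub>R (q' - p') - (p + s *\<^sub>R (q - p)) = (f0 + s * (f1 - f0)) *\<^sub>R u"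
  proof -
    have "p' + s *\<^sub>R (q' - p') - (p + s *\<^sub>R (q - p)) = (p' - p) + s *\<^sub>R ((q' - q) - (p' - p))"
      by (simp add: algebra_simps)
    thus ?thesis using assms by (simp add: algebra_simps)
  qed
  ultimately have "p' + s *\<^sub>R (q' - p') = p + s *\<^sub>R (q - p)" by simp
  thus ?thesis using segment_affine_mem[OF s] by (metis disjoint_iff)
qed

section \<open>Trajectories of a coding\<close>

abbreviation edge_dir :: "('i \<Rightarrow> plane \<times> plane) \<Rightarrow> 'i \<Rightarrow> plane" where
  "edge_dir e a \<equiv> snd (e a) - fst (e a)"

locale edge_system =
  fixes A :: "'i set" and e :: "'i \<Rightarrow> plane \<times> plane"
  assumes finite_A: "finite A"
    and nondegenerate: "a \<in> A \<Longrightarrow> fst (e a) \<noteq> snd (e a)"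
    and meet_at_ends: "a \<in> A \<Longrightarrow> b \<in> A \<Longrightarrow> a \<noteq> b \<Longrightarrow>
      edge_seg e a \<inter> edge_seg e b \<subseteq> edge_ends e a \<inter> edge_ends e b"
begin

lemma dir_nonzero: "a \<in> A \<Longrightarrow> edge_dir e a \<noteq> 0"
  using nondegenerate by force

lemma interior_subset_seg: "edge_interior e a \<subseteq> edge_seg e a"
  by (simp add: edge_interior_def edge_seg_def segment_open_subset_closed)

lemma interior_only_edge:
  assumes "a \<in> A" "b \<in> A" "z \<in> edge_interior e a" "z \<in> edge_seg e b"
  shows "a = b"
proof (rule ccontr)
  assume "a \<noteq> b"
  hence "z \<in> edge_ends e a"
    using meet_at_ends[of a b] assms interior_subset_seg by blast
  thus False using assms(3) by (auto simp: edge_ends_def edge_interior_def open_segment_def)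
qed

lemma seg_diff_parallel:
  assumes "x \<in> edge_seg e a" "y \<in> edge_seg e a"
  shows "\<exists>c. x - y = c *\<^sub>R edge_dir e a"
  using closed_segment_diff_parallel assms by (simp add: edge_seg_def)

lemma closed_seg_subset:
  assumes "x \<in> edge_seg e a" "y \<in> edge_seg e a"
  shows "closed_segment x y \<subseteq> edge_seg e a"
  using assms unfolding edge_seg_def
  by (simp add: closed_segment_subset)

lemma closed_seg_subset_interior:
  assumes "x \<in> edge_interior e a" "y \<in> edge_interior e a"
  shows "closed_segment x y \<subseteq> edge_interior e a"
  using assms unfolding edge_interior_def
  by (simp add: closed_segment_subset convex_open_segment)

lemma open_seg_subset_interior:
  assumes "x \<in> edge_seg e a" "y \<in> edge_seg e a" "x \<noteq> y"
  shows "open_segment x y \<subseteq> edge_interior e a"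
  using assms unfolding edge_seg_def edge_interior_def
  by (meson subset_open_segment)

lemma diameter_bound:
  "\<exists>D>0. \<forall>a\<in>A. \<forall>b\<in>A. \<forall>x\<in>edge_seg e a. \<forall>y\<in>edge_seg e b. norm (x - y) \<le> D"
proof -
  have "bounded (boundary A e)"
    unfolding boundary_def edge_seg_def
    using finite_A by (intro bounded_UN) (auto simp: bounded_closed_segment)
  then obtain B where "\<forall>x\<in>boundary A e. norm x \<le> B" by (auto simp: bounded_iff)
  hence "norm (x - y) \<le> \<bar>2 * B\<bar> + 1" if "a \<in> A" "b \<in> A" "x \<in> edge_seg e a" "y \<in> edge_seg e b" for a b x y
  proof -
    have "norm x \<le> B" "norm y \<le> B" using that \<open>\<forall>x\<in>boundary A e. norm x \<le> B\<close> unfolding boundary_def by auto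
    thus ?thesis using norm_triangle_ineq4[of x y] by linarith
  qed
  thus ?thesis by (intro exI[of _ "\<bar>2 * B\<bar> + 1"]) auto
qed

end

text \<open>\<open>v n\<close> is the direction after the bounce at \<open>x n\<close>.\<close>

definition trajectory ::
  "'i set \<Rightarrow> ('i \<Rightarrow> plane \<times> plane) \<Rightarrow> (nat \<Rightarrow> 'i) \<Rightarrow> (nat \<Rightarrow> plane) \<Rightarrow> (nat \<Rightarrow> plane) \<Rightarrow>
    (nat \<Rightarrow> real) \<Rightarrow> bool" where
  "trajectory A e \<alpha> x v t \<longleftrightarrow>
    (\<forall>n. x n \<in> edge_interior e (\<alpha> n) \<and> norm (v n) = 1 \<and> 0 < t n \<and>
      x (Suc n) = x n + t n *\<^sub>R v n \<and> v (Suc n) = reflect (edge_dir e (\<alpha> (Suc n))) (v n) \<and>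
      (\<forall>r. 0 < r \<and> r < t n \<longrightarrow> x n + r *\<^sub>R v n \<notin> boundary A e))"

section \<open>From the billiard map to trajectories\<close>

context
  fixes A :: "'i set" and e :: "'i \<Rightarrow> plane \<times> plane" and Q :: "plane set"
  assumes poly: "is_polygon A e Q"
begin

interpretation edge_system A e
  using poly unfolding is_polygon_def by unfold_locales auto

lemma interior_not_boundary: "z \<in> poly_interior A e Q \<Longrightarrow> z \<notin> boundary A e"
  by (simp add: poly_interior_def)

lemma edge_point_isolated:
  assumes a: "a \<in> A" and z: "z \<in> edge_interior e a"
  obtains r where "r > 0" "\<And>b w. b \<in> A \<Longrightarrow> w \<in> ball z r \<Longrightarrow> w \<in> edge_seg e b \<Longrightarrow> b = a"
proof -
  define C where "C = (\<Union>b\<in>A - {a}. edge_seg e b)"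
  have "closed C" unfolding C_def edge_seg_def using finite_A by (intro closed_UN) auto
  moreover have "z \<notin> C" using interior_only_edge[OF a _ z] by (auto simp: C_def)
  ultimately obtain r where "r > 0" "ball z r \<subseteq> - C"
    by (metis ComplI open_Compl openE)
  thus ?thesis using that by (force simp: C_def)
qed

text \<open>Near an interior point of an edge the boundary is a straight line, so an open half disc
  that meets the interior of \<open>Q\<close> is contained in it; reflection keeps the half disc.\<close>

lemma reflected_points_into:
  assumes a: "a \<in> A" and z: "z \<in> edge_interior e a" and T: "T > 0"
    and inc: "\<And>s. 0 < s \<Longrightarrow> s < T \<Longrightarrow> z - s *\<^sub>R v \<in> poly_interior A e Q"
    and nv: "norm v = 1"
  shows "points_into A e Q z (reflect (edge_dir e a) v)"
proof -
  let ?d = "edge_dir e a"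
  obtain r where r: "r > 0"
    and iso: "\<And>b w. b \<in> A \<Longrightarrow> w \<in> ball z r \<Longrightarrow> w \<in> edge_seg e b \<Longrightarrow> b = a"
    using edge_point_isolated[OF a z] by blast
  have d0: "?d \<noteq> 0" using dir_nonzero a by simp
  have transv: "wedge v ?d \<noteq> 0"
  proof
    assume w0: "wedge v ?d = 0"
    hence "wedge ?d v = 0" by (metis neg_equal_0_iff_equal wedge_swap)
    then obtain k where k: "?d = k *\<^sub>R v" using wedge_zero_parallel nv by blast
    hence k0: "k \<noteq> 0" using d0 by auto
    obtain u where u: "0 < u" "u < 1" "z = (1 - u) *\<^sub>R fst (e a) + u *\<^sub>R snd (e a)"
      using z by (auto simp: edge_interior_def in_segment)
    \<comment> \<open>If \<open>v\<close> were parallel to the edge, going back from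
      \<open>z\<close> by \<open>s\<close> would stay on the edge: the second bound keeps the
      parameter \<open>u - s / k\<close> in the unit interval, the first keeps \<open>s\<close>
      within the incoming flight.\<close>
    define s where "s = min (T / 2) (\<bar>k\<bar> * min u (1 - u))"
    have s: "0 < s" "s < T" "s \<le> \<bar>k\<bar> * min u (1 - u)" using T k0 u by (auto simp: s_def)
    have "\<bar>s / k\<bar> \<le> min u (1 - u)"
    proof -
      have "\<bar>s / k\<bar> = s / \<bar>k\<bar>" using s by (simp add: abs_divide)
      also have "\<dots> \<le> min u (1 - u)"
        using s(3) k0 by (subst pos_divide_le_eq) (simp, metis mult.commute)
      finally show ?thesis .
    qed
    hence uu: "0 \<le> u - s / k" "u - s / k \<le> 1" by linarith+
    have "v = (1 / k) *\<^sub>R ?d" using k k0 by simp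
    hence "s *\<^sub>R v = (s / k) *\<^sub>R ?d" by simp
    hence "z - s *\<^sub>R v = fst (e a) + (u - s / k) *\<^sub>R (snd (e a) - fst (e a))"
      unfolding u(3) by (simp only:) (simp add: algebra_simps)
    hence "z - s *\<^sub>R v \<in> edge_seg e a"
      unfolding edge_seg_def using segment_affine_mem[OF uu] by metis
    thus False using inc[OF s(1,2)] a by (auto simp: poly_interior_def boundary_def)
  qed
  \<comment> \<open>The half disc on the side from which the flight arrives. Dividing by
    \<open>wedge v ?d\<close> makes the choice of side independent of the orientation of the
    edge.\<close>
  define H where "H = ball z r \<inter> {w. 0 < wedge (z - w) ?d / wedge v ?d}"
  have convH: "convex H"
  proof -
    have "convex {w. 0 < wedge (z - w) ?d / wedge v ?d}"
    proof (rule convexI)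
      fix x y :: plane and p q :: real
      assume x: "x \<in> {w. 0 < wedge (z - w) ?d / wedge v ?d}" and y: "y \<in> {w. 0 < wedge (z - w) ?d / wedge v ?d}"
        and pq: "0 \<le> p" "0 \<le> q" "p + q = 1"
      have "z - (p *\<^sub>R x + q *\<^sub>R y) = p *\<^sub>R (z - x) + q *\<^sub>R (z - y)"
      proof -
        have "p *\<^sub>R (z - x) + q *\<^sub>R (z - y) = (p + q) *\<^sub>R z - (p *\<^sub>R x + q *\<^sub>R y)"
          by (simp add: algebra_simps)
        thus ?thesis using pq(3) by simp
      qed
      hence "wedge (z - (p *\<^sub>R x + q *\<^sub>R y)) ?d / wedge v ?d
          = p * (wedge (z - x) ?d / wedge v ?d) + q * (wedge (z - y) ?d / wedge v ?d)"
        by (simp add: wedge_add add_divide_distrib)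
      also have "\<dots> > 0"
      proof (cases "p = 0")
        case True
        thus ?thesis using y pq by simp
      next
        case False
        hence "0 < p * (wedge (z - x) ?d / wedge v ?d)"
          using x pq(1) by (intro mult_pos_pos) auto
        moreover have "0 \<le> q * (wedge (z - y) ?d / wedge v ?d)"
          using y pq(2) by (intro mult_nonneg_nonneg) auto
        ultimately show ?thesis by linarith
      qed
      finally show "p *\<^sub>R x + q *\<^sub>R y \<in> {w. 0 < wedge (z - w) ?d / wedge v ?d}" by simp
    qed
    thus ?thesis unfolding H_def by (intro convex_Int convex_ball)
  qed
  have Hb: "H \<inter> boundary A e = {}"
  proof (rule ccontr)
    assume "H \<inter> boundary A e \<noteq> {}"
    then obtain w b where w: "w \<in> H" "b \<in> A" "w \<in> edge_seg e b" by (auto simp: boundary_def)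
    hence "w \<in> edge_seg e a" using iso by (auto simp: H_def)
    then obtain c where "z - w = c *\<^sub>R ?d" using seg_diff_parallel z interior_subset_seg by blast
    thus False using w(1) by (simp add: H_def)
  qed
  define s where "s = min (T / 2) (r / 2)"
  have s: "0 < s" "s < T" "s < r" using T r by (auto simp: s_def)
  have mem: "z - s *\<^sub>R v \<in> H" using s transv nv by (simp add: H_def dist_norm)
  have fr: "frontier (poly_interior A e Q) = boundary A e" using poly by (simp add: is_polygon_def)
  have sub: "H \<subseteq> poly_interior A e Q"
  proof (rule ccontr)
    assume "\<not> H \<subseteq> poly_interior A e Q"
    hence "H - poly_interior A e Q \<noteq> {}" by auto
    moreover have "H \<inter> poly_interior A e Q \<noteq> {}" using mem inc[OF s(1,2)] by auto
    ultimately have "H \<inter> frontier (poly_interior A e Q) \<noteq> {}"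
      using connected_Int_frontier convex_connected[OF convH] by blast
    thus False using Hb fr by simp
  qed
  have "z + q *\<^sub>R reflect ?d v \<in> H" if "0 < q" "q < r" for q
  proof -
    have "wedge (reflect ?d v) ?d = - wedge v ?d"
      using wedge_reflect_self[of ?d v] wedge_swap[of "reflect ?d v" ?d] wedge_swap[of v ?d] by simp
    thus ?thesis using that transv nv reflect_norm[OF d0, of v] by (simp add: H_def dist_norm)
  qed
  thus ?thesis unfolding points_into_def using r sub by blast
qed

lemma reflected_phase_space:
  assumes "a \<in> A" "x + t *\<^sub>R v \<in> edge_interior e a" "0 < t" "norm v = 1"
    and "\<And>r. 0 < r \<Longrightarrow> r < t \<Longrightarrow> x + r *\<^sub>R v \<in> poly_interior A e Q"
  shows "(x + t *\<^sub>R v, reflect (edge_dir e a) v) \<in> phase_space A e Q"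
proof -
  have "points_into A e Q (x + t *\<^sub>R v) (reflect (edge_dir e a) v)"
  proof (rule reflected_points_into[OF assms(1,2,3) _ assms(4)])
    fix s assume "0 < s" "s < t"
    thus "x + t *\<^sub>R v - s *\<^sub>R v \<in> poly_interior A e Q"
      using assms(5)[of "t - s"] by (simp add: algebra_simps)
  qed
  moreover have "x + t *\<^sub>R v \<in> boundary A e"
    using assms(1,2) interior_subset_seg unfolding boundary_def by blast
  ultimately show ?thesis using assms(4) reflect_norm[OF dir_nonzero[OF assms(1)], of v]
    by (simp add: phase_space_def)
qed

text \<open>A bounce would land in the phase space, so up to a time without return only
  \<open>start\<close> and \<open>move\<close> can have been applied. This normalises the many ways
  in which the inductive relation can cut one straight flight into pieces.\<close>

lemma flow_before_return:
  assumes "flow A e Q p s q" "norm (snd p) = 1"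
    and "\<And>s' r. 0 < s' \<Longrightarrow> s' \<le> s \<Longrightarrow> flow A e Q p s' r \<Longrightarrow> r \<notin> phase_space A e Q"
  shows "0 \<le> s \<and> q = (fst p + s *\<^sub>R snd p, snd p) \<and>
    (\<forall>r. 0 < r \<and> r \<le> s \<longrightarrow> fst p + r *\<^sub>R snd p \<in> poly_interior A e Q)"
  using assms
proof (induction rule: flow.induct)
  case (start p)
  thus ?case by auto
next
  case (move p s x v t)
  have IH: "0 \<le> s \<and> (x, v) = (fst p + s *\<^sub>R snd p, snd p) \<and>
    (\<forall>r. 0 < r \<and> r \<le> s \<longrightarrow> fst p + r *\<^sub>R snd p \<in> poly_interior A e Q)"
    using move by auto
  have "fst p + r *\<^sub>R snd p \<in> poly_interior A e Q" if "0 < r" "r \<le> s + t" for r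
  proof (cases "r \<le> s")
    case False
    thus ?thesis using move(3)[rule_format, of "r - s"] IH that by (simp add: algebra_simps)
  qed (use IH that in auto)
  thus ?case using IH move(2) by (auto simp: algebra_simps)
next
  case (bounce p s x v t a)
  have IH: "0 \<le> s \<and> (x, v) = (fst p + s *\<^sub>R snd p, snd p) \<and>
    (\<forall>r. 0 < r \<and> r \<le> s \<longrightarrow> fst p + r *\<^sub>R snd p \<in> poly_interior A e Q)"
    using bounce by auto
  have "(x + t *\<^sub>R v, reflect (edge_dir e a) v) \<in> phase_space A e Q"
    using bounce IH by (intro reflected_phase_space) auto
  moreover have "flow A e Q p (s + t) (x + t *\<^sub>R v, reflect (edge_dir e a) v)"
    using bounce by (intro flow.bounce) auto
  ultimately show ?case using bounce.prems(2)[of "s + t"] bounce(2) IH by fastforce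
qed

text \<open>The last rule must be \<open>bounce\<close>: \<open>start\<close> takes no time and
  \<open>move\<close> ends off the boundary. Everything before it is one free flight, which is
  joined to the flight of the bounce.\<close>

lemma billiard_map_step:
  assumes "(p, q) \<in> billiard_map A e Q"
  obtains t a where "0 < t" "a \<in> A" "fst q = fst p + t *\<^sub>R snd p" "fst q \<in> edge_interior e a"
    "snd q = reflect (edge_dir e a) (snd p)"
    "\<forall>r. 0 < r \<and> r < t \<longrightarrow> fst p + r *\<^sub>R snd p \<in> poly_interior A e Q"
proof -
  obtain T where T: "0 < T" "flow A e Q p T q"
    and first: "\<And>s r. 0 < s \<Longrightarrow> s < T \<Longrightarrow> flow A e Q p s r \<Longrightarrow> r \<notin> phase_space A e Q"
    using assms unfolding billiard_map_def by blast
  have p: "norm (snd p) = 1" and q: "q \<in> phase_space A e Q"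
    using assms by (auto simp: billiard_map_def phase_space_def)
  from T(2) show thesis
  proof cases
    case start
    thus ?thesis using T by simp
  next
    case (move s x v t)
    hence "x + t *\<^sub>R v \<in> poly_interior A e Q" by auto
    thus ?thesis using q move interior_not_boundary by (auto simp: phase_space_def)
  next
    case (bounce s x v t a)
    have IH: "0 \<le> s \<and> (x, v) = (fst p + s *\<^sub>R snd p, snd p) \<and>
      (\<forall>r. 0 < r \<and> r \<le> s \<longrightarrow> fst p + r *\<^sub>R snd p \<in> poly_interior A e Q)"
      using bounce p first by (intro flow_before_return) auto
    have "fst p + r *\<^sub>R snd p \<in> poly_interior A e Q" if "0 < r" "r < s + t" for r
    proof (cases "r \<le> s")
      case False
      thus ?thesis using bounce(5)[rule_format, of "r - s"] IH that by (simp add: algebra_simps)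
    qed (use IH that in auto)
    thus ?thesis using that[of "s + t" a] bounce IH T by (auto simp: algebra_simps)
  qed
qed

text \<open>The shorter of two flights from \<open>p\<close> would end at a boundary point inside
  the longer free flight. Uniqueness is what lets states found separately for each number of
  iterations be assembled into one orbit.\<close>

lemma single_valued_billiard_map: "single_valued (billiard_map A e Q)"
proof (rule single_valuedI)
  fix p q q' assume "(p, q) \<in> billiard_map A e Q" "(p, q') \<in> billiard_map A e Q"
  note pq = this
  obtain t a where 1: "0 < t" "a \<in> A" "fst q = fst p + t *\<^sub>R snd p" "fst q \<in> edge_interior e a"
    "snd q = reflect (edge_dir e a) (snd p)"
    "\<forall>r. 0 < r \<and> r < t \<longrightarrow> fst p + r *\<^sub>R snd p \<in> poly_interior A e Q"
    using billiard_map_step[OF pq(1)] by blast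
  obtain t' a' where 2: "0 < t'" "a' \<in> A" "fst q' = fst p + t' *\<^sub>R snd p" "fst q' \<in> edge_interior e a'"
    "snd q' = reflect (edge_dir e a') (snd p)"
    "\<forall>r. 0 < r \<and> r < t' \<longrightarrow> fst p + r *\<^sub>R snd p \<in> poly_interior A e Q"
    using billiard_map_step[OF pq(2)] by blast
  have b: "fst q \<in> boundary A e" "fst q' \<in> boundary A e"
    using 1(2,4) 2(2,4) interior_subset_seg unfolding boundary_def by blast+
  have "\<not> t < t'" "\<not> t' < t"
    using 1(1,3,6) 2(1,3,6) b interior_not_boundary by metis+
  hence "t = t'" by simp
  moreover have "a = a'" using interior_only_edge[OF 1(2) 2(2) 1(4)] 1(3) 2(3,4) calculation interior_subset_seg
    by auto
  ultimately show "q = q'" using 1 2 by (simp add: prod_eq_iff)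
qed

lemma coding_trajectory:
  assumes p: "p \<in> coding_set A e Q \<alpha>" and \<alpha>: "\<And>n. \<alpha> n \<in> A"
  obtains x v t where "trajectory A e \<alpha> x v t" "p = (x 0, v 0)"
proof -
  let ?B = "billiard_map A e Q"
  have "\<forall>n. \<exists>q. (p, q) \<in> ?B ^^ n \<and> q \<in> phase_on_edge A e Q (\<alpha> n)"
    using p unfolding coding_set_def has_edge_coding_def by blast
  from choice[OF this] obtain s
    where s: "\<And>n. (p, s n) \<in> ?B ^^ n" "\<And>n. s n \<in> phase_on_edge A e Q (\<alpha> n)"
    by blast
  \<comment> \<open>The coding supplies some \<open>n\<close>-th iterate for every \<open>n\<close>
    separately. Single-valued powers force the state through which the \<open>Suc n\<close>-th
    iterate passes to be \<open>s n\<close>.\<close>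
  have sv: "single_valued (?B ^^ n)" for n
    by (induction n) (auto intro: single_valued_relcomp single_valued_billiard_map)
  have step: "(s n, s (Suc n)) \<in> ?B" for n
    using s(1)[of "Suc n"] s(1)[of n] sv[of n] by (auto dest: single_valuedD)
  have "\<exists>t>0. fst (s (Suc n)) = fst (s n) + t *\<^sub>R snd (s n) \<and>
      snd (s (Suc n)) = reflect (edge_dir e (\<alpha> (Suc n))) (snd (s n)) \<and>
      (\<forall>r. 0 < r \<and> r < t \<longrightarrow> fst (s n) + r *\<^sub>R snd (s n) \<notin> boundary A e)" for n
  proof -
    obtain t a where t: "0 < t" "a \<in> A" "fst (s (Suc n)) = fst (s n) + t *\<^sub>R snd (s n)"
      "fst (s (Suc n)) \<in> edge_interior e a" "snd (s (Suc n)) = reflect (edge_dir e a) (snd (s n))"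
      "\<forall>r. 0 < r \<and> r < t \<longrightarrow> fst (s n) + r *\<^sub>R snd (s n) \<in> poly_interior A e Q"
      using billiard_map_step[OF step[of n]] by blast
    have "a = \<alpha> (Suc n)"
      using s(2)[of "Suc n"] interior_only_edge[OF t(2) \<alpha> t(4)] interior_subset_seg
      by (fastforce simp: phase_on_edge_def)
    thus ?thesis using t interior_not_boundary by (intro exI[of _ t]) auto
  qed
  hence "\<forall>n. \<exists>t>0. fst (s (Suc n)) = fst (s n) + t *\<^sub>R snd (s n) \<and>
      snd (s (Suc n)) = reflect (edge_dir e (\<alpha> (Suc n))) (snd (s n)) \<and>
      (\<forall>r. 0 < r \<and> r < t \<longrightarrow> fst (s n) + r *\<^sub>R snd (s n) \<notin> boundary A e)" by blast
  from choice[OF this] obtain t where t: "\<And>n. t n > 0 \<and> fst (s (Suc n)) = fst (s n) + t n *\<^sub>R snd (s n) \<and>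
      snd (s (Suc n)) = reflect (edge_dir e (\<alpha> (Suc n))) (snd (s n)) \<and>
      (\<forall>r. 0 < r \<and> r < t n \<longrightarrow> fst (s n) + r *\<^sub>R snd (s n) \<notin> boundary A e)" by blast
  have "s n \<in> phase_on_edge A e Q (\<alpha> n)" for n using s(2) .
  hence "fst (s n) \<in> edge_interior e (\<alpha> n) \<and> norm (snd (s n)) = 1" for n
    by (simp add: phase_on_edge_def phase_space_def case_prod_unfold)
  hence "trajectory A e \<alpha> (\<lambda>n. fst (s n)) (\<lambda>n. snd (s n)) t"
    using t unfolding trajectory_def by blast
  moreover have "p = s 0" using s(1)[of 0] by simp
  ultimately show thesis using that by force
qed

end

section \<open>Lines in folded coordinates\<close>

text \<open>Closed edges, no orientation and no condition on obstacles: pseudo-lines are stable under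
  limits and convex combinations.\<close>

definition pseudo_line ::
  "('i \<Rightarrow> plane \<times> plane) \<Rightarrow> (nat \<Rightarrow> 'i) \<Rightarrow> nat \<Rightarrow> (nat \<Rightarrow> plane) \<Rightarrow> (nat \<Rightarrow> plane) \<Rightarrow> bool" where
  "pseudo_line e b m z D \<longleftrightarrow>
    (\<forall>j\<le>m. z j \<in> edge_seg e (b j)) \<and> norm (D 0) = 1 \<and>
    (\<forall>j<m. wedge (z (Suc j) - z j) (D j) = 0 \<and> D (Suc j) = reflect (edge_dir e (b (Suc j))) (D j))"

text \<open>The common direction sequence makes the two lines parallel, and the wedge with a unit
  direction is their distance. The absolute value leaves open which line is on which side, and
  asking only for a lower bound makes the notion monotone in the width.\<close>

definition strip :: "('i \<Rightarrow> plane \<times> plane) \<Rightarrow> (nat \<Rightarrow> 'i) \<Rightarrow> nat \<Rightarrow> real \<Rightarrow> bool" where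
  "strip e b m w \<longleftrightarrow>
    (\<exists>z z' D. pseudo_line e b m z D \<and> pseudo_line e b m z' D \<and> w \<le> \<bar>wedge (z' 0 - z 0) (D 0)\<bar>)"

text \<open>Pieces of genuine orbits. Openness of the edges and freedom from obstacles are lost in
  limits, which is why the weaker pseudo-lines are kept beside them.\<close>

definition flight_path ::
  "'i set \<Rightarrow> ('i \<Rightarrow> plane \<times> plane) \<Rightarrow> (nat \<Rightarrow> 'i) \<Rightarrow> nat \<Rightarrow> (nat \<Rightarrow> plane) \<Rightarrow> (nat \<Rightarrow> plane) \<Rightarrow>
    (nat \<Rightarrow> real) \<Rightarrow> bool" where
  "flight_path A e b m z D t \<longleftrightarrow>
    pseudo_line e b m z D \<and> (\<forall>j\<le>m. z j \<in> edge_interior e (b j)) \<and>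
    (\<forall>j<m. 0 < t j \<and> z (Suc j) = z j + t j *\<^sub>R D j \<and>
      (\<forall>r. 0 < r \<and> r < t j \<longrightarrow> z j + r *\<^sub>R D j \<notin> boundary A e))"

lemma pseudo_line_cong:
  assumes "pseudo_line e b m z D" "\<And>j. j \<le> m \<Longrightarrow> b j = b' j"
  shows "pseudo_line e b' m z D"
  using assms by (auto simp: pseudo_line_def)

lemma strip_cong:
  assumes "strip e b m w" "\<And>j. j \<le> m \<Longrightarrow> b j = b' j" shows "strip e b' m w"
proof -
  obtain z z' D where "pseudo_line e b m z D" "pseudo_line e b m z' D" "w \<le> \<bar>wedge (z' 0 - z 0) (D 0)\<bar>"
    using assms(1) unfolding strip_def by blast
  moreover from this(1,2) have "pseudo_line e b' m z D" "pseudo_line e b' m z' D"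
    using pseudo_line_cong assms(2) by metis+
  ultimately show ?thesis unfolding strip_def by blast
qed

lemma strip_antimono: "strip e b m w \<Longrightarrow> w' \<le> w \<Longrightarrow> strip e b m w'"
  unfolding strip_def by (meson order_trans)

lemma pseudo_line_uminus: "pseudo_line e b m z D \<Longrightarrow> pseudo_line e b m z (\<lambda>j. - D j)"
  by (simp add: pseudo_line_def reflect_uminus)

lemma pseudo_line_mono: "pseudo_line e b m z D \<Longrightarrow> m' \<le> m \<Longrightarrow> pseudo_line e b m' z D"
  by (auto simp: pseudo_line_def)

lemma flight_path_mono: "flight_path A e b m z D t \<Longrightarrow> m' \<le> m \<Longrightarrow> flight_path A e b m' z D t"
  by (auto simp: flight_path_def pseudo_line_def)

lemma flight_pathD:
  assumes "flight_path A e b m z D t"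
  shows "pseudo_line e b m z D" "j \<le> m \<Longrightarrow> z j \<in> edge_interior e (b j)"
    "j < m \<Longrightarrow> 0 < t j" "j < m \<Longrightarrow> z (Suc j) = z j + t j *\<^sub>R D j"
    "j < m \<Longrightarrow> 0 < r \<Longrightarrow> r < t j \<Longrightarrow> z j + r *\<^sub>R D j \<notin> boundary A e"
  using assms unfolding flight_path_def by auto

lemma trajectory_flight_path:
  assumes "trajectory A e \<alpha> x v t"
  shows "flight_path A e (\<lambda>j. \<alpha> (s + j)) m (\<lambda>j. x (s + j)) (\<lambda>j. v (s + j)) (\<lambda>j. t (s + j))"
  using assms
  unfolding trajectory_def flight_path_def pseudo_line_def
  by (auto simp: edge_interior_def edge_seg_def intro: subsetD[OF segment_open_subset_closed])

context edge_system begin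

lemma reflect_dir_norm: "a \<in> A \<Longrightarrow> norm (reflect (edge_dir e a) u) = norm u"
  using reflect_norm dir_nonzero by blast

lemma reflect_dir_reflect: "a \<in> A \<Longrightarrow> reflect (edge_dir e a) (reflect (edge_dir e a) u) = u"
  using reflect_reflect dir_nonzero by blast

lemma pseudo_line_norm:
  assumes "pseudo_line e b m z D" "\<And>j. j \<le> m \<Longrightarrow> b j \<in> A" "j \<le> m"
  shows "norm (D j) = 1"
  using assms(3)
proof (induction j)
  case 0 thus ?case using assms(1) by (simp add: pseudo_line_def)
next
  case (Suc j)
  hence "D (Suc j) = reflect (edge_dir e (b (Suc j))) (D j)" using assms(1) by (simp add: pseudo_line_def)
  thus ?case using Suc assms(2) by (simp add: reflect_dir_norm)
qed

lemma pseudo_line_shift: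
  assumes "pseudo_line e b m z D" "\<And>j. j \<le> m \<Longrightarrow> b j \<in> A" "a + M \<le> m"
  shows "pseudo_line e (\<lambda>j. b (a + j)) M (\<lambda>j. z (a + j)) (\<lambda>j. D (a + j))"
  using assms pseudo_line_norm[OF assms(1,2), of a] by (auto simp: pseudo_line_def)

text \<open>The reversed path leaves \<open>z (m - j)\<close> along the line by which it was
  reached, of direction \<open>D (m - Suc j)\<close>. Writing this direction as the reflection of
  \<open>D (m - j)\<close> also covers the final index \<open>j = m\<close>, where no earlier
  direction exists.\<close>

lemma pseudo_line_reverse:
  assumes "pseudo_line e b m z D" "\<And>j. j \<le> m \<Longrightarrow> b j \<in> A"
  shows "pseudo_line e (\<lambda>j. b (m - j)) m (\<lambda>j. z (m - j))
    (\<lambda>j. reflect (edge_dir e (b (m - j))) (D (m - j)))"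
proof -
  have n: "norm (reflect (edge_dir e (b m)) (D m)) = 1"
    using pseudo_line_norm[OF assms, of m] assms(2) by (simp add: reflect_dir_norm)
  have r: "reflect (edge_dir e (b (m - j))) (D (m - j)) = D (m - Suc j)" if "j < m" for j
  proof -
    have "D (m - j) = reflect (edge_dir e (b (m - j))) (D (m - Suc j))"
      using assms(1) that unfolding pseudo_line_def by (metis Suc_diff_Suc diff_less zero_less_Suc less_imp_Suc_add)
    thus ?thesis using that assms(2) by (simp add: reflect_dir_reflect)
  qed
  have "wedge (z (m - Suc j) - z (m - j)) (D (m - Suc j)) = 0" if "j < m" for j
  proof -
    have "wedge (z (m - j) - z (m - Suc j)) (D (m - Suc j)) = 0"
      using assms(1) that unfolding pseudo_line_def
      by (metis Suc_diff_Suc diff_less zero_less_Suc less_imp_Suc_add)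
    thus ?thesis by (simp add: wedge_diff)
  qed
  thus ?thesis using n r assms(1) by (simp add: pseudo_line_def)
qed

lemma flight_path_reverse:
  assumes "flight_path A e b m z D t" "\<And>j. j \<le> m \<Longrightarrow> b j \<in> A"
  shows "flight_path A e (\<lambda>j. b (m - j)) m (\<lambda>j. z (m - j))
    (\<lambda>j. - reflect (edge_dir e (b (m - j))) (D (m - j))) (\<lambda>j. t (m - Suc j))"
proof -
  note pl = flight_pathD(1)[OF assms(1)]
  have r: "reflect (edge_dir e (b (m - j))) (D (m - j)) = D (m - Suc j)" if "j < m" for j
  proof -
    have "D (m - j) = reflect (edge_dir e (b (m - j))) (D (m - Suc j))"
      using pl that unfolding pseudo_line_def by (metis Suc_diff_Suc diff_less zero_less_Suc less_imp_Suc_add)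
    thus ?thesis using that assms(2) by (simp add: reflect_dir_reflect)
  qed
  have s: "z (m - j) = z (m - Suc j) + t (m - Suc j) *\<^sub>R D (m - Suc j)" if "j < m" for j
    using flight_pathD(4)[OF assms(1), of "m - Suc j"] that by (simp add: Suc_diff_Suc)
  have "z (m - j) - r *\<^sub>R D (m - Suc j) \<notin> boundary A e"
    if "j < m" "0 < r" "r < t (m - Suc j)" for j r
  proof -
    have "z (m - Suc j) + (t (m - Suc j) - r) *\<^sub>R D (m - Suc j) \<notin> boundary A e"
      using that by (intro flight_pathD(5)[OF assms(1)]) auto
    thus ?thesis unfolding s[OF that(1)] by (simp add: algebra_simps)
  qed
  thus ?thesis
    unfolding flight_path_def
    using pseudo_line_uminus[OF pseudo_line_reverse[OF pl assms(2)]] r s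
      flight_pathD(2)[OF assms(1)] flight_pathD(3)[OF assms(1)]
    by simp
qed

text \<open>The two bounce points lie on one edge, so their difference is parallel to the mirror:
  its component across the direction changes sign, its component along the direction is
  kept.\<close>

lemma width_step:
  assumes "pseudo_line e b m z D" "pseudo_line e b m z' D'" "\<And>j. j \<le> m \<Longrightarrow> b j \<in> A" "j < m"
  shows "wedge (z' (Suc j) - z (Suc j)) (D' (Suc j)) = - wedge (z' (Suc j) - z (Suc j)) (D' j)"
    "(z' (Suc j) - z (Suc j)) \<bullet> D' (Suc j) = (z' (Suc j) - z (Suc j)) \<bullet> D' j"
proof -
  obtain c where c: "z' (Suc j) - z (Suc j) = c *\<^sub>R edge_dir e (b (Suc j))"
    using seg_diff_parallel assms(1,2,4) unfolding pseudo_line_def by (meson Suc_leI)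
  have r: "D' (Suc j) = reflect (edge_dir e (b (Suc j))) (D' j)"
    using assms(2,4) by (simp add: pseudo_line_def)
  have "edge_dir e (b (Suc j)) \<noteq> 0" using dir_nonzero[OF assms(3)] assms(4) by simp
  from wedge_reflect_parallel[OF this c] inner_reflect_parallel[OF this c]
  show "wedge (z' (Suc j) - z (Suc j)) (D' (Suc j)) = - wedge (z' (Suc j) - z (Suc j)) (D' j)"
    "(z' (Suc j) - z (Suc j)) \<bullet> D' (Suc j) = (z' (Suc j) - z (Suc j)) \<bullet> D' j"
    unfolding r by auto
qed

lemma width_signed:
  assumes "pseudo_line e b m z D" "pseudo_line e b m z' D" "\<And>j. j \<le> m \<Longrightarrow> b j \<in> A" "j \<le> m"
  shows "wedge (z' j - z j) (D j) = (-1) ^ j * wedge (z' 0 - z 0) (D 0)"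
  using assms(4)
proof (induction j)
  case (Suc j)
  have "wedge (z (Suc j) - z j) (D j) = 0" "wedge (z' (Suc j) - z' j) (D j) = 0"
    using assms(1,2) Suc by (auto simp: pseudo_line_def)
  hence "wedge (z' (Suc j) - z (Suc j)) (D j) = wedge (z' j - z j) (D j)"
    by (simp add: wedge_diff)
  thus ?case using Suc width_step(1)[OF assms(1,2,3), of j] by simp
qed simp

lemma width_abs:
  assumes "pseudo_line e b m z D" "pseudo_line e b m z' D" "\<And>j. j \<le> m \<Longrightarrow> b j \<in> A" "j \<le> m"
  shows "\<bar>wedge (z' j - z j) (D j)\<bar> = \<bar>wedge (z' 0 - z 0) (D 0)\<bar>"
  using width_signed[OF assms] by (simp add: abs_mult power_abs)

lemma strip_shift:
  assumes "strip e b m w" "\<And>j. j \<le> m \<Longrightarrow> b j \<in> A" "a + M \<le> m"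
  shows "strip e (\<lambda>j. b (a + j)) M w"
proof -
  obtain z z' D where 1: "pseudo_line e b m z D" "pseudo_line e b m z' D" "w \<le> \<bar>wedge (z' 0 - z 0) (D 0)\<bar>"
    using assms(1) unfolding strip_def by blast
  have "w \<le> \<bar>wedge (z' a - z a) (D a)\<bar>"
    using width_abs[OF 1(1,2) assms(2), of a] 1(3) assms(3) by simp
  thus ?thesis unfolding strip_def
    using pseudo_line_shift[OF 1(1) assms(2,3)] pseudo_line_shift[OF 1(2) assms(2,3)]
    by (intro exI conjI) (assumption | simp)+
qed

lemma strip_reverse:
  assumes "strip e b m w" "\<And>j. j \<le> m \<Longrightarrow> b j \<in> A"
  shows "strip e (\<lambda>j. b (m - j)) m w"
proof -
  obtain z z' D where 1: "pseudo_line e b m z D" "pseudo_line e b m z' D" "w \<le> \<bar>wedge (z' 0 - z 0) (D 0)\<bar>"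
    using assms(1) unfolding strip_def by blast
  have zm: "z m \<in> edge_seg e (b m)" "z' m \<in> edge_seg e (b m)"
    using 1 by (auto simp: pseudo_line_def)
  then obtain c where c: "z' m - z m = c *\<^sub>R edge_dir e (b m)" using seg_diff_parallel by blast
  have "\<bar>wedge (z' m - z m) (reflect (edge_dir e (b m)) (D m))\<bar> = \<bar>wedge (z' m - z m) (D m)\<bar>"
    using wedge_reflect_parallel[OF dir_nonzero c] assms(2) by simp
  hence "w \<le> \<bar>wedge (z' m - z m) (reflect (edge_dir e (b m)) (D m))\<bar>"
    using width_abs[OF 1(1,2) assms(2), of m] 1(3) by simp
  thus ?thesis unfolding strip_def
    using pseudo_line_reverse[OF 1(1) assms(2)] pseudo_line_reverse[OF 1(2) assms(2)]
    by (intro exI conjI) (assumption | simp)+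
qed

text \<open>Both sequences undergo the same reflections, so the angle between the lines is constant
  up to orientation. The values at index 0 are its sine and cosine.\<close>

lemma direction_invariants:
  assumes "pseudo_line e b m z D" "pseudo_line e b m z' D'" "\<And>j. j \<le> m \<Longrightarrow> b j \<in> A" "j \<le> m"
  shows "wedge (D' j) (D j) = (-1) ^ j * wedge (D' 0) (D 0)" "D' j \<bullet> D j = D' 0 \<bullet> D 0"
  using assms(4)
proof (induction j)
  case (Suc j)
  {
    case 1
    hence r: "D (Suc j) = reflect (edge_dir e (b (Suc j))) (D j)"
      "D' (Suc j) = reflect (edge_dir e (b (Suc j))) (D' j)" and d: "b (Suc j) \<in> A"
      using assms(1-3) by (auto simp: pseudo_line_def)
    show ?case unfolding r reflect_wedge[OF dir_nonzero[OF d]] using Suc 1 by simp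
  next
    case 2
    hence r: "D (Suc j) = reflect (edge_dir e (b (Suc j))) (D j)"
      "D' (Suc j) = reflect (edge_dir e (b (Suc j))) (D' j)" and d: "b (Suc j) \<in> A"
      using assms(1-3) by (auto simp: pseudo_line_def)
    show ?case unfolding r reflect_inner[OF dir_nonzero[OF d]] using Suc 2 by simp
  }
qed auto

text \<open>The offset is measured from the second line, so moving along that line contributes
  nothing. Each flight of the first line contributes its length times the sine of the constant
  angle, and bounces only alter the sign.\<close>

lemma crossing_drift:
  assumes "pseudo_line e b m z D" "pseudo_line e b m z' D'" "\<And>j. j \<le> m \<Longrightarrow> b j \<in> A"
    and "\<And>j. j < m \<Longrightarrow> z (Suc j) = z j + t j *\<^sub>R D j" and "j \<le> m"
  shows "wedge (z j - z' j) (D' j) =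
    (-1) ^ j * (wedge (z 0 - z' 0) (D' 0) - wedge (D' 0) (D 0) * sum t {..<j})"
  using assms(5)
proof (induction j)
  case (Suc j)
  hence jm: "j < m" by simp
  have "wedge (z' (Suc j) - z' j) (D' j) = 0" using assms(2) jm by (simp add: pseudo_line_def)
  hence "wedge (z (Suc j) - z' (Suc j)) (D' j) = wedge (z j - z' j) (D' j) - t j * wedge (D' j) (D j)"
    unfolding assms(4)[OF jm] using wedge_swap[of "D j" "D' j"]
    by (simp add: wedge_diff wedge_add)
  also have "\<dots> = (-1) ^ j * (wedge (z 0 - z' 0) (D' 0) - wedge (D' 0) (D 0) * sum t {..<Suc j})"
    using Suc jm direction_invariants(1)[OF assms(1,2,3), of j] by (simp add: algebra_simps)
  finally show ?case
    using width_step(1)[OF assms(2,1,3), of j] jm width_step(1)[OF assms(1,2,3), of j]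
    by (simp add: wedge_diff)
qed simp

text \<open>The companion estimate along the direction: it compares the two total lengths, the
  second one being projected by the cosine of the constant angle.\<close>

lemma parallel_drift:
  assumes "pseudo_line e b m z D" "pseudo_line e b m z' D'" "\<And>j. j \<le> m \<Longrightarrow> b j \<in> A"
    and "\<And>j. j < m \<Longrightarrow> z (Suc j) = z j + t j *\<^sub>R D j"
    and "\<And>j. j < m \<Longrightarrow> z' (Suc j) = z' j + t' j *\<^sub>R D' j" and "j \<le> m"
  shows "(z j - z' j) \<bullet> D j =
    (z 0 - z' 0) \<bullet> D 0 + sum t {..<j} - (D' 0 \<bullet> D 0) * sum t' {..<j}"
  using assms(6)
proof (induction j)
  case (Suc j)
  hence jm: "j < m" by simp
  have "D j \<bullet> D j = 1" using pseudo_line_norm[OF assms(1,3), of j] jm by (simp add: norm_eq_1)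
  hence "(z (Suc j) - z' (Suc j)) \<bullet> D j = (z j - z' j) \<bullet> D j + t j - t' j * (D' j \<bullet> D j)"
    unfolding assms(4)[OF jm] assms(5)[OF jm] by (simp add: inner_diff_left inner_add_left)
  also have "\<dots> = (z 0 - z' 0) \<bullet> D 0 + sum t {..<Suc j} - (D' 0 \<bullet> D 0) * sum t' {..<Suc j}"
    using Suc jm direction_invariants(2)[OF assms(1,2,3), of j] by (simp add: algebra_simps)
  finally show ?case using width_step(2)[OF assms(2,1,3), of j] jm by simp
qed simp

end

section \<open>Bounds on angles and lengths\<close>

context edge_system begin

definition size_bound :: real where
  "size_bound = (SOME D. D > 0 \<and>
    (\<forall>a\<in>A. \<forall>b\<in>A. \<forall>x\<in>edge_seg e a. \<forall>y\<in>edge_seg e b. norm (x - y) \<le> D))"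

lemma size_bound: "0 < size_bound"
    "a \<in> A \<Longrightarrow> b \<in> A \<Longrightarrow> x \<in> edge_seg e a \<Longrightarrow> y \<in> edge_seg e b \<Longrightarrow> norm (x - y) \<le> size_bound"
  using someI_ex[OF diameter_bound] unfolding size_bound_def by blast+

text \<open>At both ends of the word the two bounce points share an edge, so the offset is at most
  \<open>size_bound\<close> there, while in between it changes by the sine of the angle times the
  length.\<close>

lemma angle_bound:
  assumes "pseudo_line e b m z D" "pseudo_line e b m z' D'" "\<And>j. j \<le> m \<Longrightarrow> b j \<in> A"
    and "\<And>j. j < m \<Longrightarrow> z (Suc j) = z j + t j *\<^sub>R D j \<and> 0 < t j"
  shows "\<bar>wedge (D' 0) (D 0)\<bar> * sum t {..<m} \<le> 2 * size_bound"
proof -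
  have M: "\<bar>wedge (z j - z' j) (D' j)\<bar> \<le> size_bound" if "j \<le> m" for j
  proof -
    have "norm (z j - z' j) \<le> size_bound"
      using that assms by (intro size_bound(2)[of "b j" "b j"]) (auto simp: pseudo_line_def)
    thus ?thesis using abs_wedge_le[of "z j - z' j" "D' j"] pseudo_line_norm[OF assms(2,3) that] by simp
  qed
  have "wedge (z m - z' m) (D' m) =
    (-1) ^ m * (wedge (z 0 - z' 0) (D' 0) - wedge (D' 0) (D 0) * sum t {..<m})"
    using crossing_drift[OF assms(1-3), of t m] assms(4) by blast
  hence "\<bar>wedge (z m - z' m) (D' m)\<bar> = \<bar>wedge (z 0 - z' 0) (D' 0) - wedge (D' 0) (D 0) * sum t {..<m}\<bar>"
    by (simp add: abs_mult power_abs)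
  moreover have "\<bar>wedge (D' 0) (D 0) * sum t {..<m}\<bar> = \<bar>wedge (D' 0) (D 0)\<bar> * sum t {..<m}"
  proof -
    have "0 \<le> sum t {..<m}" using assms(4) by (intro sum_nonneg) (simp add: less_imp_le)
    thus ?thesis by (simp add: abs_mult)
  qed
  ultimately show ?thesis using M[of 0] M[of m] by linarith
qed

text \<open>A small sine does not exclude opposite directions. If the inner product were not
  positive, the first path would run ahead of the second by at least its own length, which is more
  than two points of one edge allow at the two ends.\<close>

lemma direction_inner_pos:
  assumes "pseudo_line e b m z D" "pseudo_line e b m z' D'" "\<And>j. j \<le> m \<Longrightarrow> b j \<in> A"
    and "\<And>j. j < m \<Longrightarrow> z (Suc j) = z j + t j *\<^sub>R D j"
    and "\<And>j. j < m \<Longrightarrow> z' (Suc j) = z' j + t' j *\<^sub>R D' j \<and> 0 < t' j"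
    and "sum t {..<m} > 2 * size_bound"
  shows "D' 0 \<bullet> D 0 > 0"
proof (rule ccontr)
  assume n: "\<not> D' 0 \<bullet> D 0 > 0"
  have M: "\<bar>(z j - z' j) \<bullet> D j\<bar> \<le> size_bound" if "j \<le> m" for j
  proof -
    have "norm (z j - z' j) \<le> size_bound"
      using that assms by (intro size_bound(2)[of "b j" "b j"]) (auto simp: pseudo_line_def)
    thus ?thesis using Cauchy_Schwarz_ineq2[of "z j - z' j" "D j"] pseudo_line_norm[OF assms(1,3) that] by simp
  qed
  have "(z m - z' m) \<bullet> D m = (z 0 - z' 0) \<bullet> D 0 + sum t {..<m} - (D' 0 \<bullet> D 0) * sum t' {..<m}"
    using parallel_drift[OF assms(1-4), of t' m] assms(5) by blast
  moreover have "(D' 0 \<bullet> D 0) * sum t' {..<m} \<le> 0"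
    using n assms(5) by (intro mult_nonpos_nonneg sum_nonneg) (auto simp: less_imp_le)
  ultimately show False using M[of 0] M[of m] assms(6) by linarith
qed

text \<open>A direction parallel to the edge would keep the flight on the boundary for a short time.
  A flight between two points of one edge is such a tangential flight.\<close>

lemma flight_nontangent:
  assumes "flight_path A e b m z D t" "j < m" "\<And>j. j \<le> m \<Longrightarrow> b j \<in> A"
  shows "wedge (edge_dir e (b j)) (D j) \<noteq> 0" "b (Suc j) \<noteq> b j"
proof -
  have bj: "b j \<in> A" and n: "norm (D j) = 1"
    using assms pseudo_line_norm[OF flight_pathD(1)[OF assms(1)] assms(3)] by auto
  show nt: "wedge (edge_dir e (b j)) (D j) \<noteq> 0"
  proof
    assume "wedge (edge_dir e (b j)) (D j) = 0"
    then obtain k where k: "edge_dir e (b j) = k *\<^sub>R D j" using wedge_zero_parallel n by blast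
    hence k0: "k \<noteq> 0" using dir_nonzero[OF bj] by auto
    have tj: "0 < t j" using flight_pathD(3) assms by blast
    have "z j \<in> open_segment (fst (e (b j))) (snd (e (b j)))"
      using flight_pathD(2)[OF assms(1), of j] assms(2) by (simp add: edge_interior_def)
    then obtain u where u: "0 < u" "u < 1"
      "z j = (1 - u) *\<^sub>R fst (e (b j)) + u *\<^sub>R snd (e (b j))"
      by (auto simp: in_segment)
    \<comment> \<open>Small enough to be inside the flight and, by the second bound, to leave the
      point on the edge on either side of \<open>z j\<close>.\<close>
    define s where "s = min (t j / 2) (\<bar>k\<bar> * min u (1 - u))"
    have s: "0 < s" "s < t j" "s \<le> \<bar>k\<bar> * min u (1 - u)" using tj k0 u by (auto simp: s_def)
    have "\<bar>s / k\<bar> \<le> min u (1 - u)"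
    proof -
      have "\<bar>s / k\<bar> = s / \<bar>k\<bar>" using s by (simp add: abs_divide)
      also have "\<dots> \<le> min u (1 - u)"
        using s(3) k0 by (subst pos_divide_le_eq) (simp, metis mult.commute)
      finally show ?thesis .
    qed
    hence uu: "0 \<le> u + s / k" "u + s / k \<le> 1" by linarith+
    have "D j = (1 / k) *\<^sub>R edge_dir e (b j)" using k k0 by simp
    hence "s *\<^sub>R D j = (s / k) *\<^sub>R edge_dir e (b j)" by simp
    hence "z j + s *\<^sub>R D j = fst (e (b j)) + (u + s / k) *\<^sub>R (snd (e (b j)) - fst (e (b j)))"
      unfolding u(3) by (simp only:) (simp add: algebra_simps)
    hence "z j + s *\<^sub>R D j \<in> edge_seg e (b j)"
      unfolding edge_seg_def using segment_affine_mem[OF uu] by metis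
    thus False using flight_pathD(5)[OF assms(1,2) s(1,2)] bj by (auto simp: boundary_def)
  qed
  show "b (Suc j) \<noteq> b j"
  proof
    assume eq: "b (Suc j) = b j"
    have "z (Suc j) \<in> edge_seg e (b j)" "z j \<in> edge_seg e (b j)"
      using flight_pathD(2)[OF assms(1)] assms(2) interior_subset_seg eq
      by (metis Suc_leI subsetD) (meson assms(1) assms(2) flight_pathD(2) interior_subset_seg less_imp_le subsetD)
    then obtain c where "z (Suc j) - z j = c *\<^sub>R edge_dir e (b j)" using seg_diff_parallel by blast
    hence c: "t j *\<^sub>R D j = c *\<^sub>R edge_dir e (b j)" using flight_pathD(4)[OF assms(1,2)] by simp
    have "t j * wedge (edge_dir e (b j)) (D j) = wedge (edge_dir e (b j)) (t j *\<^sub>R D j)" by simp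
    also have "\<dots> = 0" unfolding c by simp
    finally show False using nt flight_pathD(3)[OF assms(1,2)] by simp
  qed
qed

text \<open>Distinct edges may share a vertex, so one point of each can be arbitrarily close. Two
  pairs cannot be close at once when the points of a pair are \<open>d\<close> apart: in a minimum
  over a compact set with value zero, two distinct points and hence their midpoint would lie on both
  edges.\<close>

lemma distinct_edges_apart:
  assumes d: "d > 0"
  shows "\<exists>\<eta>>0. \<forall>a\<in>A. \<forall>b\<in>A. a \<noteq> b \<longrightarrow> (\<forall>x\<in>edge_seg e a. \<forall>y\<in>edge_seg e a.
    \<forall>x'\<in>edge_seg e b. \<forall>y'\<in>edge_seg e b. d \<le> norm (y - x) \<longrightarrow> \<eta> \<le> norm (x' - x) + norm (y' - y))"
proof -
  define P where "P p \<eta> \<longleftrightarrow> (\<forall>x\<in>edge_seg e (fst p). \<forall>y\<in>edge_seg e (fst p). \<forall>x'\<in>edge_seg e (snd p).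
      \<forall>y'\<in>edge_seg e (snd p). d \<le> norm (y - x) \<longrightarrow> \<eta> \<le> norm (x' - x) + norm (y' - y))" for p \<eta>
  have mono: "P p \<eta>'" if "P p \<eta>" "\<eta>' \<le> \<eta>" for p \<eta> \<eta>' using that unfolding P_def by (meson order_trans)
  have ex: "\<exists>\<eta>>0. P (a, b) \<eta>" if ab: "a \<in> A" "b \<in> A" "a \<noteq> b" for a b
  proof -
    define K where "K = (edge_seg e a \<times> edge_seg e a \<times> edge_seg e b \<times> edge_seg e b) \<inter>
      {p. d \<le> norm (fst (snd p) - fst p)}"
    define g :: "plane \<times> plane \<times> plane \<times> plane \<Rightarrow> real" where
      "g p = norm (fst (snd (snd p)) - fst p) + norm (snd (snd (snd p)) - fst (snd p))" for p
    have "compact (edge_seg e a \<times> edge_seg e a \<times> edge_seg e b \<times> edge_seg e b)"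
      unfolding edge_seg_def by (intro compact_Times compact_segment)
    moreover have "closed {p::plane \<times> plane \<times> plane \<times> plane. d \<le> norm (fst (snd p) - fst p)}"
      by (intro closed_Collect_le continuous_intros)
    ultimately have K: "compact K" unfolding K_def by (rule compact_Int_closed)
    have pos: "0 < g p" if "p \<in> K" for p
    proof (rule ccontr)
      assume "\<not> 0 < g p"
      hence 0: "fst (snd (snd p)) = fst p" "snd (snd (snd p)) = fst (snd p)"
        using norm_ge_zero[of "fst (snd (snd p)) - fst p"] norm_ge_zero[of "snd (snd (snd p)) - fst (snd p)"]
        unfolding g_def by (simp_all add: add_nonneg_eq_0_iff not_less antisym)
          (metis add_nonneg_eq_0_iff eq_iff_diff_eq_0 norm_eq_zero norm_ge_zero order_antisym add_nonneg_nonneg)+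
      define x where "x = fst p"
      define y where "y = fst (snd p)"
      have m: "x \<in> edge_seg e a" "y \<in> edge_seg e a" "x \<in> edge_seg e b" "y \<in> edge_seg e b" "x \<noteq> y"
        using that 0 d by (auto simp: K_def x_def y_def mem_Times_iff)
      have "midpoint x y \<in> open_segment x y" using m(5) by simp
      hence "midpoint x y \<in> edge_interior e a" "midpoint x y \<in> edge_interior e b"
        using open_seg_subset_interior m by blast+
      thus False using interior_only_edge[OF ab(1,2)] ab(3) interior_subset_seg by blast
    qed
    show ?thesis
    proof (cases "K = {}")
      case True
      thus ?thesis unfolding P_def by (intro exI[of _ 1]) (force simp: K_def)
    next
      case False
      have "continuous_on K g" unfolding g_def by (intro continuous_intros)
      then obtain p where p: "p \<in> K" "\<forall>q\<in>K. g p \<le> g q"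
        using continuous_attains_inf[OF K False] by blast
      have "g p \<le> norm (x' - x) + norm (y' - y)"
        if "x \<in> edge_seg e a" "y \<in> edge_seg e a" "x' \<in> edge_seg e b" "y' \<in> edge_seg e b" "d \<le> norm (y - x)"
        for x y x' y'
        using p(2)[rule_format, of "(x, y, x', y')"] that by (simp add: K_def g_def)
      hence "P (a, b) (g p)" unfolding P_def by simp
      thus ?thesis using pos[OF p(1)] by blast
    qed
  qed
  have "\<forall>p\<in>{p\<in>A \<times> A. fst p \<noteq> snd p}. \<exists>\<eta>. \<eta> > 0 \<and> P p \<eta>" using ex by force
  from bchoice[OF this] obtain \<eta>
    where \<eta>': "\<forall>p\<in>{p\<in>A \<times> A. fst p \<noteq> snd p}. \<eta> p > 0 \<and> P p (\<eta> p)" ..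
  note \<eta> = bspec[OF \<eta>']
  \<comment> \<open>The extra element 1 keeps the minimum meaningful when there is no pair of
    distinct edges.\<close>
  define E where "E = insert 1 (\<eta> ` {p\<in>A \<times> A. fst p \<noteq> snd p})"
  have fin: "finite E" unfolding E_def using finite_A by simp
  have "Min E \<in> E" using fin by (intro Min_in) (auto simp: E_def)
  hence "Min E > 0" using \<eta> by (auto simp: E_def)
  moreover have "Min E \<le> \<eta> (a, b)" if "a \<in> A" "b \<in> A" "a \<noteq> b" for a b
    using fin that by (intro Min_le) (auto simp: E_def)
  moreover from this have "P (a, b) (Min E)" if "a \<in> A" "b \<in> A" "a \<noteq> b" for a b
    using mono[of "(a, b)" "\<eta> (a, b)" "Min E"] \<eta>[of "(a, b)"] that by simp
  ultimately show ?thesis unfolding P_def by (intro exI[of _ "Min E"]) simp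
qed

text \<open>Two parallel flight paths at distance \<open>d\<close> cannot both be short between two consecutive
  distinct edges, so their lengths grow linearly in the number of bounces.\<close>

lemma flight_length:
  assumes d: "d > 0"
  shows "\<exists>\<eta>>0. \<forall>b m z z' D t t'. (\<forall>j\<le>m. b j \<in> A) \<longrightarrow> flight_path A e b m z D t \<longrightarrow>
    flight_path A e b m z' D t' \<longrightarrow> d \<le> \<bar>wedge (z' 0 - z 0) (D 0)\<bar> \<longrightarrow>
    \<eta> * m - size_bound \<le> sum t {..<m}"
proof -
  obtain \<eta> where \<eta>: "\<eta> > 0" and ap: "\<And>a b x y x' y'. a \<in> A \<Longrightarrow> b \<in> A \<Longrightarrow> a \<noteq> b \<Longrightarrow> x \<in> edge_seg e a \<Longrightarrow>
      y \<in> edge_seg e a \<Longrightarrow> x' \<in> edge_seg e b \<Longrightarrow> y' \<in> edge_seg e b \<Longrightarrow> d \<le> norm (y - x) \<Longrightarrow>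
      \<eta> \<le> norm (x' - x) + norm (y' - y)"
    using distinct_edges_apart[OF d] by blast
  have "\<eta> / 2 * m - size_bound \<le> sum t {..<m}"
    if b: "\<forall>j\<le>m. b j \<in> A" and f: "flight_path A e b m z D t" "flight_path A e b m z' D t'"
      and w: "d \<le> \<bar>wedge (z' 0 - z 0) (D 0)\<bar>" for b m z z' D t t'
  proof -
    note pl = flight_pathD(1)[OF f(1)] flight_pathD(1)[OF f(2)]
    have bA: "\<And>j. j \<le> m \<Longrightarrow> b j \<in> A" using b by blast
    have nD: "norm (D j) = 1" if "j \<le> m" for j using pseudo_line_norm[OF pl(1) bA that] .
    have seg: "z j \<in> edge_seg e (b j)" "z' j \<in> edge_seg e (b j)" if "j \<le> m" for j
      using pl that by (auto simp: pseudo_line_def)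
    have "\<eta> \<le> t j + t' j" if j: "j < m" for j
    proof -
      have "d \<le> \<bar>wedge (z' j - z j) (D j)\<bar>" using width_abs[OF pl bA, of j] w j by simp
      also have "\<dots> \<le> norm (z' j - z j)" using abs_wedge_le[of "z' j - z j" "D j"] nD j by simp
      finally have "\<eta> \<le> norm (z (Suc j) - z j) + norm (z' (Suc j) - z' j)"
        using flight_nontangent(2)[OF f(1) j bA] j bA seg by (intro ap[of "b j" "b (Suc j)"]) auto
      thus ?thesis using flight_pathD(3,4)[OF f(1) j] flight_pathD(3,4)[OF f(2) j] nD[of j] j by simp
    qed
    hence "(\<Sum>j<m. \<eta>) \<le> (\<Sum>j<m. t j + t' j)" by (intro sum_mono) auto
    hence 1: "\<eta> * m \<le> sum t {..<m} + sum t' {..<m}" by (simp add: sum.distrib mult.commute)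
    have M: "\<bar>(z j - z' j) \<bullet> D j\<bar> \<le> size_bound" if "j \<le> m" for j
      using Cauchy_Schwarz_ineq2[of "z j - z' j" "D j"] nD[OF that]
        size_bound(2)[OF bA[OF that] bA[OF that] seg[OF that]] by simp
    \<comment> \<open>With equal directions the cosine is 1, so the two lengths differ by at most
      \<open>2 * size_bound\<close>. The bound on their sum therefore gives one of them at least
      half of it, which is the origin of \<open>\<eta> / 2\<close>.\<close>
    have "D 0 \<bullet> D 0 = 1" using nD[of 0] by (simp add: norm_eq_1)
    moreover have "(z m - z' m) \<bullet> D m = (z 0 - z' 0) \<bullet> D 0 + sum t {..<m} - (D 0 \<bullet> D 0) * sum t' {..<m}"
      using parallel_drift[OF pl bA, of t t' m] flight_pathD(4)[OF f(1)] flight_pathD(4)[OF f(2)] by blast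
    ultimately have "sum t' {..<m} \<le> sum t {..<m} + 2 * size_bound"
      using M[of 0] M[of m] by simp
    thus ?thesis using 1 by simp
  qed
  moreover have "\<eta> / 2 > 0" using \<eta> by simp
  ultimately show ?thesis by blast
qed

end

section \<open>Trajectories with a prescribed coding: infinite length and common directions\<close>

context edge_system begin

context
  fixes \<alpha> :: "nat \<Rightarrow> 'i"
  assumes \<alpha>: "\<And>n. \<alpha> n \<in> A"
begin

lemma trajectoryD:
  assumes "trajectory A e \<alpha> x v t"
  shows "x n \<in> edge_interior e (\<alpha> n)" "x n \<in> edge_seg e (\<alpha> n)" "norm (v n) = 1" "0 < t n"
    "x (Suc n) = x n + t n *\<^sub>R v n"
    "v (Suc n) = reflect (edge_dir e (\<alpha> (Suc n))) (v n)"
    "0 < r \<Longrightarrow> r < t n \<Longrightarrow> x n + r *\<^sub>R v n \<notin> boundary A e"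
proof -
  have *: "x n \<in> edge_interior e (\<alpha> n) \<and> norm (v n) = 1 \<and> 0 < t n \<and>
      x (Suc n) = x n + t n *\<^sub>R v n \<and> v (Suc n) = reflect (edge_dir e (\<alpha> (Suc n))) (v n) \<and>
      (\<forall>r. 0 < r \<and> r < t n \<longrightarrow> x n + r *\<^sub>R v n \<notin> boundary A e)"
    using assms unfolding trajectory_def by (rule spec)
  show "x n \<in> edge_interior e (\<alpha> n)" "norm (v n) = 1" "0 < t n" "x (Suc n) = x n + t n *\<^sub>R v n"
    "v (Suc n) = reflect (edge_dir e (\<alpha> (Suc n))) (v n)" using * by blast+
  thus "x n \<in> edge_seg e (\<alpha> n)" using interior_subset_seg by blast
  show "0 < r \<Longrightarrow> r < t n \<Longrightarrow> x n + r *\<^sub>R v n \<notin> boundary A e" using * by blast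
qed

lemma trajectory_nontangent:
  assumes "trajectory A e \<alpha> x v t"
  shows "wedge (edge_dir e (\<alpha> n)) (v n) \<noteq> 0" "\<alpha> (Suc n) \<noteq> \<alpha> n"
  using flight_nontangent[OF trajectory_flight_path[OF assms, of n 1], of 0] \<alpha> by auto

text \<open>If the total length were finite, the bounce points would converge to a vertex; the distance of
  the trajectory's line from that vertex is invariant, hence zero, so the trajectory would be
  tangent to the edges.\<close>

lemma trajectory_length_unbounded:
  assumes T: "trajectory A e \<alpha> x v t"
  shows "\<exists>n. B < sum t {..<n}"
proof (rule ccontr)
  note tr = trajectoryD[OF T]
  assume "\<not> ?thesis"
  hence "sum t {..<n} \<le> B" for n by (simp add: not_less)
  hence "summable t" using tr(4) by (intro summableI_nonneg_bounded[of t B]) (auto simp: less_imp_le)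
  hence "summable (\<lambda>n. t n *\<^sub>R v n)"
    using tr(3,4) by (intro summable_norm_cancel[of "\<lambda>n. t n *\<^sub>R v n"]) (simp add: less_imp_le)
  hence "convergent (\<lambda>n. \<Sum>i<n. t i *\<^sub>R v i)" by (simp add: summable_iff_convergent)
  then obtain S where S: "(\<lambda>n. \<Sum>i<n. t i *\<^sub>R v i) \<longlonglongrightarrow> S" by (auto simp: convergent_def)
  have "x n = x 0 + (\<Sum>i<n. t i *\<^sub>R v i)" for n by (induction n) (auto simp: tr(5))
  moreover define X where "X = x 0 + S"
  ultimately have X: "x \<longlonglongrightarrow> X" using tendsto_add[OF tendsto_const S, of "x 0"] by (metis (no_types, lifting) ext)
  \<comment> \<open>There are finitely many closed edges, so from some index on every edge that is
    hit contains the limit point.\<close>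
  have "\<forall>a\<in>A. eventually (\<lambda>n. X \<notin> edge_seg e a \<longrightarrow> x n \<notin> edge_seg e a) sequentially"
  proof
    fix a
    have "open (- edge_seg e a)" by (simp add: edge_seg_def open_Compl)
    thus "eventually (\<lambda>n. X \<notin> edge_seg e a \<longrightarrow> x n \<notin> edge_seg e a) sequentially"
      using topological_tendstoD[OF X, of "- edge_seg e a"] by (cases "X \<in> edge_seg e a") auto
  qed
  hence "eventually (\<lambda>n. \<forall>a\<in>A. X \<notin> edge_seg e a \<longrightarrow> x n \<notin> edge_seg e a) sequentially"
    by (rule eventually_ball_finite[OF finite_A])
  then obtain N where N: "\<And>n. n \<ge> N \<Longrightarrow> X \<in> edge_seg e (\<alpha> n)"
    using tr(2) \<alpha> unfolding eventually_sequentially by blast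
  have const: "\<bar>wedge (x (N + k) - X) (v (N + k))\<bar> = \<bar>wedge (x N - X) (v N)\<bar>" for k
  proof (induction k)
    case (Suc k)
    obtain c where c: "x (Suc (N + k)) - X = c *\<^sub>R edge_dir e (\<alpha> (Suc (N + k)))"
      using seg_diff_parallel[OF tr(2)[of "Suc (N + k)"] N] by auto
    have "wedge (x (Suc (N + k)) - X) (v (Suc (N + k))) = - wedge (x (Suc (N + k)) - X) (v (N + k))"
      unfolding tr(6) by (rule wedge_reflect_parallel[OF dir_nonzero[OF \<alpha>] c])
    also have "\<dots> = - wedge (x (N + k) - X) (v (N + k))"
      by (simp add: tr(5) wedge_diff wedge_add)
    finally show ?case using Suc by simp
  qed simp
  have "\<bar>wedge (x N - X) (v N)\<bar> \<le> norm (x (N + k) - X)" for k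
    using abs_wedge_le[of "x (N + k) - X" "v (N + k)"] tr(3) const[of k] by simp
  moreover have "(\<lambda>k. norm (x (N + k) - X)) \<longlonglongrightarrow> 0"
    using LIMSEQ_ignore_initial_segment[OF X, of N] by (simp add: tendsto_norm_zero_iff LIM_zero_iff add.commute)
  ultimately have "\<bar>wedge (x N - X) (v N)\<bar> \<le> 0"
    by (intro LIMSEQ_le_const) auto
  hence w: "wedge (x N - X) (v N) = 0" by simp
  \<comment> \<open>Consecutive edges are distinct and both contain \<open>X\<close>, so
    \<open>X\<close> is a vertex; the bounce points, interior to their edges, differ from
    it.\<close>
  have "X \<in> edge_ends e (\<alpha> N)"
    using meet_at_ends[OF \<alpha> \<alpha>, of "Suc N" N] trajectory_nontangent(2)[OF T, of N] N[of N] N[of "Suc N"] by auto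
  hence ne: "x N \<noteq> X" using tr(1)[of N] by (auto simp: edge_ends_def edge_interior_def open_segment_def)
  obtain c where c: "x N - X = c *\<^sub>R edge_dir e (\<alpha> N)"
    using seg_diff_parallel[OF tr(2) N] by blast
  hence "c \<noteq> 0" using ne by auto
  thus False using w trajectory_nontangent(1)[OF T, of N] unfolding c by simp
qed

lemma same_coding_same_direction:
  assumes T: "trajectory A e \<alpha> x v t" "trajectory A e \<alpha> y w s"
  shows "v n = w n"
proof -
  have f: "flight_path A e \<alpha> m x v t" "flight_path A e \<alpha> m y w s" for m
    using trajectory_flight_path[OF T(1), of 0 m] trajectory_flight_path[OF T(2), of 0 m] by simp_all
  note pl = flight_pathD(1)[OF f(1)] flight_pathD(1)[OF f(2)]
  note tr = trajectoryD[OF T(1)] and tr' = trajectoryD[OF T(2)]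
  define \<kappa> where "\<kappa> = \<bar>wedge (w 0) (v 0)\<bar>"
  have k: "\<kappa> * sum t {..<m} \<le> 2 * size_bound" for m
    unfolding \<kappa>_def using tr \<alpha> by (intro angle_bound[OF pl]) auto
  have "\<kappa> = 0"
  proof (rule ccontr)
    assume "\<kappa> \<noteq> 0"
    hence k0: "\<kappa> > 0" by (simp add: \<kappa>_def)
    obtain m where "2 * size_bound / \<kappa> < sum t {..<m}" using trajectory_length_unbounded[OF T(1)] by blast
    thus False using k[of m] k0 by (simp add: field_simps)
  qed
  hence 0: "wedge (v 0) (w 0) = 0" using wedge_swap[of "v 0" "w 0"] by (simp add: \<kappa>_def)
  \<comment> \<open>The vanishing sine leaves equal or opposite directions; a long enough common
    word excludes the latter.\<close>
  obtain m where "2 * size_bound < sum t {..<m}" using trajectory_length_unbounded[OF T(1)] by blast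
  hence "w 0 \<bullet> v 0 > 0" using tr tr' \<alpha> by (intro direction_inner_pos[OF pl]) auto
  hence "v 0 = w 0" using unit_parallel_eq[OF 0] tr(3) tr'(3) by (simp add: inner_commute)
  thus ?thesis by (induction n) (auto simp: tr(6) tr'(6))
qed

end

end

section \<open>Limits of long strips\<close>

lemma constant_subsequence:
  fixes f :: "nat \<Rightarrow> 'w"
  assumes "finite F" "\<And>k. f k \<in> F"
  shows "\<exists>r c. strict_mono (r :: nat \<Rightarrow> nat) \<and> (\<forall>k. f (r k) = c)"
proof -
  have "finite (range f)" using assms by (meson finite_subset image_subsetI)
  then obtain k0 where "infinite {k. f k = f k0}"
    using pigeonhole_infinite[of UNIV f] by auto
  then obtain r :: "nat \<Rightarrow> nat" where "strict_mono r" "\<And>n. r n \<in> {k. f k = f k0}"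
    using infinite_enumerate by blast
  thus ?thesis by blast
qed

lemma bounded_family_subsequence:
  fixes f :: "'j \<Rightarrow> nat \<Rightarrow> 'v::heine_borel"
  assumes "finite I" "\<And>i. i \<in> I \<Longrightarrow> bounded (range (f i))"
  shows "\<exists>r l. strict_mono (r :: nat \<Rightarrow> nat) \<and> (\<forall>i\<in>I. (f i \<circ> r) \<longlonglongrightarrow> l i)"
  using assms
proof (induction I rule: finite_induct)
  case empty
  show ?case by (intro exI[of _ id]) (auto simp: strict_mono_def)
next
  case (insert i I)
  have "\<exists>r l. strict_mono (r :: nat \<Rightarrow> nat) \<and> (\<forall>i\<in>I. (f i \<circ> r) \<longlonglongrightarrow> l i)"
    by (rule insert.IH) (use insert.prems in blast)
  then obtain r l where r: "strict_mono (r :: nat \<Rightarrow> nat)" "\<forall>i\<in>I. (f i \<circ> r) \<longlonglongrightarrow> l i" by blast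
  have "bounded (range (f i \<circ> r))"
    using insert.prems[of i] by (auto intro: bounded_subset)
  then obtain l' r' where r': "strict_mono (r' :: nat \<Rightarrow> nat)" "((f i \<circ> r) \<circ> r') \<longlonglongrightarrow> l'"
    using bounded_imp_convergent_subsequence by blast
  have "(f j \<circ> (r \<circ> r')) \<longlonglongrightarrow> (l(i := l')) j" if "j \<in> insert i I" for j
  proof (cases "j = i")
    case True
    thus ?thesis using r'(2) by (simp add: o_assoc)
  next
    case False
    hence "(f j \<circ> r) \<longlonglongrightarrow> l j" using that r(2) by auto
    thus ?thesis using LIMSEQ_subseq_LIMSEQ[OF _ r'(1)] False by (simp add: o_assoc)
  qed
  thus ?case using strict_mono_o[OF r(1) r'(1)] by blast
qed

context edge_system begin

lemma boundary_norm_bound: "\<exists>B\<ge>1. \<forall>a\<in>A. \<forall>x\<in>edge_seg e a. norm x \<le> B"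
proof -
  have "bounded (boundary A e)"
    unfolding boundary_def edge_seg_def
    using finite_A by (intro bounded_UN) (auto simp: bounded_closed_segment)
  then obtain B where "\<forall>x\<in>boundary A e. norm x \<le> B" by (auto simp: bounded_iff)
  thus ?thesis by (intro exI[of _ "max 1 B"]) (auto simp: boundary_def max.coboundedI2)
qed

lemma closed_edge_limit:
  assumes "\<And>k. f k \<in> edge_seg e a" "f \<longlonglongrightarrow> l" shows "l \<in> edge_seg e a"
  using closed_sequentially[of "edge_seg e a" f l] assms by (simp add: edge_seg_def)

lemma pseudo_line_direction_cong:
  assumes "pseudo_line e b m z D" "\<And>j. j \<le> m \<Longrightarrow> D j = D' j"
  shows "pseudo_line e b m z D'"
  using assms(1) assms(2)[symmetric] unfolding pseudo_line_def by simp

text \<open>Limits of pseudo-lines with a common limit direction are parallel, hence bound a strip over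
  every word that recurs in the limit.\<close>

lemma limit_offset_le:
  fixes w :: "nat \<Rightarrow> nat \<Rightarrow> 'i"
  assumes wA: "\<And>k j. j \<le> k \<Longrightarrow> w k j \<in> A"
    and UB: "\<And>\<epsilon>. \<epsilon> > 0 \<Longrightarrow> \<exists>m k0. \<forall>k\<ge>k0. \<not> strip e (w k) m (W + \<epsilon>)"
    and pl: "\<And>k. pseudo_line e (w k) k (z k) (D k)" "\<And>k. pseudo_line e (w k) k (z' k) (D' k)"
    and lim: "(\<lambda>k. z k 0) \<longlonglongrightarrow> x" "(\<lambda>k. z' k 0) \<longlonglongrightarrow> x'"
      "(\<lambda>k. D k 0) \<longlonglongrightarrow> u" "(\<lambda>k. D' k 0) \<longlonglongrightarrow> u"
  shows "\<bar>wedge (x' - x) u\<bar> \<le> W"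
proof (rule ccontr)
  assume asm: "\<not> ?thesis"
  define \<epsilon> where "\<epsilon> = \<bar>wedge (x' - x) u\<bar> - W"
  have "\<epsilon> > 0" using asm by (simp add: \<epsilon>_def)
  then obtain m k0 where mk: "\<And>k. k \<ge> k0 \<Longrightarrow> \<not> strip e (w k) m (W + \<epsilon>)" using UB by blast
  \<comment> \<open>Skips the words that are too short or precede \<open>k0\<close>. Along a further
    subsequence the prefix of \<open>Suc m\<close> letters is a single word \<open>b\<close>, and
    compactness yields limits of all the bounce points and directions over it.\<close>
  define s where "s k = k + max k0 m" for k
  have sm: "strict_mono s" by (simp add: s_def strict_mono_def)
  have fin: "finite {xs. set xs \<subseteq> A \<and> length xs = Suc m}" using finite_A by (rule finite_lists_length_eq)
  have mem: "map (w (s k)) [0..<Suc m] \<in> {xs. set xs \<subseteq> A \<and> length xs = Suc m}" for k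
    using wA[of _ "s k"] by (auto simp: s_def)
  obtain r0 :: "nat \<Rightarrow> nat" and c where r0: "strict_mono r0" "\<And>k. map (w (s (r0 k))) [0..<Suc m] = c"
    using constant_subsequence[OF fin, of "\<lambda>k. map (w (s k)) [0..<Suc m]", OF mem] by blast
  define r1 where "r1 = s \<circ> r0"
  define b where "b j = c ! j" for j
  have wb: "w (r1 k) j = b j" if "j \<le> m" for k j
    using r0(2)[of k, symmetric] that unfolding b_def r1_def by (simp del: upt_Suc)
  have r1: "strict_mono r1" unfolding r1_def using sm r0(1) by (rule strict_mono_o)
  have r1ge: "r1 k \<ge> k0" "r1 k \<ge> m" for k by (auto simp: r1_def s_def)
  have bA: "b j \<in> A" if "j \<le> m" for j using wb[OF that, of 0] wA[of j "r1 0"] r1ge(2)[of 0] that by auto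
  have plm: "pseudo_line e b m (z (r1 k)) (D (r1 k))" "pseudo_line e b m (z' (r1 k)) (D' (r1 k))" for k
    using pseudo_line_cong[OF pseudo_line_mono[OF pl(1)[of "r1 k"] r1ge(2)], of b] 
      pseudo_line_cong[OF pseudo_line_mono[OF pl(2)[of "r1 k"] r1ge(2)], of b] wb by auto
  obtain B where B: "B \<ge> 1" "\<And>a x. a \<in> A \<Longrightarrow> x \<in> edge_seg e a \<Longrightarrow> norm x \<le> B"
    using boundary_norm_bound by blast
  define f where "f j k = (z (r1 k) j, D (r1 k) j, z' (r1 k) j, D' (r1 k) j)" for j k
  have "bounded (range (f j))" if "j \<in> {..m}" for j
  proof -
    have j: "j \<le> m" using that by simp
    have "f j k \<in> cball 0 B \<times> cball 0 B \<times> cball 0 B \<times> cball 0 B" for k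
    proof -
      have "z (r1 k) j \<in> edge_seg e (b j)" "z' (r1 k) j \<in> edge_seg e (b j)"
        using plm[of k] j by (auto simp: pseudo_line_def)
      hence "norm (z (r1 k) j) \<le> B" "norm (z' (r1 k) j) \<le> B" using B(2)[OF bA[OF j]] by auto
      thus ?thesis
        using pseudo_line_norm[OF plm(1)[of k] bA j] pseudo_line_norm[OF plm(2)[of k] bA j] B(1)
        by (simp add: f_def)
    qed
    moreover have "bounded (cball (0::plane) B \<times> cball (0::plane) B \<times> cball (0::plane) B \<times> cball (0::plane) B)"
      by (intro bounded_Times bounded_cball)
    ultimately show ?thesis by (meson bounded_subset image_subsetI)
  qed
  from bounded_family_subsequence[of "{..m}" f, OF finite_atMost this]
  obtain r2 :: "nat \<Rightarrow> nat" and l where r2: "strict_mono r2" and l: "\<And>j. j \<le> m \<Longrightarrow> (f j \<circ> r2) \<longlonglongrightarrow> l j" by auto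
  define R where "R = r1 \<circ> r2"
  have R: "strict_mono R" unfolding R_def using r1 r2 by (rule strict_mono_o)
  define Z \<Delta> Z' \<Delta>' where "Z j = fst (l j)" and "\<Delta> j = fst (snd (l j))"
    and "Z' j = fst (snd (snd (l j)))" and "\<Delta>' j = snd (snd (snd (l j)))" for j
  have L: "(\<lambda>k. z (R k) j) \<longlonglongrightarrow> Z j" "(\<lambda>k. D (R k) j) \<longlonglongrightarrow> \<Delta> j"
      "(\<lambda>k. z' (R k) j) \<longlonglongrightarrow> Z' j" "(\<lambda>k. D' (R k) j) \<longlonglongrightarrow> \<Delta>' j" if "j \<le> m" for j
  proof -
    have *: "(\<lambda>k. f j (r2 k)) \<longlonglongrightarrow> l j" using l[OF that] by (simp add: o_def)
    show "(\<lambda>k. z (R k) j) \<longlonglongrightarrow> Z j" using tendsto_fst[OF *] by (simp add: f_def R_def Z_def)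
    show "(\<lambda>k. D (R k) j) \<longlonglongrightarrow> \<Delta> j" using tendsto_fst[OF tendsto_snd[OF *]] by (simp add: f_def R_def \<Delta>_def)
    show "(\<lambda>k. z' (R k) j) \<longlonglongrightarrow> Z' j"
      using tendsto_fst[OF tendsto_snd[OF tendsto_snd[OF *]]] by (simp add: f_def R_def Z'_def)
    show "(\<lambda>k. D' (R k) j) \<longlonglongrightarrow> \<Delta>' j"
      using tendsto_snd[OF tendsto_snd[OF tendsto_snd[OF *]]] by (simp add: f_def R_def \<Delta>'_def)
  qed
  have lim0: "Z 0 = x" "Z' 0 = x'" "\<Delta> 0 = u" "\<Delta>' 0 = u"
    using L[of 0] LIMSEQ_subseq_LIMSEQ[OF lim(1) R] LIMSEQ_subseq_LIMSEQ[OF lim(2) R]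
      LIMSEQ_subseq_LIMSEQ[OF lim(3) R] LIMSEQ_subseq_LIMSEQ[OF lim(4) R]
    by (auto simp: o_def intro: LIMSEQ_unique)
  have limit_line: "pseudo_line e b m Z \<Delta>"
    if p: "\<And>k. pseudo_line e b m (z (R k)) (D (R k))"
      and L: "\<And>j. j \<le> m \<Longrightarrow> (\<lambda>k. z (R k) j) \<longlonglongrightarrow> Z j" "\<And>j. j \<le> m \<Longrightarrow> (\<lambda>k. D (R k) j) \<longlonglongrightarrow> \<Delta> j"
    for z D Z \<Delta>
  proof -
    have "Z j \<in> edge_seg e (b j)" if "j \<le> m" for j
      using p that by (intro closed_edge_limit[OF _ L(1)[OF that]]) (auto simp: pseudo_line_def)
    moreover have "norm (\<Delta> 0) = 1"
      using tendsto_norm[OF L(2)[of 0]] p by (simp add: pseudo_line_def LIMSEQ_const_iff)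
    moreover have "wedge (Z (Suc j) - Z j) (\<Delta> j) = 0" if "j < m" for j
    proof -
      have "(\<lambda>k. wedge (z (R k) (Suc j) - z (R k) j) (D (R k) j)) \<longlonglongrightarrow> wedge (Z (Suc j) - Z j) (\<Delta> j)"
        using that by (intro tendsto_intros L) auto
      thus ?thesis using p that by (simp add: pseudo_line_def LIMSEQ_const_iff)
    qed
    moreover have "\<Delta> (Suc j) = reflect (edge_dir e (b (Suc j))) (\<Delta> j)" if "j < m" for j
    proof -
      have "(\<lambda>k. reflect (edge_dir e (b (Suc j))) (D (R k) j)) \<longlonglongrightarrow> reflect (edge_dir e (b (Suc j))) (\<Delta> j)"
        using that by (intro tendsto_reflect L) auto
      moreover have "(\<lambda>k. D (R k) (Suc j)) = (\<lambda>k. reflect (edge_dir e (b (Suc j))) (D (R k) j))"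
        using p that by (auto simp: pseudo_line_def)
      ultimately show ?thesis using L(2)[of "Suc j"] that LIMSEQ_unique by (metis Suc_leI)
    qed
    ultimately show ?thesis by (simp add: pseudo_line_def)
  qed
  have plR: "pseudo_line e b m (z (R k)) (D (R k))" "pseudo_line e b m (z' (R k)) (D' (R k))" for k
    using plm[of "r2 k"] by (simp_all add: R_def)
  have 1: "pseudo_line e b m Z \<Delta>" by (rule limit_line[of z D Z \<Delta>, OF plR(1) L(1,2)])
  have 2: "pseudo_line e b m Z' \<Delta>'" by (rule limit_line[of z' D' Z' \<Delta>', OF plR(2) L(3,4)])
  \<comment> \<open>Equal initial directions and the same mirrors give equal directions throughout,
    so the two limit lines are the sides of one strip of width
    \<open>W + \<epsilon>\<close>.\<close>
  have "\<Delta>' j = \<Delta> j" if "j \<le> m" for j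
    using that
  proof (induction j)
    case (Suc j)
    thus ?case using 1 2 by (simp add: pseudo_line_def)
  qed (simp add: lim0)
  hence "pseudo_line e b m Z' \<Delta>" using pseudo_line_direction_cong[OF 2] by blast
  hence "strip e b m (W + \<epsilon>)"
    unfolding strip_def using 1 lim0 by (intro exI[of _ Z] exI[of _ Z'] exI[of _ \<Delta>]) (simp add: \<epsilon>_def)
  hence "strip e (w (r1 0)) m (W + \<epsilon>)" using strip_cong[of e b m _ "w (r1 0)"] wb by simp
  thus False using mk r1ge by blast
qed

end

section \<open>Rods\<close>

context edge_system begin

lemma same_offset_eq:
  assumes "x \<in> edge_seg e a" "y \<in> edge_seg e a" "wedge (x - y) u = 0" "wedge (edge_dir e a) u \<noteq> 0"
  shows "x = y"
proof -
  obtain c where c: "x - y = c *\<^sub>R edge_dir e a" using seg_diff_parallel assms by blast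
  hence "c = 0" using assms(3,4) by simp
  thus ?thesis using c by simp
qed

text \<open>Over a range of offsets the two edges are graphs with heights measured along
  \<open>u\<close>. A change of sign of the height difference would make them meet at an interior
  point of the edge \<open>a\<close>.\<close>

lemma edges_do_not_cross:
  assumes "a \<in> A" "b \<in> A" "a \<noteq> b" "closed_segment p q \<subseteq> edge_interior e a" "p' \<in> edge_seg e b" "q' \<in> edge_seg e b"
    and "p' - p = f0 *\<^sub>R u" "q' - q = f1 *\<^sub>R u" "0 < f1"
  shows "0 < f0"
proof (rule ccontr)
  assume "\<not> 0 < f0"
  hence "closed_segment p q \<inter> closed_segment p' q' \<noteq> {}"
    using assms by (intro segments_cross[of p' p f0 u q' q f1]) auto
  thus False using closed_seg_subset[OF assms(5,6)] assms interior_only_edge[OF assms(1,2)] by blast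
qed

text \<open>On the line through \<open>E\<close> the edge \<open>c'\<close> lies between
  \<open>a\<close> and \<open>c\<close>. It crosses neither, so if it reaches the line through
  \<open>x\<close> it lies between them there too, and the point \<open>R\<close> obstructs the
  flight of \<open>x\<close>.\<close>

lemma blocked_flight:
  assumes abc: "a \<in> A" "c \<in> A" "c' \<in> A" "a \<noteq> c'" "c \<noteq> c'" and u: "norm u = 1"
    and int: "x \<in> edge_interior e a" "E \<in> edge_interior e a" "x + t *\<^sub>R u \<in> edge_interior e c"
      "E + g *\<^sub>R u \<in> edge_interior e c"
    and hit: "R \<in> edge_seg e c'" "wedge (R - x) u = 0" "E + f *\<^sub>R u \<in> edge_seg e c'" "0 < f" "f < g"
    and free: "\<And>r. 0 < r \<Longrightarrow> r < t \<Longrightarrow> x + r *\<^sub>R u \<notin> boundary A e"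
  shows False
proof -
  obtain \<rho> where "R - x = \<rho> *\<^sub>R u" using wedge_zero_parallel[OF hit(2) u] by blast
  hence R: "R = x + \<rho> *\<^sub>R u" by (simp add: algebra_simps)
  have "0 < \<rho>"
    using closed_seg_subset_interior[OF int(1,2)] R hit abc
    by (intro edges_do_not_cross[OF abc(1,3,4), of x E R "E + f *\<^sub>R u" \<rho> u f]) auto
  moreover have "0 < t - \<rho>"
  proof -
    \<comment> \<open>The same comparison of heights, made from the edge \<open>c\<close> with the
      direction reversed.\<close>
    have *: "R - (x + t *\<^sub>R u) = (t - \<rho>) *\<^sub>R (- u)"
      "E + f *\<^sub>R u - (E + g *\<^sub>R u) = (g - f) *\<^sub>R (- u)"
      by (simp_all add: R algebra_simps)
    thus "0 < t - \<rho>"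
      using edges_do_not_cross[OF abc(2,3,5) closed_seg_subset_interior[OF int(3,4)] hit(1,3) *] hit(5) by simp
  qed
  ultimately have "R \<notin> boundary A e" using free unfolding R by simp
  thus False using hit(1) abc by (auto simp: boundary_def)
qed

lemma wedge_affine:
  "wedge (p + s *\<^sub>R (q - p) - x) u = wedge (p - x) u + s * (wedge (q - x) u - wedge (p - x) u)"
  by (simp add: wedge_add wedge_diff)

text \<open>The edge \<open>c'\<close> meets the midline between \<open>a\<close> and
  \<open>c\<close>. If it extended beyond the midline as far as the line of \<open>x\<close> or of
  \<open>y\<close>, it would block that side of the rod. Hence both ends of \<open>c'\<close> have
  offsets strictly between the two sides. Here \<open>\<alpha>\<close> and \<open>\<beta>\<close>
  are the offsets of the ends from the midline, \<open>f\<close> is the height of \<open>c'\<close>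
  on it and \<open>(t + s) / 2\<close> the height of \<open>c\<close>.\<close>

lemma rod_encircles:
  assumes abc: "a \<in> A" "c \<in> A" "c' \<in> A" "a \<noteq> c'" "c \<noteq> c'" and u: "norm u = 1"
    and c': "edge_seg e c' = closed_segment c1 c2"
    and int: "x \<in> edge_interior e a" "y \<in> edge_interior e a" "x + t *\<^sub>R u \<in> edge_interior e c"
      "y + s *\<^sub>R u \<in> edge_interior e c"
    and free: "\<And>r. 0 < r \<Longrightarrow> r < t \<Longrightarrow> x + r *\<^sub>R u \<notin> boundary A e"
      "\<And>r. 0 < r \<Longrightarrow> r < s \<Longrightarrow> y + r *\<^sub>R u \<notin> boundary A e"
    and d: "0 < wedge (y - x) u"
    and E: "E = midpoint x y"
    and \<alpha>: "\<alpha> = wedge (E - c1) u" "0 < \<alpha>" and \<beta>: "\<beta> = wedge (c2 - E) u" "0 < \<beta>"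
    and f: "f = (c1 + (\<alpha> / (\<alpha> + \<beta>)) *\<^sub>R (c2 - c1) - E) \<bullet> u" "0 < f" "f < (t + s) / 2"
  shows "0 < wedge (c1 - x) u \<and> wedge (c2 - y) u < 0"
proof -
  define l where "l = \<alpha> / (\<alpha> + \<beta>)"
  define Z where "Z = c1 + l *\<^sub>R (c2 - c1)"
  have l: "0 \<le> l" "l \<le> 1" using \<alpha> \<beta> by (auto simp: l_def field_simps)
  have "wedge (Z - E) u = - \<alpha> + l * (\<beta> + \<alpha>)"
    unfolding Z_def wedge_affine using \<alpha>(1) \<beta>(1) by (simp add: wedge_diff)
  also have "\<dots> = 0" using \<alpha>(2) \<beta>(2) by (simp add: l_def field_simps)
  finally have "Z - E = f *\<^sub>R u" using wedge_zero_parallel[of "Z - E" u] u f(1) by (simp add: Z_def l_def)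
  hence Z: "Z = E + f *\<^sub>R u" by (simp add: algebra_simps)
  have Zs: "Z \<in> closed_segment c1 c2" unfolding Z_def by (rule segment_affine_mem[OF l])
  have EI: "E \<in> edge_interior e a"
    using closed_seg_subset_interior[OF int(1,2)] E by auto
  have "midpoint (x + t *\<^sub>R u) (y + s *\<^sub>R u) = E + ((t + s) / 2) *\<^sub>R u"
    unfolding E midpoint_def by (simp add: algebra_simps add_divide_distrib)
  hence CI: "E + ((t + s) / 2) *\<^sub>R u \<in> edge_interior e c"
    using closed_seg_subset_interior[OF int(3,4)] by (metis midpoint_in_closed_segment subsetD)
  have mid: "wedge (E - x) u = wedge (y - x) u / 2" "wedge (E - y) u = - wedge (y - x) u / 2"
    unfolding E midpoint_def by (simp_all add: wedge_def algebra_simps)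
  \<comment> \<open>Only the part of \<open>c'\<close> from one of its ends to the point
    \<open>Z\<close> on the midline is considered: it meets a side of the rod as soon as that end is
    not strictly inside.\<close>
  have no_hit: False if "q \<in> {c1, c2}" "z = x \<or> z = y" "0 \<le> \<sigma>" "\<sigma> \<le> 1" "wedge (q + \<sigma> *\<^sub>R (Z - q) - z) u = 0" for q z \<sigma>
  proof -
    have "q + \<sigma> *\<^sub>R (Z - q) \<in> closed_segment q Z" by (rule segment_affine_mem[OF that(3,4)])
    moreover have "q \<in> closed_segment c1 c2" using that(1) by auto
    ultimately have R: "q + \<sigma> *\<^sub>R (Z - q) \<in> edge_seg e c'"
      using closed_seg_subset[of q c' Z] Zs c' by auto
    from that(2) show False
    proof
      assume "z = x"
      thus False using blocked_flight[OF abc u int(1) EI int(3) CI R _ _ f(2,3) free(1)] that(5) Zs Z c' by auto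
    next
      assume "z = y"
      thus False using blocked_flight[OF abc u int(2) EI int(4) CI R _ _ f(2,3) free(2)] that(5) Zs Z c' by auto
    qed
  qed
  have ZE: "wedge (Z - x) u = wedge (y - x) u / 2" "wedge (Z - y) u = - wedge (y - x) u / 2"
    using mid unfolding Z by (simp_all add: wedge_add wedge_diff)
  have 1: "0 < wedge (c1 - x) u"
  proof (rule ccontr)
    assume n: "\<not> 0 < wedge (c1 - x) u"
    define \<sigma> where "\<sigma> = - wedge (c1 - x) u / (wedge (Z - x) u - wedge (c1 - x) u)"
    have p: "0 < wedge (Z - x) u - wedge (c1 - x) u" using n ZE d by linarith
    have "0 \<le> \<sigma>" "\<sigma> \<le> 1" using n p ZE d by (auto simp: \<sigma>_def field_simps)
    moreover have "wedge (c1 + \<sigma> *\<^sub>R (Z - c1) - x) u = 0" unfolding wedge_affine using p by (simp add: \<sigma>_def)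
    ultimately show False using no_hit[of c1 x \<sigma>] by simp
  qed
  have 2: "wedge (c2 - y) u < 0"
  proof (rule ccontr)
    assume n: "\<not> wedge (c2 - y) u < 0"
    define \<sigma> where "\<sigma> = - wedge (c2 - y) u / (wedge (Z - y) u - wedge (c2 - y) u)"
    have p: "wedge (Z - y) u - wedge (c2 - y) u < 0" using n ZE d by linarith
    have "0 \<le> \<sigma>" "\<sigma> \<le> 1" using n p ZE d by (auto simp: \<sigma>_def field_simps)
    moreover have "wedge (c2 + \<sigma> *\<^sub>R (Z - c2) - y) u = 0" unfolding wedge_affine using p by (simp add: \<sigma>_def)
    ultimately show False using no_hit[of c2 y \<sigma>] by simp
  qed
  show ?thesis using 1 2 by blast
qed

lemma open_segment_offsets:
  assumes "x + t *\<^sub>R u \<in> open_segment c1 c2" "0 < wedge (c2 - c1) u"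
  shows "wedge (c1 - x) u < 0" "0 < wedge (c2 - x) (u::plane)"
proof -
  obtain l where l: "0 < l" "l < 1" "x + t *\<^sub>R u = (1 - l) *\<^sub>R c1 + l *\<^sub>R c2"
    using assms(1) by (auto simp: in_segment)
  hence x: "x = c1 + l *\<^sub>R (c2 - c1) - t *\<^sub>R u" by (simp add: algebra_simps)
  have "wedge (c1 - x) u = - l * wedge (c2 - c1) u" "wedge (c2 - x) u = (1 - l) * wedge (c2 - c1) u"
    unfolding x by (simp_all add: wedge_def algebra_simps)
  thus "wedge (c1 - x) u < 0" "0 < wedge (c2 - x) u"
    using l assms(2) by (auto simp: mult_pos_pos)
qed

text \<open>A boundary point on a bisector of the two lines bounds their offset by a multiple of their
  angle, so it stands for a crossing at a bounded distance.\<close>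

definition lines_cross :: "plane \<Rightarrow> plane \<Rightarrow> plane \<Rightarrow> plane \<Rightarrow> bool" where
  "lines_cross x u y w \<longleftrightarrow> wedge w u \<noteq> 0 \<and> (\<exists>z\<in>boundary A e. wedge (z - x) u = wedge (z - y) w)"

lemma lines_cross_commute: "lines_cross x u y w \<Longrightarrow> lines_cross y w x u"
  unfolding lines_cross_def using wedge_swap[of u w] by (metis neg_equal_0_iff_equal)

text \<open>Rod A has the edge \<open>c1 c2\<close> strictly between its sides, rod B is strictly
  inside the edge. Hence the difference of the offsets from the two first sides is positive at
  \<open>c1\<close> and negative at \<open>c2\<close>, and vanishes at some point of the edge. For
  equal directions this difference would be constant, so the lines are not parallel.\<close>

lemma lines_crossI:
  assumes c': "c' \<in> A" "c1 \<in> edge_seg e c'" "c2 \<in> edge_seg e c'"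
    and dA: "wedge (yA - xA) uA = d" and dB: "wedge (yB - xB) uB = d"
    and A: "0 < wedge (c1 - xA) uA" "wedge (c2 - yA) uA < 0"
    and B: "wedge (c1 - xB) uB < 0" "0 < wedge (c2 - yB) uB"
    and u: "norm uA = 1" "norm uB = 1" "uA \<bullet> uB > 0"
  shows "lines_cross xA uA xB uB"
proof -
  define \<phi> where "\<phi> z = wedge (z - xA) uA - wedge (z - xB) uB" for z
  have "wedge (c2 - xA) uA = wedge (c2 - yA) uA + d" "wedge (c2 - xB) uB = wedge (c2 - yB) uB + d"
    using dA dB by (simp_all add: wedge_diff)
  hence p: "\<phi> c1 > 0" "\<phi> c2 < 0" using A B by (auto simp: \<phi>_def)
  define \<sigma> where "\<sigma> = \<phi> c1 / (\<phi> c1 - \<phi> c2)"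
  have s: "0 \<le> \<sigma>" "\<sigma> \<le> 1" using p by (auto simp: \<sigma>_def field_simps)
  have "\<phi> (c1 + \<sigma> *\<^sub>R (c2 - c1)) = \<phi> c1 + \<sigma> * (\<phi> c2 - \<phi> c1)"
    unfolding \<phi>_def wedge_affine by (simp add: algebra_simps)
  also have "\<dots> = 0" using p by (simp add: \<sigma>_def field_simps)
  finally have "\<phi> (c1 + \<sigma> *\<^sub>R (c2 - c1)) = 0" .
  moreover have "c1 + \<sigma> *\<^sub>R (c2 - c1) \<in> boundary A e"
    using segment_affine_mem[OF s, of c1 c2] closed_seg_subset[OF c'(2,3)] c'(1) by (auto simp: boundary_def)
  moreover have "wedge uB uA \<noteq> 0"
  proof
    assume "wedge uB uA = 0"
    hence "uB = (uB \<bullet> uA) *\<^sub>R uA" using wedge_zero_parallel u by blast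
    moreover from this have "\<bar>uB \<bullet> uA\<bar> = 1" using u by (metis mult.right_neutral norm_scaleR)
    ultimately have "uB = uA" using u(3) by (simp add: inner_commute)
    hence "\<phi> c1 = \<phi> c2" by (simp add: \<phi>_def wedge_diff)
    thus False using p by simp
  qed
  ultimately show ?thesis unfolding lines_cross_def by (auto simp: \<phi>_def)
qed

end

text \<open>Carries the order of two edges from one line inside a strip to all of them. The interval
  is open because edges may meet on the sides of the strip.\<close>

lemma affine_pos:
  fixes g0 g1 :: real
  assumes nz: "\<And>\<tau>. 0 < \<tau> \<Longrightarrow> \<tau> < 1 \<Longrightarrow> (1 - \<tau>) * g0 + \<tau> * g1 \<noteq> 0"
    and m: "0 < m" "m < 1" "0 \<le> (1 - m) * g0 + m * g1" and t: "0 < \<tau>" "\<tau> < 1"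
  shows "0 < (1 - \<tau>) * g0 + \<tau> * g1"
proof (rule ccontr)
  define f where "f \<sigma> = (1 - \<sigma>) * g0 + \<sigma> * g1" for \<sigma>
  assume "\<not> ?thesis"
  hence ft: "f \<tau> < 0" using nz[OF t] by (simp add: f_def)
  have fm: "f m > 0" using nz[OF m(1,2)] m(3) by (simp add: f_def)
  define l where "l = - f \<tau> / (f m - f \<tau>)"
  have l: "0 < l" "l < 1" using ft fm by (auto simp: l_def field_simps)
  have "f (\<tau> + l * (m - \<tau>)) = f \<tau> + l * (f m - f \<tau>)" unfolding f_def by (simp add: algebra_simps)
  also have "\<dots> = 0" using ft fm by (simp add: l_def)
  finally have "f (\<tau> + l * (m - \<tau>)) = 0" .
  moreover have "\<tau> + l * (m - \<tau>) = (1 - l) * \<tau> + l * m" by (simp add: algebra_simps)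
  moreover have "0 < (1 - l) * \<tau> + l * m" using l m t by (simp add: add_pos_pos)
  moreover have "(1 - l) * \<tau> + l * m < 1"
  proof -
    have "(1 - l) * \<tau> < (1 - l) * 1" "l * m < l * 1" using l m t by (auto intro!: mult_strict_left_mono)
    thus ?thesis by simp
  qed
  ultimately show False using nz[of "\<tau> + l * (m - \<tau>)"] by (simp add: f_def)
qed

section \<open>Rods inside a limiting strip\<close>

context edge_system begin

lemma seg_transversal:
  assumes "p \<in> edge_seg e a" "q \<in> edge_seg e a" "wedge (q - p) u \<noteq> 0"
  shows "wedge (edge_dir e a) u \<noteq> 0"
  using seg_diff_parallel[OF assms(2,1)] assms(3) by auto

lemma seg_affine_mem:
  assumes "p \<in> edge_seg e a" "q \<in> edge_seg e a" "0 \<le> s" "s \<le> 1"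
  shows "p + s *\<^sub>R (q - p) \<in> edge_seg e a"
  using segment_affine_mem[OF assms(3,4), of p q] closed_seg_subset[OF assms(1,2)] by blast

text \<open>The strip from \<open>p1\<close> to \<open>q1\<close> is parametrised by the offset
  divided by \<open>W\<close>; over it the edge \<open>c\<close> has the affine height from
  \<open>g0\<close> to \<open>g1\<close>. The sides of the rod may lie on the sides of the strip,
  but \<open>0 < d\<close> puts the midpoint strictly inside, and its flight ends at the
  interpolated height.\<close>

lemma midpoint_config:
  assumes pq: "p1 \<in> edge_seg e a" "q1 \<in> edge_seg e a" "p0 \<in> edge_seg e c" "q0 \<in> edge_seg e c"
    "p0 = p1 + g0 *\<^sub>R u" "q0 = q1 + g1 *\<^sub>R u" "wedge (q1 - p1) u = W"
    and XY: "X1 \<in> edge_seg e a" "Y1 \<in> edge_seg e a" "X0 \<in> edge_seg e c" "Y0 \<in> edge_seg e c"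
    "wedge (X0 - X1) u = 0" "wedge (Y0 - Y1) u = 0" "wedge (Y1 - X1) u = d" "0 < d"
    "0 \<le> wedge (X1 - p1) u" "wedge (Y1 - p1) u \<le> W"
    and m: "m = wedge (midpoint X1 Y1 - p1) u / W"
  shows "0 < m" "m < 1" "midpoint X1 Y1 = p1 + m *\<^sub>R (q1 - p1)"
    "midpoint X0 Y0 = midpoint X1 Y1 + ((1 - m) * g0 + m * g1) *\<^sub>R u"
proof -
  have Y: "wedge (Y1 - p1) u = wedge (X1 - p1) u + d" using XY(7) by (simp add: wedge_diff)
  have mid: "wedge (midpoint X1 Y1 - p1) u = wedge (X1 - p1) u + d / 2"
    using XY(7) by (simp add: midpoint_def wedge_diff wedge_add field_simps)
  have W: "0 < W" using Y XY by linarith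
  show m01: "0 < m" "m < 1" unfolding m mid using Y XY W by (auto simp: field_simps)
  have ta: "wedge (edge_dir e a) u \<noteq> 0" using seg_transversal[OF pq(1,2)] pq(7) W by simp
  have "wedge (q0 - p0) u = W" using pq(7) unfolding pq(5,6) by (simp add: wedge_diff wedge_add)
  hence tc: "wedge (edge_dir e c) u \<noteq> 0" using seg_transversal[OF pq(3,4)] W by simp
  have Ea: "midpoint X1 Y1 \<in> edge_seg e a" "midpoint X0 Y0 \<in> edge_seg e c"
    using closed_seg_subset XY(1-4) by (meson midpoint_in_closed_segment subsetD)+
  have o1: "wedge (p1 + m *\<^sub>R (q1 - p1) - p1) u = m * W" using pq(7) by simp
  have "wedge (midpoint X1 Y1 - p1) u = m * W" using W by (simp add: m)
  moreover have "wedge (midpoint X1 Y1 - (p1 + m *\<^sub>R (q1 - p1))) u =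
      wedge (midpoint X1 Y1 - p1) u - wedge (p1 + m *\<^sub>R (q1 - p1) - p1) u" by (simp add: wedge_diff wedge_add)
  ultimately have "wedge (midpoint X1 Y1 - (p1 + m *\<^sub>R (q1 - p1))) u = 0" using o1 by linarith
  thus E: "midpoint X1 Y1 = p1 + m *\<^sub>R (q1 - p1)"
    using same_offset_eq[OF Ea(1) seg_affine_mem[OF pq(1,2)] _ ta] m01 by simp
  have c: "p0 + m *\<^sub>R (q0 - p0) = p1 + m *\<^sub>R (q1 - p1) + ((1 - m) * g0 + m * g1) *\<^sub>R u"
    unfolding pq(5,6) by (simp add: algebra_simps)
  have "wedge (midpoint X0 Y0 - midpoint X1 Y1) u = 0"
    using XY(5,6) by (simp add: midpoint_def wedge_diff wedge_add)
  moreover have "wedge (p0 + m *\<^sub>R (q0 - p0) - midpoint X1 Y1) u = 0"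
    unfolding c E by simp
  ultimately have "wedge (midpoint X0 Y0 - (p0 + m *\<^sub>R (q0 - p0))) u = 0" by (simp add: wedge_diff wedge_add)
  hence "midpoint X0 Y0 = p0 + m *\<^sub>R (q0 - p0)"
    using same_offset_eq[OF Ea(2) seg_affine_mem[OF pq(3,4)] _ tc] m01 by simp
  thus "midpoint X0 Y0 = midpoint X1 Y1 + ((1 - m) * g0 + m * g1) *\<^sub>R u" unfolding E c .
qed

text \<open>On the midline all conditions for encircling are strict in the limit, with the edge
  \<open>c'\<close> at height \<open>H\<close> in front of \<open>c\<close> at height
  \<open>G\<close>; so they hold for some \<open>k\<close>. For that \<open>k\<close> rod A has
  \<open>c'\<close> between its sides while rod B is stopped by \<open>c'\<close> on both
  sides.\<close>

lemma rod_encircles_limit: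
  assumes abc: "a \<in> A" "c \<in> A" "c' \<in> A" "a \<noteq> c" "a \<noteq> c'" "c \<noteq> c'" and u: "norm u = 1" and d: "0 < d"
    and A: "\<And>k. norm (uA k) = 1" "\<And>k. xA k \<in> edge_interior e a" "\<And>k. yA k \<in> edge_interior e a"
      "\<And>k. xA k + tA k *\<^sub>R uA k \<in> edge_interior e c" "\<And>k. yA k + sA k *\<^sub>R uA k \<in> edge_interior e c"
      "\<And>k r. 0 < r \<Longrightarrow> r < tA k \<Longrightarrow> xA k + r *\<^sub>R uA k \<notin> boundary A e"
      "\<And>k r. 0 < r \<Longrightarrow> r < sA k \<Longrightarrow> yA k + r *\<^sub>R uA k \<notin> boundary A e"
      "\<And>k. wedge (yA k - xA k) (uA k) = d"
    and B: "\<And>k. norm (uB k) = 1" "\<And>k. xB k + tB k *\<^sub>R uB k \<in> edge_interior e c'"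
      "\<And>k. yB k + sB k *\<^sub>R uB k \<in> edge_interior e c'"
      "\<And>k. wedge (yB k - xB k) (uB k) = d" "\<And>k. uA k \<bullet> uB k > 0"
    and lim: "xA \<longlonglongrightarrow> X1" "yA \<longlonglongrightarrow> Y1" "(\<lambda>k. xA k + tA k *\<^sub>R uA k) \<longlonglongrightarrow> X0"
      "(\<lambda>k. yA k + sA k *\<^sub>R uA k) \<longlonglongrightarrow> Y0" "uA \<longlonglongrightarrow> u" "uB \<longlonglongrightarrow> u"
    and pq: "p1 \<in> edge_seg e a" "q1 \<in> edge_seg e a" "p0 \<in> edge_seg e c" "q0 \<in> edge_seg e c"
      "p0 = p1 + g0 *\<^sub>R u" "q0 = q1 + g1 *\<^sub>R u" "wedge (q1 - p1) u = W"
    and rs: "r0 \<in> edge_seg e c'" "s0 \<in> edge_seg e c'" "r0 = p1 + h0 *\<^sub>R u" "s0 = q1 + h1 *\<^sub>R u"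
    and off: "0 \<le> wedge (X1 - p1) u" "wedge (Y1 - p1) u \<le> W"
    and ord: "\<And>\<tau>. 0 < \<tau> \<Longrightarrow> \<tau> < 1 \<Longrightarrow> 0 < (1 - \<tau>) * h0 + \<tau> * h1"
      "\<And>\<tau>. 0 < \<tau> \<Longrightarrow> \<tau> < 1 \<Longrightarrow> (1 - \<tau>) * h0 + \<tau> * h1 < (1 - \<tau>) * g0 + \<tau> * g1"
  shows "\<exists>k. lines_cross (xA k) (uA k) (xB k) (uB k)"
proof -
  have X: "X1 \<in> edge_seg e a" "Y1 \<in> edge_seg e a" "X0 \<in> edge_seg e c" "Y0 \<in> edge_seg e c"
    by (rule closed_edge_limit[OF subsetD[OF interior_subset_seg A(2)] lim(1)]
      closed_edge_limit[OF subsetD[OF interior_subset_seg A(3)] lim(2)]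
      closed_edge_limit[OF subsetD[OF interior_subset_seg A(4)] lim(3)]
      closed_edge_limit[OF subsetD[OF interior_subset_seg A(5)] lim(4)])+
  have "(\<lambda>k. wedge (xA k + tA k *\<^sub>R uA k - xA k) (uA k)) \<longlonglongrightarrow> wedge (X0 - X1) u"
    "(\<lambda>k. wedge (yA k + sA k *\<^sub>R uA k - yA k) (uA k)) \<longlonglongrightarrow> wedge (Y0 - Y1) u"
    "(\<lambda>k. wedge (yA k - xA k) (uA k)) \<longlonglongrightarrow> wedge (Y1 - X1) u"
    by (intro tendsto_intros lim)+
  hence par: "wedge (X0 - X1) u = 0" "wedge (Y0 - Y1) u = 0" "wedge (Y1 - X1) u = d"
    using A(8) by (simp_all add: LIMSEQ_const_iff)
  define E where "E = midpoint X1 Y1"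
  define C where "C = midpoint X0 Y0"
  define m where "m = wedge (E - p1) u / W"
  define G where "G = (1 - m) * g0 + m * g1"
  define H where "H = (1 - m) * h0 + m * h1"
  note cfg = midpoint_config[OF pq X par d off m_def[unfolded E_def], folded E_def C_def G_def]
  have GH: "0 < H" "H < G" using ord cfg(1,2) by (auto simp: G_def H_def)
  have W: "0 < W" using off par(3) d by (simp add: wedge_diff)
  have rsW: "wedge (s0 - r0) u = W" using pq(7) unfolding rs(3,4) by (simp add: wedge_diff wedge_add)
  have tc: "wedge (edge_dir e c') u \<noteq> 0" using seg_transversal[OF rs(1,2)] rsW W by simp
  \<comment> \<open>The ends are named by increasing offset, so that \<open>c1\<close> is on the
    side of \<open>x\<close> and \<open>c2\<close> on the side of \<open>y\<close>.\<close>
  obtain c1 c2 where cc: "edge_seg e c' = closed_segment c1 c2" "edge_interior e c' = open_segment c1 c2"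
      "0 < wedge (c2 - c1) u"
  proof (cases "0 < wedge (edge_dir e c') u")
    case True
    thus ?thesis using that by (simp add: edge_seg_def edge_interior_def)
  next
    case False
    hence "0 < wedge (fst (e c') - snd (e c')) u" using tc by (simp add: wedge_diff)
    thus ?thesis using that[of "snd (e c')" "fst (e c')"]
      by (simp add: edge_seg_def edge_interior_def closed_segment_commute open_segment_commute)
  qed
  have cseg: "c1 \<in> edge_seg e c'" "c2 \<in> edge_seg e c'" using cc by auto
  have rng: "wedge (c1 - x) u \<le> 0 \<and> 0 \<le> wedge (c2 - x) u" if "x \<in> edge_seg e c'" for x
  proof -
    obtain l where l: "0 \<le> l" "l \<le> 1" "x = (1 - l) *\<^sub>R c1 + l *\<^sub>R c2"
      using \<open>x \<in> edge_seg e c'\<close> cc(1) by (auto simp: in_segment)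
    hence x: "x = c1 + l *\<^sub>R (c2 - c1)" by (simp add: algebra_simps)
    have "wedge (c1 - x) u = - l * wedge (c2 - c1) u" "wedge (c2 - x) u = (1 - l) * wedge (c2 - c1) u"
      unfolding x by (simp_all add: wedge_diff wedge_add algebra_simps)
    thus ?thesis using l cc(3) by simp
  qed
  have Em: "wedge (E - p1) u = m * W" using W by (simp add: m_def)
  have rp: "wedge (r0 - p1) u = 0" "wedge (s0 - p1) u = W" unfolding rs(3,4) using pq(7) by (simp_all add: wedge_diff wedge_add)
  \<comment> \<open>The edge \<open>c'\<close> contains \<open>r0\<close> and \<open>s0\<close>,
    whose offsets are 0 and \<open>W\<close>, so it spans the whole strip and its ends lie on
    different sides of the midline.\<close>
  have "0 < m * W" "m * W < W" using cfg(1,2) W by auto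
  hence lims0: "0 < wedge (E - c1) u" "0 < wedge (c2 - E) u"
    using rng[OF rs(1)] rng[OF rs(2)] rp Em by (auto simp: wedge_diff)
  define E' where "E' k = midpoint (xA k) (yA k)" for k
  define \<alpha> where "\<alpha> k = wedge (E' k - c1) (uA k)" for k
  define \<beta> where "\<beta> k = wedge (c2 - E' k) (uA k)" for k
  define f where "f k = (c1 + (\<alpha> k / (\<alpha> k + \<beta> k)) *\<^sub>R (c2 - c1) - E' k) \<bullet> uA k" for k
  define g where "g k = (tA k + sA k) / 2" for k
  have limE: "E' \<longlonglongrightarrow> E" unfolding E'_def E_def midpoint_def by (intro tendsto_intros lim)
  have lim\<alpha>: "\<alpha> \<longlonglongrightarrow> wedge (E - c1) u" and lim\<beta>: "\<beta> \<longlonglongrightarrow> wedge (c2 - E) u"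
    unfolding \<alpha>_def \<beta>_def by (intro tendsto_intros limE lim)+
  define l where "l = wedge (E - c1) u / (wedge (E - c1) u + wedge (c2 - E) u)"
  have l01: "0 \<le> l" "l \<le> 1" using lims0 by (auto simp: l_def field_simps)
  have limf: "f \<longlonglongrightarrow> (c1 + l *\<^sub>R (c2 - c1) - E) \<bullet> u"
    unfolding f_def l_def using lims0 by (intro tendsto_intros lim\<alpha> lim\<beta> limE lim) auto
  have "c1 + l *\<^sub>R (c2 - c1) = E + H *\<^sub>R u"
  proof -
    have "wedge (c1 + l *\<^sub>R (c2 - c1) - E) u = 0"
      unfolding wedge_affine using lims0 by (simp add: l_def wedge_diff field_simps)
    moreover have eq: "r0 + m *\<^sub>R (s0 - r0) = E + H *\<^sub>R u"
      unfolding cfg(3) rs(3,4) H_def by (simp add: algebra_simps)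
    ultimately have "wedge (c1 + l *\<^sub>R (c2 - c1) - (r0 + m *\<^sub>R (s0 - r0))) u = 0"
      unfolding eq by (simp add: wedge_diff wedge_add)
    hence "c1 + l *\<^sub>R (c2 - c1) = r0 + m *\<^sub>R (s0 - r0)"
      using same_offset_eq[OF seg_affine_mem[OF cseg l01] seg_affine_mem[OF rs(1,2)] _ tc] cfg(1,2) by simp
    thus ?thesis using eq by simp
  qed
  moreover have "u \<bullet> u = 1" using u by (simp add: norm_eq_1)
  ultimately have limf: "f \<longlonglongrightarrow> H" using limf by simp
  have "g k = (midpoint (xA k + tA k *\<^sub>R uA k) (yA k + sA k *\<^sub>R uA k) - E' k) \<bullet> uA k" for k
  proof -
    have "uA k \<bullet> uA k = 1" using A(1) by (simp add: norm_eq_1)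
    moreover have "midpoint (xA k + tA k *\<^sub>R uA k) (yA k + sA k *\<^sub>R uA k) - E' k = g k *\<^sub>R uA k"
      unfolding E'_def midpoint_def g_def by (simp add: algebra_simps add_divide_distrib)
    ultimately show ?thesis by simp
  qed
  moreover have "(\<lambda>k. (midpoint (xA k + tA k *\<^sub>R uA k) (yA k + sA k *\<^sub>R uA k) - E' k) \<bullet> uA k) \<longlonglongrightarrow> (C - E) \<bullet> u"
    unfolding C_def midpoint_def by (intro tendsto_intros lim limE)
  ultimately have "g \<longlonglongrightarrow> (C - E) \<bullet> u" by (metis (no_types, lifting) ext)
  hence limg: "g \<longlonglongrightarrow> G" using cfg(4) \<open>u \<bullet> u = 1\<close> by simp
  have limB: "(\<lambda>k. wedge (c2 - c1) (uB k)) \<longlonglongrightarrow> wedge (c2 - c1) u" by (intro tendsto_intros lim)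
  have limgf: "(\<lambda>k. g k - f k) \<longlonglongrightarrow> G - H" by (intro tendsto_intros limg limf)
  have "G - H > 0" using GH by simp
  have "eventually (\<lambda>k. 0 < \<alpha> k \<and> 0 < \<beta> k \<and> 0 < f k \<and> 0 < g k - f k \<and> 0 < wedge (c2 - c1) (uB k)) sequentially"
    using order_tendstoD(1)[OF lim\<alpha> lims0(1)] order_tendstoD(1)[OF lim\<beta> lims0(2)]
      order_tendstoD(1)[OF limf GH(1)] order_tendstoD(1)[OF limgf \<open>G - H > 0\<close>] order_tendstoD(1)[OF limB cc(3)]
    by eventually_elim auto
  then obtain k where k: "0 < \<alpha> k" "0 < \<beta> k" "0 < f k" "f k < g k" "0 < wedge (c2 - c1) (uB k)"
    unfolding eventually_sequentially by force
  have encA: "0 < wedge (c1 - xA k) (uA k) \<and> wedge (c2 - yA k) (uA k) < 0"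
    using k(4) d A(8)[of k]
    by (intro rod_encircles[OF abc(1,2,3,5,6) A(1) cc(1) A(2,3,4,5,6,7) _ E'_def \<alpha>_def k(1) \<beta>_def k(2) f_def k(3)])
      (auto simp: g_def)
  show ?thesis
    using lines_crossI[OF abc(3) cseg A(8) B(4) _ _ _ _ A(1) B(1) B(5)] encA
      open_segment_offsets(1)[OF B(2)[of k, unfolded cc(2)] k(5)] open_segment_offsets(2)[OF B(3)[of k, unfolded cc(2)] k(5)]
    by blast
qed

end

section \<open>Splitting of rods\<close>

context edge_system begin

lemma lines_cross_uminus: "lines_cross x (- u) y (- w) \<longleftrightarrow> lines_cross x u y w"
  by (simp add: lines_cross_def)

text \<open>Over the open strip the points of the edge \<open>a\<close> are interior to it, so the
  distinct edge \<open>c\<close> cannot touch them and its height never vanishes. On the midline of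
  a limit of genuine flights the height is nonnegative, which decides the sign everywhere.\<close>

lemma branch_heights_pos:
  assumes ac: "a \<in> A" "c \<in> A" "a \<noteq> c" and u: "norm u = 1"
    and mem: "p1 \<in> edge_seg e a" "q1 \<in> edge_seg e a" "p0 \<in> edge_seg e c" "q0 \<in> edge_seg e c"
    "p0 = p1 + g0 *\<^sub>R u" "q0 = q1 + g1 *\<^sub>R u" "wedge (q1 - p1) u = W"
    and XY: "X1 \<in> edge_seg e a" "Y1 \<in> edge_seg e a" "X0 \<in> edge_seg e c" "Y0 \<in> edge_seg e c"
    "wedge (X0 - X1) u = 0" "wedge (Y0 - Y1) u = 0" "wedge (Y1 - X1) u = d" "0 < d"
    "0 \<le> wedge (X1 - p1) u" "wedge (Y1 - p1) u \<le> W"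
    and fwd: "0 \<le> (X0 - X1) \<bullet> u" "0 \<le> (Y0 - Y1) \<bullet> u"
    and t: "0 < \<tau>" "\<tau> < 1"
  shows "0 < (1 - \<tau>) * g0 + \<tau> * g1"
proof -
  define m where "m = wedge (midpoint X1 Y1 - p1) u / W"
  note cfg = midpoint_config[OF mem XY m_def]
  have pq: "p1 \<noteq> q1"
  proof
    assume "p1 = q1"
    hence "W = 0" using mem(7) by simp
    thus False using XY(7-10) by (simp add: wedge_diff)
  qed
  have "u \<bullet> u = 1" using u by (simp add: norm_eq_1)
  hence "(1 - m) * g0 + m * g1 = (midpoint X0 Y0 - midpoint X1 Y1) \<bullet> u"
    using cfg(4) by simp
  also have "\<dots> = ((X0 - X1) \<bullet> u + (Y0 - Y1) \<bullet> u) / 2"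
    by (simp add: midpoint_def inner_diff_left inner_add_left field_simps)
  finally have m: "0 \<le> (1 - m) * g0 + m * g1" using fwd by simp
  have nz: "(1 - \<sigma>) * g0 + \<sigma> * g1 \<noteq> 0" if s: "0 < \<sigma>" "\<sigma> < 1" for \<sigma>
  proof
    assume 0: "(1 - \<sigma>) * g0 + \<sigma> * g1 = 0"
    have "p0 + \<sigma> *\<^sub>R (q0 - p0) = p1 + \<sigma> *\<^sub>R (q1 - p1) + ((1 - \<sigma>) * g0 + \<sigma> * g1) *\<^sub>R u"
      unfolding mem(5,6) by (simp add: algebra_simps)
    hence "p1 + \<sigma> *\<^sub>R (q1 - p1) \<in> edge_seg e c"
      using 0 seg_affine_mem[OF mem(3,4), of \<sigma>] s by simp
    moreover have "p1 + \<sigma> *\<^sub>R (q1 - p1) \<in> edge_interior e a"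
      using segment_affine_mem_open[OF s pq] open_seg_subset_interior[OF mem(1,2) pq] by blast
    ultimately show False using interior_only_edge[OF ac(1,2)] ac(3) by blast
  qed
  show ?thesis using affine_pos[OF nz cfg(1,2) m t] .
qed

text \<open>Index 0 carries the differing letters \<open>c\<close> and \<open>c'\<close>, index 1
  the common edge \<open>a\<close>. Flights tend to the direction \<open>- u\<close>, so
  \<open>u\<close> looks back from \<open>a\<close> towards the two edges. The pairs
  \<open>pS\<close>, \<open>qS\<close> and \<open>pT\<close>, \<open>qT\<close> are the sides of
  near maximal strips over the two words; they prescribe the common strip behind which
  \<open>c\<close> and \<open>c'\<close> are compared.\<close>

lemma split_limit:
  fixes bA bB :: "nat \<Rightarrow> nat \<Rightarrow> 'i" and zA yA DA zB yB DB pS qS DS pT qT DT :: "nat \<Rightarrow> nat \<Rightarrow> plane"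
    and tA sA tB sB :: "nat \<Rightarrow> nat \<Rightarrow> real" and \<epsilon> :: "nat \<Rightarrow> real"
  assumes abc: "a \<in> A" "c \<in> A" "c' \<in> A" "a \<noteq> c" "a \<noteq> c'" "c \<noteq> c'" and d: "0 < d"
    and bA: "\<And>k j. j \<le> Suc k \<Longrightarrow> bA k j \<in> A" "\<And>k. bA k 0 = c" "\<And>k. bA k (Suc 0) = a"
    and bB: "\<And>k. bB k 0 = c'" "\<And>k j. j \<le> k \<Longrightarrow> bB k (Suc j) = bA k (Suc j)"
    and fA: "\<And>k. flight_path A e (bA k) (Suc k) (zA k) (DA k) (tA k)"
      "\<And>k. flight_path A e (bA k) (Suc k) (yA k) (DA k) (sA k)"
      "\<And>k. wedge (yA k (Suc 0) - zA k (Suc 0)) (DA k 0) = - d"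
    and fB: "\<And>k. flight_path A e (bB k) (Suc k) (zB k) (DB k) (tB k)"
      "\<And>k. flight_path A e (bB k) (Suc k) (yB k) (DB k) (sB k)"
      "\<And>k. wedge (yB k (Suc 0) - zB k (Suc 0)) (DB k 0) = - d"
    and pos: "\<And>k. DA k 0 \<bullet> DB k 0 > 0"
    and S: "\<And>k. pseudo_line e (bA k) (Suc k) (pS k) (DS k)" "\<And>k. pseudo_line e (bA k) (Suc k) (qS k) (DS k)"
      "\<And>k. wedge (qS k (Suc 0) - pS k (Suc 0)) (DS k 0) \<le> - (W - \<epsilon> k)"
    and T: "\<And>k. pseudo_line e (bB k) (Suc k) (pT k) (DT k)" "\<And>k. pseudo_line e (bB k) (Suc k) (qT k) (DT k)"
      "\<And>k. wedge (qT k (Suc 0) - pT k (Suc 0)) (DT k 0) \<le> - (W - \<epsilon> k)"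
    and eps: "\<epsilon> \<longlonglongrightarrow> 0"
    and UB: "\<And>\<epsilon>. \<epsilon> > 0 \<Longrightarrow> \<exists>m k0. \<forall>k\<ge>k0. \<not> strip e (\<lambda>j. bA k (Suc j)) m (W + \<epsilon>)"
    and limD: "(\<lambda>k. DA k 0) \<longlonglongrightarrow> - u" "(\<lambda>k. DB k 0) \<longlonglongrightarrow> - u" "(\<lambda>k. DS k 0) \<longlonglongrightarrow> - u" "(\<lambda>k. DT k 0) \<longlonglongrightarrow> - u"
    and limA: "(\<lambda>k. zA k 0) \<longlonglongrightarrow> X0" "(\<lambda>k. zA k (Suc 0)) \<longlonglongrightarrow> X1" "(\<lambda>k. yA k 0) \<longlonglongrightarrow> Y0" "(\<lambda>k. yA k (Suc 0)) \<longlonglongrightarrow> Y1"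
    and limB: "(\<lambda>k. zB k 0) \<longlonglongrightarrow> X0'" "(\<lambda>k. zB k (Suc 0)) \<longlonglongrightarrow> X1'" "(\<lambda>k. yB k 0) \<longlonglongrightarrow> Y0'" "(\<lambda>k. yB k (Suc 0)) \<longlonglongrightarrow> Y1'"
    and limS: "(\<lambda>k. pS k 0) \<longlonglongrightarrow> p0" "(\<lambda>k. pS k (Suc 0)) \<longlonglongrightarrow> p1" "(\<lambda>k. qS k 0) \<longlonglongrightarrow> q0" "(\<lambda>k. qS k (Suc 0)) \<longlonglongrightarrow> q1"
    and limT: "(\<lambda>k. pT k 0) \<longlonglongrightarrow> r0" "(\<lambda>k. pT k (Suc 0)) \<longlonglongrightarrow> r1" "(\<lambda>k. qT k 0) \<longlonglongrightarrow> s0" "(\<lambda>k. qT k (Suc 0)) \<longlonglongrightarrow> s1"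
  shows "\<exists>k. lines_cross (zA k (Suc 0)) (DA k 0) (zB k (Suc 0)) (DB k 0)"
proof -
  have bB1: "bB k (Suc 0) = a" for k using bB(2)[of 0 k] bA(3) by simp
  have bBA: "bB k j \<in> A" if "j \<le> Suc k" for k j
    using that bB abc(3) bA(1) by (cases j) auto
  note plA = flight_pathD(1)[OF fA(1)] flight_pathD(1)[OF fA(2)]
  note plB = flight_pathD(1)[OF fB(1)] flight_pathD(1)[OF fB(2)]
  have "(\<lambda>k. norm (DA k 0)) \<longlonglongrightarrow> norm (- u)" by (intro tendsto_intros limD)
  moreover have "norm (DA k 0) = 1" for k using plA(1)[of k] by (simp add: pseudo_line_def)
  ultimately have u: "norm u = 1" by (simp add: LIMSEQ_const_iff)
  define u1 where "u1 = reflect (edge_dir e a) (- u)"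
  define L where "L z D x \<longleftrightarrow>
    (\<forall>k. pseudo_line e (\<lambda>j. bA k (Suc j)) k (\<lambda>j. z k (Suc j)) (\<lambda>j. D k (Suc j))) \<and>
    (\<lambda>k. z k (Suc 0)) \<longlonglongrightarrow> x \<and> (\<lambda>k. D k (Suc 0)) \<longlonglongrightarrow> u1" for z D :: "nat \<Rightarrow> nat \<Rightarrow> plane" and x
  have D1: "(\<lambda>k. D k (Suc 0)) \<longlonglongrightarrow> u1"
    if "(\<lambda>k. D k 0) \<longlonglongrightarrow> - u" "\<And>k. D k (Suc 0) = reflect (edge_dir e a) (D k 0)" for D :: "nat \<Rightarrow> nat \<Rightarrow> plane"
    unfolding that(2) u1_def by (rule tendsto_reflect[OF that(1)])
  have LA: "L z D x" if "\<And>k. pseudo_line e (bA k) (Suc k) (z k) (D k)" "(\<lambda>k. z k (Suc 0)) \<longlonglongrightarrow> x"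
    "(\<lambda>k. D k 0) \<longlonglongrightarrow> - u" for z D x
  proof -
    have "pseudo_line e (\<lambda>j. bA k (Suc j)) k (\<lambda>j. z k (Suc j)) (\<lambda>j. D k (Suc j))" for k
      using pseudo_line_shift[OF that(1) bA(1), of _ 1 k] by simp
    moreover have "D k (Suc 0) = reflect (edge_dir e a) (D k 0)" for k
      using that(1)[of k] bA(3)[of k] by (simp add: pseudo_line_def)
    ultimately show ?thesis using D1[of D] that(2,3) by (simp add: L_def)
  qed
  have LB: "L z D x" if "\<And>k. pseudo_line e (bB k) (Suc k) (z k) (D k)" "(\<lambda>k. z k (Suc 0)) \<longlonglongrightarrow> x"
    "(\<lambda>k. D k 0) \<longlonglongrightarrow> - u" for z D x
  proof -
    have "pseudo_line e (\<lambda>j. bB k (Suc j)) k (\<lambda>j. z k (Suc j)) (\<lambda>j. D k (Suc j))" for k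
      using pseudo_line_shift[OF that(1) bBA, of _ 1 k] by simp
    hence "pseudo_line e (\<lambda>j. bA k (Suc j)) k (\<lambda>j. z k (Suc j)) (\<lambda>j. D k (Suc j))" for k
      using bB(2) by (rule pseudo_line_cong)
    moreover have "D k (Suc 0) = reflect (edge_dir e a) (D k 0)" for k
      using that(1)[of k] bB1[of k] by (simp add: pseudo_line_def)
    ultimately show ?thesis using D1[of D] that(2,3) by (simp add: L_def)
  qed
  \<comment> \<open>Any two limits of lines over the common tails have the limit direction in
    common, so their distance on \<open>a\<close> is at most the maximal width. This is used for all
    pairs of sides below.\<close>
  have off: "\<bar>wedge (x' - x) u\<bar> \<le> W" if h: "L z D x" "L z' D' x'" "x \<in> edge_seg e a" "x' \<in> edge_seg e a" for z D x z' D' x'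
  proof -
    have "\<bar>wedge (x' - x) u1\<bar> \<le> W"
      using h(1,2) bA(1) UB unfolding L_def
      by (intro limit_offset_le[of "\<lambda>k j. bA k (Suc j)" W "\<lambda>k j. z k (Suc j)" "\<lambda>k j. D k (Suc j)"
          "\<lambda>k j. z' k (Suc j)" "\<lambda>k j. D' k (Suc j)"]) auto
    moreover obtain l where l: "x' - x = l *\<^sub>R edge_dir e a" using seg_diff_parallel h(3,4) by blast
    moreover have "wedge (x' - x) u1 = - wedge (x' - x) (- u)"
      unfolding u1_def by (rule wedge_reflect_parallel[OF dir_nonzero[OF abc(1)] l])
    ultimately show ?thesis by (simp only: wedge_simps minus_minus)
  qed
  have segs: "x1 \<in> edge_seg e a" "x0 \<in> edge_seg e g" "wedge (x0 - x1) u = 0"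
    if "\<And>k. pseudo_line e (b k) (Suc k) (z k) (D k)" "\<And>k. b k (Suc 0) = a" "\<And>k. b k 0 = g"
      "(\<lambda>k. z k 0) \<longlonglongrightarrow> x0" "(\<lambda>k. z k (Suc 0)) \<longlonglongrightarrow> x1" "(\<lambda>k. D k 0) \<longlonglongrightarrow> - u"
    for b :: "nat \<Rightarrow> nat \<Rightarrow> 'i" and z D :: "nat \<Rightarrow> nat \<Rightarrow> plane" and x0 x1 g
  proof -
    have "z k (Suc 0) \<in> edge_seg e (b k (Suc 0))" "z k 0 \<in> edge_seg e (b k 0)" for k
      using that(1)[of k] unfolding pseudo_line_def by auto
    hence m: "z k (Suc 0) \<in> edge_seg e a" "z k 0 \<in> edge_seg e g" for k using that(2,3) by simp_all
    show "x1 \<in> edge_seg e a" by (rule closed_edge_limit[OF m(1) that(5)])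
    show "x0 \<in> edge_seg e g" by (rule closed_edge_limit[OF m(2) that(4)])
    have "(\<lambda>k. wedge (z k (Suc 0) - z k 0) (D k 0)) \<longlonglongrightarrow> wedge (x1 - x0) (- u)"
      by (intro tendsto_intros that(4-6))
    thus "wedge (x0 - x1) u = 0" using that(1) by (simp add: pseudo_line_def LIMSEQ_const_iff wedge_diff)
  qed
  note sX = segs[OF plA(1) bA(3,2) limA(1,2) limD(1)] and sY = segs[OF plA(2) bA(3,2) limA(3,4) limD(1)]
  note sX' = segs[OF plB(1) bB1 bB(1) limB(1,2) limD(2)] and sY' = segs[OF plB(2) bB1 bB(1) limB(3,4) limD(2)]
  note sp = segs[OF S(1) bA(3,2) limS(1,2) limD(3)] and sq = segs[OF S(2) bA(3,2) limS(3,4) limD(3)]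
  note sr = segs[OF T(1) bB1 bB(1) limT(1,2) limD(4)] and ss = segs[OF T(2) bB1 bB(1) limT(3,4) limD(4)]
  note LX = LA[OF plA(1) limA(2) limD(1)] and LY = LA[OF plA(2) limA(4) limD(1)]
  note LX' = LB[OF plB(1) limB(2) limD(2)] and LY' = LB[OF plB(2) limB(4) limD(2)]
  note Lp = LA[OF S(1) limS(2) limD(3)] and Lq = LA[OF S(2) limS(4) limD(3)]
  note Lr = LB[OF T(1) limT(2) limD(4)] and Ls = LB[OF T(2) limT(4) limD(4)]
  have dX: "wedge (Y1 - X1) u = d"
  proof -
    have "(\<lambda>k. wedge (yA k (Suc 0) - zA k (Suc 0)) (DA k 0)) \<longlonglongrightarrow> wedge (Y1 - X1) (- u)"
      by (intro tendsto_intros limA limD)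
    thus ?thesis using fA(3) by (simp add: LIMSEQ_const_iff)
  qed
  have dX': "wedge (Y1' - X1') u = d"
  proof -
    have "(\<lambda>k. wedge (yB k (Suc 0) - zB k (Suc 0)) (DB k 0)) \<longlonglongrightarrow> wedge (Y1' - X1') (- u)"
      by (intro tendsto_intros limB limD)
    thus ?thesis using fB(3) by (simp add: LIMSEQ_const_iff)
  qed
  have width: "W \<le> wedge (q - p) u"
    if "(\<lambda>k. p' k (Suc 0)) \<longlonglongrightarrow> p" "(\<lambda>k. q' k (Suc 0)) \<longlonglongrightarrow> q" "(\<lambda>k. D k 0) \<longlonglongrightarrow> - u"
      "\<And>k. wedge (q' k (Suc 0) - p' k (Suc 0)) (D k 0) \<le> - (W - \<epsilon> k)"
    for p q and p' q' D :: "nat \<Rightarrow> nat \<Rightarrow> plane"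
  proof -
    have "(\<lambda>k. wedge (q' k (Suc 0) - p' k (Suc 0)) (D k 0)) \<longlonglongrightarrow> wedge (q - p) (- u)"
      by (intro tendsto_intros that(1-3))
    moreover have "(\<lambda>k. - (W - \<epsilon> k)) \<longlonglongrightarrow> - (W - 0)" by (intro tendsto_intros eps)
    ultimately have "wedge (q - p) (- u) \<le> - (W - 0)" using that(4) by (intro LIMSEQ_le) auto
    thus ?thesis by simp
  qed
  have wS: "wedge (q1 - p1) u = W" using width[of pS p1 qS q1 DS, OF limS(2,4) limD(3) S(3)] off[OF Lp Lq sp(1) sq(1)] by simp
  have wT: "wedge (s1 - r1) u = W" using width[of pT r1 qT s1 DT, OF limT(2,4) limD(4) T(3)] off[OF Lr Ls sr(1) ss(1)] by simp
  have W: "0 < W" using off[OF LX LY sX(1) sY(1)] dX d by simp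
  have ta: "wedge (edge_dir e a) u \<noteq> 0" using seg_transversal[OF sp(1) sq(1)] wS W by simp
  \<comment> \<open>Both limit strips have width exactly \<open>W\<close>. If they were shifted, the
    outer side of one and the opposite side of the other would be more than \<open>W\<close>
    apart.\<close>
  have rp: "wedge (r1 - p1) u = 0"
    using off[OF Lp Ls sp(1) ss(1)] off[OF Lr Lq sr(1) sq(1)] wS wT by (simp add: wedge_diff)
  hence r1: "r1 = p1" using same_offset_eq[OF sr(1) sp(1) _ ta] by simp
  have "wedge (s1 - q1) u = 0" using rp wS wT by (simp add: wedge_diff)
  hence s1: "s1 = q1" using same_offset_eq[OF ss(1) sq(1) _ ta] by simp
  \<comment> \<open>By the same maximality the rods lie inside the limit strip: a side sticking out
    would be too far from the opposite side of the strip.\<close>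
  have offX: "0 \<le> wedge (X1 - p1) u" "wedge (Y1 - p1) u \<le> W"
    using off[OF LX Lq sX(1) sq(1)] off[OF Lp LY sp(1) sY(1)] wS by (simp_all add: wedge_diff)
  have offX': "0 \<le> wedge (X1' - p1) u" "wedge (Y1' - p1) u \<le> W"
    using off[OF LX' Lq sX'(1) sq(1)] off[OF Lp LY' sp(1) sY'(1)] wS by (simp_all add: wedge_diff)
  define g0 g1 h0 h1 where "g0 = (p0 - p1) \<bullet> u" and "g1 = (q0 - q1) \<bullet> u"
    and "h0 = (r0 - p1) \<bullet> u" and "h1 = (s0 - q1) \<bullet> u"
  have ext: "x0 = x1 + ((x0 - x1) \<bullet> u) *\<^sub>R u" if "wedge (x0 - x1) u = 0" for x0 x1
    using wedge_zero_parallel[OF that u] by (simp add: algebra_simps)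
  have p0: "p0 = p1 + g0 *\<^sub>R u" and q0: "q0 = q1 + g1 *\<^sub>R u"
    and r0: "r0 = p1 + h0 *\<^sub>R u" and s0: "s0 = q1 + h1 *\<^sub>R u"
    using ext[OF sp(3)] ext[OF sq(3)] ext[OF sr(3)] ext[OF ss(3)]
    unfolding r1 s1 g0_def g1_def h0_def h1_def by blast+
  have fwd: "0 \<le> (x0 - x1) \<bullet> u"
    if "\<And>k. flight_path A e (b k) (Suc k) (z k) (D k) (t k)"
      "(\<lambda>k. z k 0) \<longlonglongrightarrow> x0" "(\<lambda>k. z k (Suc 0)) \<longlonglongrightarrow> x1" "(\<lambda>k. D k 0) \<longlonglongrightarrow> - u"
    for b :: "nat \<Rightarrow> nat \<Rightarrow> 'i" and z D :: "nat \<Rightarrow> nat \<Rightarrow> plane" and t :: "nat \<Rightarrow> nat \<Rightarrow> real" and x0 x1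
  proof -
    have "(\<lambda>k. (z k 0 - z k (Suc 0)) \<bullet> (- D k 0)) \<longlonglongrightarrow> (x0 - x1) \<bullet> (- (- u))"
      by (intro tendsto_intros that(2-4))
    moreover have "0 \<le> (z k 0 - z k (Suc 0)) \<bullet> (- D k 0)" for k
      using flight_pathD(3,4)[OF that(1), of 0 k] by simp
    ultimately have "0 \<le> (x0 - x1) \<bullet> (- (- u))" by (intro LIMSEQ_le_const) auto
    thus ?thesis by simp
  qed
  have gpos: "0 < (1 - \<tau>) * g0 + \<tau> * g1" if "0 < \<tau>" "\<tau> < 1" for \<tau>
    using branch_heights_pos[OF abc(1,2,4) u sp(1) sq(1) sp(2) sq(2) p0 q0 wS sX(1) sY(1) sX(2) sY(2) sX(3) sY(3) dX d offX
        fwd[OF fA(1) limA(1,2) limD(1)] fwd[OF fA(2) limA(3,4) limD(1)] that] .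
  have hpos: "0 < (1 - \<tau>) * h0 + \<tau> * h1" if "0 < \<tau>" "\<tau> < 1" for \<tau>
    using branch_heights_pos[OF abc(1,3,5) u sp(1) sq(1) sr(2) ss(2) r0 s0 wS sX'(1) sY'(1) sX'(2) sY'(2) sX'(3) sY'(3) dX' d offX'
        fwd[OF fB(1) limB(1,2) limD(2)] fwd[OF fB(2) limB(3,4) limD(2)] that] .
  \<comment> \<open>Equal heights over the open strip would be a point of \<open>c'\<close> interior
    to the edge \<open>c\<close>.\<close>
  have ne: "(1 - \<tau>) * h0 + \<tau> * h1 \<noteq> (1 - \<tau>) * g0 + \<tau> * g1" if t: "0 < \<tau>" "\<tau> < 1" for \<tau>
  proof
    assume eq: "(1 - \<tau>) * h0 + \<tau> * h1 = (1 - \<tau>) * g0 + \<tau> * g1"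
    have "p0 + \<tau> *\<^sub>R (q0 - p0) = p1 + \<tau> *\<^sub>R (q1 - p1) + ((1 - \<tau>) * g0 + \<tau> * g1) *\<^sub>R u"
      unfolding p0 q0 by (simp add: algebra_simps)
    moreover have "r0 + \<tau> *\<^sub>R (s0 - r0) = p1 + \<tau> *\<^sub>R (q1 - p1) + ((1 - \<tau>) * h0 + \<tau> * h1) *\<^sub>R u"
      unfolding r0 s0 by (simp add: algebra_simps)
    ultimately have "p0 + \<tau> *\<^sub>R (q0 - p0) = r0 + \<tau> *\<^sub>R (s0 - r0)" using eq by simp
    hence "p0 + \<tau> *\<^sub>R (q0 - p0) \<in> edge_seg e c'" using seg_affine_mem[OF sr(2) ss(2), of \<tau>] t by simp
    moreover have "wedge (q0 - p0) u = W" using wS by (simp add: p0 q0 wedge_diff wedge_add)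
    hence "p0 \<noteq> q0" using W by auto
    hence "p0 + \<tau> *\<^sub>R (q0 - p0) \<in> edge_interior e c"
      using segment_affine_mem_open[OF t] open_seg_subset_interior[OF sp(2) sq(2)] by blast
    ultimately show False using interior_only_edge[OF abc(2,3)] abc(6) by blast
  qed
  \<comment> \<open>The flights from index 0 to index 1 are read backwards, from the common edge
    \<open>a\<close>.\<close>
  have bk: "z k 0 = z k (Suc 0) + t k 0 *\<^sub>R - D k 0"
    "0 < r \<Longrightarrow> r < t k 0 \<Longrightarrow> z k (Suc 0) + r *\<^sub>R - D k 0 \<notin> boundary A e"
    if "\<And>k. flight_path A e (b k) (Suc k) (z k) (D k) (t k)"
    for b :: "nat \<Rightarrow> nat \<Rightarrow> 'i" and z D :: "nat \<Rightarrow> nat \<Rightarrow> plane" and t :: "nat \<Rightarrow> nat \<Rightarrow> real" and k r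
  proof -
    have 1: "z k (Suc 0) = z k 0 + t k 0 *\<^sub>R D k 0" using flight_pathD(4)[OF that, of 0 k] by simp
    thus "z k 0 = z k (Suc 0) + t k 0 *\<^sub>R - D k 0" by simp
    assume "0 < r" "r < t k 0"
    hence "z k 0 + (t k 0 - r) *\<^sub>R D k 0 \<notin> boundary A e"
      using flight_pathD(5)[OF that, of 0 k "t k 0 - r"] by simp
    thus "z k (Suc 0) + r *\<^sub>R - D k 0 \<notin> boundary A e" unfolding 1 by (simp add: algebra_simps)
  qed
  have nrm: "norm (- DA k 0) = 1" "norm (- DB k 0) = 1" for k
    using plA(1)[of k] plB(1)[of k] by (simp_all add: pseudo_line_def)
  have intA: "zA k (Suc 0) \<in> edge_interior e a" "yA k (Suc 0) \<in> edge_interior e a"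
    "zA k (Suc 0) + tA k 0 *\<^sub>R - DA k 0 \<in> edge_interior e c" "yA k (Suc 0) + sA k 0 *\<^sub>R - DA k 0 \<in> edge_interior e c" for k
    using flight_pathD(2)[OF fA(1), of 0 k] flight_pathD(2)[OF fA(2), of 0 k]
      flight_pathD(2)[OF fA(1), of "Suc 0" k] flight_pathD(2)[OF fA(2), of "Suc 0" k] bA(2,3)[of k]
    unfolding bk(1)[OF fA(1), of k, symmetric] bk(1)[OF fA(2), of k, symmetric] by simp_all
  have intB: "zB k (Suc 0) \<in> edge_interior e a" "yB k (Suc 0) \<in> edge_interior e a"
    "zB k (Suc 0) + tB k 0 *\<^sub>R - DB k 0 \<in> edge_interior e c'" "yB k (Suc 0) + sB k 0 *\<^sub>R - DB k 0 \<in> edge_interior e c'" for k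
    using flight_pathD(2)[OF fB(1), of 0 k] flight_pathD(2)[OF fB(2), of 0 k]
      flight_pathD(2)[OF fB(1), of "Suc 0" k] flight_pathD(2)[OF fB(2), of "Suc 0" k] bB(1)[of k] bB1[of k]
    unfolding bk(1)[OF fB(1), of k, symmetric] bk(1)[OF fB(2), of k, symmetric] by simp_all
  have limu: "(\<lambda>k. - DA k 0) \<longlonglongrightarrow> u" "(\<lambda>k. - DB k 0) \<longlonglongrightarrow> u" using tendsto_minus[OF limD(1)] tendsto_minus[OF limD(2)] by simp_all
  have lA0: "(\<lambda>k. zA k (Suc 0) + tA k 0 *\<^sub>R - DA k 0) \<longlonglongrightarrow> X0" "(\<lambda>k. yA k (Suc 0) + sA k 0 *\<^sub>R - DA k 0) \<longlonglongrightarrow> Y0"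
    using limA(1,3) by (simp_all add: bk(1)[OF fA(1), symmetric] bk(1)[OF fA(2), symmetric] del: scaleR_minus_right)
  have lB0: "(\<lambda>k. zB k (Suc 0) + tB k 0 *\<^sub>R - DB k 0) \<longlonglongrightarrow> X0'" "(\<lambda>k. yB k (Suc 0) + sB k 0 *\<^sub>R - DB k 0) \<longlonglongrightarrow> Y0'"
    using limB(1,3) by (simp_all add: bk(1)[OF fB(1), symmetric] bk(1)[OF fB(2), symmetric] del: scaleR_minus_right)
  have wd: "wedge (yA k (Suc 0) - zA k (Suc 0)) (- DA k 0) = d" "wedge (yB k (Suc 0) - zB k (Suc 0)) (- DB k 0) = d" for k
    using fA(3) fB(3) by simp_all
  have pos': "(- DA k 0) \<bullet> (- DB k 0) > 0" "(- DB k 0) \<bullet> (- DA k 0) > 0" for k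
    using pos[of k] by (simp_all add: inner_commute)
  \<comment> \<open>The heights of the two edges never agree over the open strip, so comparing them
    at the parameter 1/2 decides which edge is in front throughout. The two cases exchange the roles
    of the rods.\<close>
  show ?thesis
  proof (cases "(1 - 1/2) * h0 + 1/2 * h1 < (1 - 1/2) * g0 + 1/2 * g1")
    case True
    have ord: "(1 - \<tau>) * h0 + \<tau> * h1 < (1 - \<tau>) * g0 + \<tau> * g1" if t: "0 < \<tau>" "\<tau> < 1" for \<tau>
    proof -
      have lin: "(1 - \<sigma>) * (g0 - h0) + \<sigma> * (g1 - h1) = (1 - \<sigma>) * g0 + \<sigma> * g1 - ((1 - \<sigma>) * h0 + \<sigma> * h1)" for \<sigma>
        by (simp add: algebra_simps)
      have "0 < (1 - \<tau>) * (g0 - h0) + \<tau> * (g1 - h1)"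
      proof (rule affine_pos[where m = "1/2", OF _ _ _ _ t])
        show "(1 - \<sigma>) * (g0 - h0) + \<sigma> * (g1 - h1) \<noteq> 0" if "0 < \<sigma>" "\<sigma> < 1" for \<sigma>
          using ne[OF that] unfolding lin by simp
        show "0 \<le> (1 - 1/2) * (g0 - h0) + 1/2 * (g1 - h1)" using True unfolding lin by simp
      qed auto
      thus ?thesis unfolding lin by simp
    qed
    have "\<exists>k. lines_cross (zA k (Suc 0)) (- DA k 0) (zB k (Suc 0)) (- DB k 0)"
      using rod_encircles_limit[where xA = "\<lambda>k. zA k (Suc 0)" and yA = "\<lambda>k. yA k (Suc 0)" and tA = "\<lambda>k. tA k 0"
          and sA = "\<lambda>k. sA k 0" and uA = "\<lambda>k. - DA k 0" and xB = "\<lambda>k. zB k (Suc 0)" and yB = "\<lambda>k. yB k (Suc 0)"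
          and tB = "\<lambda>k. tB k 0" and sB = "\<lambda>k. sB k 0" and uB = "\<lambda>k. - DB k 0",
          OF abc u d nrm(1) intA bk(2)[OF fA(1)] bk(2)[OF fA(2)] wd(1) nrm(2) intB(3,4) wd(2) pos'(1)
          limA(2,4) lA0 limu sp(1) sq(1) sp(2) sq(2) p0 q0 wS sr(2) ss(2) r0 s0 offX hpos ord] .
    thus ?thesis unfolding lines_cross_uminus .
  next
    case False
    have ord: "(1 - \<tau>) * g0 + \<tau> * g1 < (1 - \<tau>) * h0 + \<tau> * h1" if t: "0 < \<tau>" "\<tau> < 1" for \<tau>
    proof -
      have lin: "(1 - \<sigma>) * (h0 - g0) + \<sigma> * (h1 - g1) = (1 - \<sigma>) * h0 + \<sigma> * h1 - ((1 - \<sigma>) * g0 + \<sigma> * g1)" for \<sigma>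
        by (simp add: algebra_simps)
      have "0 < (1 - \<tau>) * (h0 - g0) + \<tau> * (h1 - g1)"
      proof (rule affine_pos[where m = "1/2", OF _ _ _ _ t])
        show "(1 - \<sigma>) * (h0 - g0) + \<sigma> * (h1 - g1) \<noteq> 0" if "0 < \<sigma>" "\<sigma> < 1" for \<sigma>
          using ne[OF that] unfolding lin by simp
        show "0 \<le> (1 - 1/2) * (h0 - g0) + 1/2 * (h1 - g1)" using False unfolding lin by simp
      qed auto
      thus ?thesis unfolding lin by simp
    qed
    have "\<exists>k. lines_cross (zB k (Suc 0)) (- DB k 0) (zA k (Suc 0)) (- DA k 0)"
      using rod_encircles_limit[where xA = "\<lambda>k. zB k (Suc 0)" and yA = "\<lambda>k. yB k (Suc 0)" and tA = "\<lambda>k. tB k 0"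
          and sA = "\<lambda>k. sB k 0" and uA = "\<lambda>k. - DB k 0" and xB = "\<lambda>k. zA k (Suc 0)" and yB = "\<lambda>k. yA k (Suc 0)"
          and tB = "\<lambda>k. tA k 0" and sB = "\<lambda>k. sA k 0" and uB = "\<lambda>k. - DA k 0",
          OF abc(1,3,2,5,4) abc(6)[symmetric] u d nrm(2) intB bk(2)[OF fB(1)] bk(2)[OF fB(2)] wd(2) nrm(1) intA(3,4) wd(1) pos'(2)
          limB(2,4) lB0 limu(2,1) sp(1) sq(1) sr(2) ss(2) r0 s0 wS sp(2) sq(2) p0 q0 offX' gpos ord] .
    thus ?thesis unfolding lines_cross_uminus using lines_cross_commute by blast
  qed
qed

end

context edge_system begin

lemma flight_path_tail:
  assumes "flight_path A e b (Suc m) z D t" "\<And>j. j \<le> Suc m \<Longrightarrow> b j \<in> A"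
  shows "flight_path A e (\<lambda>j. b (Suc j)) m (\<lambda>j. z (Suc j)) (\<lambda>j. D (Suc j)) (\<lambda>j. t (Suc j))"
proof -
  have "\<forall>j<m. 0 < t (Suc j) \<and> z (Suc (Suc j)) = z (Suc j) + t (Suc j) *\<^sub>R D (Suc j) \<and>
      (\<forall>r. 0 < r \<and> r < t (Suc j) \<longrightarrow> z (Suc j) + r *\<^sub>R D (Suc j) \<notin> boundary A e)"
    using assms(1) unfolding flight_path_def by blast
  thus ?thesis
    using pseudo_line_shift[OF flight_pathD(1)[OF assms(1)] assms(2), of 1 m] flight_pathD(2)[OF assms(1)]
    unfolding flight_path_def by simp
qed

lemma pseudo_line_tail:
  assumes "pseudo_line e b (Suc m) z D" "\<And>j. j \<le> Suc m \<Longrightarrow> b j \<in> A"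
  shows "pseudo_line e (\<lambda>j. b (Suc j)) m (\<lambda>j. z (Suc j)) (\<lambda>j. D (Suc j))"
  using pseudo_line_shift[OF assms, of 1 m] by simp

text \<open>A strip has neither orientation nor a first side: reversing the direction makes it face
  \<open>v\<close>, exchanging the lines fixes the sign. Without this the limits of its directions
  could be opposite to those of the rods.\<close>

lemma strip_normalized:
  assumes "strip e b (Suc m) w"
  obtains p q D where "pseudo_line e b (Suc m) p D" "pseudo_line e b (Suc m) q D"
    "0 \<le> D 0 \<bullet> v" "wedge (q (Suc 0) - p (Suc 0)) (D 0) \<le> - w"
proof -
  obtain p q D where 1: "pseudo_line e b (Suc m) p D" "pseudo_line e b (Suc m) q D"
    "w \<le> \<bar>wedge (q 0 - p 0) (D 0)\<bar>"
    using assms unfolding strip_def by blast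
  have "wedge (p (Suc 0) - p 0) (D 0) = 0" "wedge (q (Suc 0) - q 0) (D 0) = 0"
    using 1 by (auto simp: pseudo_line_def)
  hence w: "w \<le> \<bar>wedge (q (Suc 0) - p (Suc 0)) (D 0)\<bar>" using 1(3) by (simp add: wedge_diff)
  obtain D' where D': "pseudo_line e b (Suc m) p D'" "pseudo_line e b (Suc m) q D'"
    "0 \<le> D' 0 \<bullet> v" "w \<le> \<bar>wedge (q (Suc 0) - p (Suc 0)) (D' 0)\<bar>"
  proof (cases "0 \<le> D 0 \<bullet> v")
    case True
    thus ?thesis using that 1 w by blast
  next
    case False
    thus ?thesis using that[of "\<lambda>j. - D j"] pseudo_line_uminus[OF 1(1)] pseudo_line_uminus[OF 1(2)] w by simp
  qed
  show ?thesis
  proof (cases "wedge (q (Suc 0) - p (Suc 0)) (D' 0) \<le> 0")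
    case True
    thus ?thesis using that[OF D'(1,2,3)] D'(4) by simp
  next
    case False
    have "wedge (p (Suc 0) - q (Suc 0)) (D' 0) = - wedge (q (Suc 0) - p (Suc 0)) (D' 0)" by (simp add: wedge_diff)
    thus ?thesis using that[OF D'(2,1,3)] D'(4) False by simp
  qed
qed

text \<open>The words agree only from index 1 on, where the general bound applies; the common mirror
  at index 1 carries the angle back to the directions at index 0.\<close>

lemma tail_angle_bound:
  assumes fA: "flight_path A e b (Suc k) z D t" and pl: "pseudo_line e b' (Suc k) z' D'"
    and b: "\<And>j. j \<le> Suc k \<Longrightarrow> b j \<in> A" "\<And>j. j \<le> Suc k \<Longrightarrow> b' j \<in> A" "\<And>j. j \<le> k \<Longrightarrow> b' (Suc j) = b (Suc j)"
    and len: "l \<le> (\<Sum>j<k. t (Suc j))"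
  shows "\<bar>wedge (D' 0) (D 0)\<bar> * l \<le> 2 * size_bound"
proof -
  have 1: "pseudo_line e (\<lambda>j. b (Suc j)) k (\<lambda>j. z (Suc j)) (\<lambda>j. D (Suc j))"
    using pseudo_line_tail[OF flight_pathD(1)[OF fA] b(1)] .
  have "pseudo_line e (\<lambda>j. b' (Suc j)) k (\<lambda>j. z' (Suc j)) (\<lambda>j. D' (Suc j))"
    using pseudo_line_tail[OF pl b(2)] .
  hence 2: "pseudo_line e (\<lambda>j. b (Suc j)) k (\<lambda>j. z' (Suc j)) (\<lambda>j. D' (Suc j))"
    using b(3) by (rule pseudo_line_cong)
  have 3: "\<bar>wedge (D' (Suc 0)) (D (Suc 0))\<bar> * (\<Sum>j<k. t (Suc j)) \<le> 2 * size_bound"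
    using angle_bound[OF 1 2, of "\<lambda>j. t (Suc j)"] b(1) flight_pathD(3,4)[OF fA] by simp
  have "D (Suc 0) = reflect (edge_dir e (b (Suc 0))) (D 0)" "D' (Suc 0) = reflect (edge_dir e (b (Suc 0))) (D' 0)"
    using flight_pathD(1)[OF fA] pl b(3)[of 0] by (auto simp: pseudo_line_def)
  hence "\<bar>wedge (D' (Suc 0)) (D (Suc 0))\<bar> = \<bar>wedge (D' 0) (D 0)\<bar>"
    using reflect_wedge[OF dir_nonzero[OF b(1)[of "Suc 0"]]] by simp
  moreover have "\<bar>wedge (D' 0) (D 0)\<bar> * l \<le> \<bar>wedge (D' 0) (D 0)\<bar> * (\<Sum>j<k. t (Suc j))"
    using len by (intro mult_left_mono) auto
  ultimately show ?thesis using 3 by simp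
qed

lemma tail_inner_pos:
  assumes fA: "flight_path A e b (Suc k) z D t" and fB: "flight_path A e b' (Suc k) z' D' t'"
    and b: "\<And>j. j \<le> Suc k \<Longrightarrow> b j \<in> A" "\<And>j. j \<le> Suc k \<Longrightarrow> b' j \<in> A" "\<And>j. j \<le> k \<Longrightarrow> b' (Suc j) = b (Suc j)"
    and len: "2 * size_bound < (\<Sum>j<k. t (Suc j))"
  shows "D 0 \<bullet> D' 0 > 0"
proof -
  note pl = flight_pathD(1)[OF fB]
  have 1: "pseudo_line e (\<lambda>j. b (Suc j)) k (\<lambda>j. z (Suc j)) (\<lambda>j. D (Suc j))"
    using pseudo_line_tail[OF flight_pathD(1)[OF fA] b(1)] .
  have "pseudo_line e (\<lambda>j. b' (Suc j)) k (\<lambda>j. z' (Suc j)) (\<lambda>j. D' (Suc j))"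
    using pseudo_line_tail[OF pl b(2)] .
  hence 2: "pseudo_line e (\<lambda>j. b (Suc j)) k (\<lambda>j. z' (Suc j)) (\<lambda>j. D' (Suc j))"
    using b(3) by (rule pseudo_line_cong)
  have 3: "D' (Suc 0) \<bullet> D (Suc 0) > 0"
    using direction_inner_pos[OF 1 2, of "\<lambda>j. t (Suc j)" "\<lambda>j. t' (Suc j)"] b(1) len
      flight_pathD(3,4)[OF fA] flight_pathD(3,4)[OF fB] by simp
  have "D (Suc 0) = reflect (edge_dir e (b (Suc 0))) (D 0)" "D' (Suc 0) = reflect (edge_dir e (b (Suc 0))) (D' 0)"
    using flight_pathD(1)[OF fA] pl b(3)[of 0] by (auto simp: pseudo_line_def)
  thus ?thesis
    using 3 reflect_inner[OF dir_nonzero[OF b(1)[of "Suc 0"]]] by (simp add: inner_commute)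
qed

text \<open>The letters differ at index 0 only. The fixed sign labels the sides of both rods alike:
  it is \<open>- d\<close> against the direction of flight, hence \<open>+ d\<close> for an observer
  looking back from index 1.\<close>

definition split_rods ::
  "nat \<Rightarrow> real \<Rightarrow> (nat \<Rightarrow> 'i) \<Rightarrow> (nat \<Rightarrow> 'i) \<Rightarrow> (nat \<Rightarrow> plane) \<Rightarrow> (nat \<Rightarrow> plane) \<Rightarrow> (nat \<Rightarrow> plane) \<Rightarrow>
    (nat \<Rightarrow> real) \<Rightarrow> (nat \<Rightarrow> real) \<Rightarrow> (nat \<Rightarrow> plane) \<Rightarrow> (nat \<Rightarrow> plane) \<Rightarrow> (nat \<Rightarrow> plane) \<Rightarrow>
    (nat \<Rightarrow> real) \<Rightarrow> (nat \<Rightarrow> real) \<Rightarrow> bool" where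
  "split_rods k d bA bB zA yA DA tA sA zB yB DB tB sB \<longleftrightarrow>
    bA 0 \<noteq> bB 0 \<and> (\<forall>j\<le>k. bB (Suc j) = bA (Suc j)) \<and>
    flight_path A e bA (Suc k) zA DA tA \<and> flight_path A e bA (Suc k) yA DA sA \<and>
    wedge (yA (Suc 0) - zA (Suc 0)) (DA 0) = - d \<and>
    flight_path A e bB (Suc k) zB DB tB \<and> flight_path A e bB (Suc k) yB DB sB \<and>
    wedge (yB (Suc 0) - zB (Suc 0)) (DB 0) = - d"

lemma rods_cross_at_split:
  fixes G :: "nat \<Rightarrow> (nat \<Rightarrow> 'i) \<Rightarrow> bool"
  assumes d: "0 < d" and GA: "\<And>k b j. G k b \<Longrightarrow> b j \<in> A"
    and UB: "\<And>\<epsilon>. \<epsilon> > 0 \<Longrightarrow> \<exists>m k0. \<forall>k b. k \<ge> k0 \<longrightarrow> G k b \<longrightarrow> \<not> strip e (\<lambda>j. b (Suc j)) m (W + \<epsilon>)"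
  shows "\<exists>k. \<forall>bA bB zA yA DA tA sA zB yB DB tB sB. G k bA \<longrightarrow> G k bB \<longrightarrow>
    strip e bA (Suc k) (W - inverse (real (Suc k))) \<longrightarrow> strip e bB (Suc k) (W - inverse (real (Suc k))) \<longrightarrow>
    split_rods k d bA bB zA yA DA tA sA zB yB DB tB sB \<longrightarrow>
    lines_cross (zA (Suc 0)) (DA 0) (zB (Suc 0)) (DB 0)"
proof (rule ccontr)
  assume asm: "\<not> ?thesis"
  define strips where "strips k b v p q D \<longleftrightarrow> pseudo_line e b (Suc k) p D \<and> pseudo_line e b (Suc k) q D \<and>
    0 \<le> D 0 \<bullet> v \<and> wedge (q (Suc 0) - p (Suc 0)) (D 0) \<le> - (W - inverse (real (Suc k)))"
    for k b and v :: plane and p q D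
  define bad where "bad k bA bB zA yA DA tA sA zB yB DB tB sB pS qS DS pT qT DT \<longleftrightarrow>
    G k bA \<and> G k bB \<and> split_rods k d bA bB zA yA DA tA sA zB yB DB tB sB \<and>
    \<not> lines_cross (zA (Suc 0)) (DA 0) (zB (Suc 0)) (DB 0) \<and>
    strips k bA (DA 0) pS qS DS \<and> strips k bB (DA 0) pT qT DT"
    for k bA bB zA yA DA tA sA zB yB DB tB sB pS qS DS pT qT DT
  have "\<forall>k. \<exists>bA bB zA yA DA tA sA zB yB DB tB sB pS qS DS pT qT DT.
    bad k bA bB zA yA DA tA sA zB yB DB tB sB pS qS DS pT qT DT"
  proof
    fix k
    have "\<exists>bA bB zA yA DA tA sA zB yB DB tB sB. G k bA \<and> G k bB \<and>
      strip e bA (Suc k) (W - inverse (real (Suc k))) \<and> strip e bB (Suc k) (W - inverse (real (Suc k))) \<and>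
      split_rods k d bA bB zA yA DA tA sA zB yB DB tB sB \<and>
      \<not> lines_cross (zA (Suc 0)) (DA 0) (zB (Suc 0)) (DB 0)"
      using asm by (simp only: not_ex not_all not_imp)
    then obtain bA bB zA yA DA tA sA zB yB DB tB sB where 1: "G k bA" "G k bB"
      "strip e bA (Suc k) (W - inverse (real (Suc k)))" "strip e bB (Suc k) (W - inverse (real (Suc k)))"
      "split_rods k d bA bB zA yA DA tA sA zB yB DB tB sB"
      "\<not> lines_cross (zA (Suc 0)) (DA 0) (zB (Suc 0)) (DB 0)"
      by (elim exE conjE) (rule that; assumption)
    obtain pS qS DS where "strips k bA (DA 0) pS qS DS"
      using strip_normalized[OF 1(3), of "DA 0"] unfolding strips_def by blast
    moreover obtain pT qT DT where "strips k bB (DA 0) pT qT DT"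
      using strip_normalized[OF 1(4), of "DA 0"] unfolding strips_def by blast
    ultimately have "bad k bA bB zA yA DA tA sA zB yB DB tB sB pS qS DS pT qT DT"
      using 1 unfolding bad_def by blast
    thus "\<exists>bA bB zA yA DA tA sA zB yB DB tB sB pS qS DS pT qT DT.
      bad k bA bB zA yA DA tA sA zB yB DB tB sB pS qS DS pT qT DT" by blast
  qed
  then obtain bA bB zA yA DA tA sA zB yB DB tB sB pS qS DS pT qT DT where
    bad: "\<And>k. bad k (bA k) (bB k) (zA k) (yA k) (DA k) (tA k) (sA k) (zB k) (yB k) (DB k) (tB k) (sB k)
      (pS k) (qS k) (DS k) (pT k) (qT k) (DT k)"
    unfolding choice_iff by (elim exE) (rule that, rule spec)
  have GAB: "G k (bA k)" "G k (bB k)" for k using bad[of k] unfolding bad_def by blast+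
  have bAA: "bA k j \<in> A" "bB k j \<in> A" for k j using GA GAB by blast+
  have nc: "\<not> lines_cross (zA k (Suc 0)) (DA k 0) (zB k (Suc 0)) (DB k 0)" for k
    using bad[of k] unfolding bad_def by blast
  have "split_rods k d (bA k) (bB k) (zA k) (yA k) (DA k) (tA k) (sA k) (zB k) (yB k) (DB k) (tB k) (sB k)" for k
    using bad[of k] unfolding bad_def by blast
  hence heads: "bA k 0 \<noteq> bB k 0" and tails: "\<And>j. j \<le> k \<Longrightarrow> bB k (Suc j) = bA k (Suc j)"
    and fzA: "flight_path A e (bA k) (Suc k) (zA k) (DA k) (tA k)"
    and fyA: "flight_path A e (bA k) (Suc k) (yA k) (DA k) (sA k)"
    and dA: "wedge (yA k (Suc 0) - zA k (Suc 0)) (DA k 0) = - d"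
    and fzB: "flight_path A e (bB k) (Suc k) (zB k) (DB k) (tB k)"
    and fyB: "flight_path A e (bB k) (Suc k) (yB k) (DB k) (sB k)"
    and dB: "wedge (yB k (Suc 0) - zB k (Suc 0)) (DB k 0) = - d" for k
    unfolding split_rods_def by blast+
  have "strips k (bA k) (DA k 0) (pS k) (qS k) (DS k)" "strips k (bB k) (DA k 0) (pT k) (qT k) (DT k)" for k
    using bad[of k] unfolding bad_def by blast+
  hence pS: "pseudo_line e (bA k) (Suc k) (pS k) (DS k)" and qS: "pseudo_line e (bA k) (Suc k) (qS k) (DS k)"
    and iS: "0 \<le> DS k 0 \<bullet> DA k 0" and wS: "wedge (qS k (Suc 0) - pS k (Suc 0)) (DS k 0) \<le> - (W - inverse (real (Suc k)))"
    and pT: "pseudo_line e (bB k) (Suc k) (pT k) (DT k)" and qT: "pseudo_line e (bB k) (Suc k) (qT k) (DT k)"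
    and iT: "0 \<le> DT k 0 \<bullet> DA k 0" and wT: "wedge (qT k (Suc 0) - pT k (Suc 0)) (DT k 0) \<le> - (W - inverse (real (Suc k)))"
    for k
    unfolding strips_def by blast+
  note plA = flight_pathD(1)[OF fzA] flight_pathD(1)[OF fyA]
  note plB = flight_pathD(1)[OF fzB] flight_pathD(1)[OF fyB]

  \<comment> \<open>The rod makes the lengths of the common tails grow linearly in \<open>k\<close>,
    so all angles between lines over the same tail are of order 1 / \<open>k\<close>.\<close>
  obtain \<eta> where \<eta>: "\<eta> > 0" and len': "\<And>b m z z' D t t'. (\<forall>j\<le>m. b j \<in> A) \<Longrightarrow> flight_path A e b m z D t \<Longrightarrow>
    flight_path A e b m z' D t' \<Longrightarrow> d \<le> \<bar>wedge (z' 0 - z 0) (D 0)\<bar> \<Longrightarrow> \<eta> * m - size_bound \<le> sum t {..<m}"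
    using flight_length[OF d] by blast
  have len: "\<eta> * k - size_bound \<le> (\<Sum>j<k. tA k (Suc j))" for k
  proof (rule len'[OF _ flight_path_tail[OF fzA] flight_path_tail[OF fyA]])
    have "wedge (yA k (Suc 0) - zA k (Suc 0)) (DA k (Suc 0)) = (-1) ^ Suc 0 * wedge (yA k 0 - zA k 0) (DA k 0)"
      using width_signed[OF plA, of k "Suc 0"] bAA by simp
    moreover have "wedge (yA k (Suc 0) - zA k (Suc 0)) (DA k 0) = wedge (yA k 0 - zA k 0) (DA k 0)"
      using plA[of k] by (simp add: pseudo_line_def wedge_diff)
    ultimately show "d \<le> \<bar>wedge (yA k (Suc 0) - zA k (Suc 0)) (DA k (Suc 0))\<bar>" using dA[of k] by simp
  qed (use bAA in auto)
  have angle: "\<bar>wedge (D' k 0) (DA k 0)\<bar> * (\<eta> * k - size_bound) \<le> 2 * size_bound"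
    if "pseudo_line e (b' k) (Suc k) (z' k) (D' k)" "\<And>j. b' k j \<in> A" "\<And>j. j \<le> k \<Longrightarrow> b' k (Suc j) = bA k (Suc j)"
    for b' :: "nat \<Rightarrow> nat \<Rightarrow> 'i" and z' D' k
    using tail_angle_bound[OF fzA that(1) bAA(1) that(2) that(3) len] by simp
  \<comment> \<open>Beyond \<open>K\<close> the tail is longer than \<open>2 * size_bound\<close>,
    which excludes opposite directions. Moreover \<open>size_bound\<close> is then at most a third
    of \<open>\<eta> * k\<close>, whence the factor 2/3 further down.\<close>
  obtain K :: nat where K: "3 * size_bound < \<eta> * K" using \<eta> by (metis mult.commute reals_Archimedean3)
  have pos: "DA k 0 \<bullet> DB k 0 > 0" if "k \<ge> K" for k
  proof -
    have "\<eta> * K \<le> \<eta> * k" using \<eta> that by simp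
    hence "2 * size_bound < (\<Sum>j<k. tA k (Suc j))" using len[of k] K by linarith
    thus ?thesis using tail_inner_pos[OF fzA fzB bAA tails] by blast
  qed

  have "(bA k 0, bB k 0, bA k (Suc 0)) \<in> A \<times> A \<times> A" for k using bAA by simp
  moreover have "finite (A \<times> A \<times> A)" using finite_A by simp
  ultimately obtain s0 h where s0: "strict_mono (s0 :: nat \<Rightarrow> nat)"
    and h0: "\<And>k. (bA (s0 k) 0, bB (s0 k) 0, bA (s0 k) (Suc 0)) = h"
    using constant_subsequence[of "A \<times> A \<times> A" "\<lambda>k. (bA k 0, bB k 0, bA k (Suc 0))"] by blast
  define c c' a where "c = fst h" and "c' = fst (snd h)" and "a = snd (snd h)"
  have c0: "bA (s0 k) 0 = c" "bB (s0 k) 0 = c'" "bA (s0 k) (Suc 0) = a" for k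
    unfolding c_def c'_def a_def h0[of k, symmetric] by simp_all
  define s where "s k = s0 (k + K)" for k
  have s: "strict_mono s" using s0 by (auto simp: s_def strict_mono_def)
  have sK: "K \<le> s k" for k using seq_suble[OF s0, of "k + K"] by (simp add: s_def)
  obtain B where B: "B \<ge> 1" "\<And>a x. a \<in> A \<Longrightarrow> x \<in> edge_seg e a \<Longrightarrow> norm x \<le> B"
    using boundary_norm_bound by blast
  define head where "head T k = (fst T k 0, fst T k (Suc 0), fst (snd T) k 0, fst (snd T) k (Suc 0), snd (snd T) k 0)"
    for T :: "(nat \<Rightarrow> nat \<Rightarrow> plane) \<times> (nat \<Rightarrow> nat \<Rightarrow> plane) \<times> (nat \<Rightarrow> nat \<Rightarrow> plane)" and k :: nat
  define I where "I = {(zA, yA, DA), (zB, yB, DB), (pS, qS, DS), (pT, qT, DT)}"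
  have bdd: "bounded (range (\<lambda>k. head (z, y, D) (s k)))"
    if h: "\<And>k. pseudo_line e (b k) (Suc k) (z k) (D k)" "\<And>k. pseudo_line e (b k) (Suc k) (y k) (D k)" "\<And>k j. b k j \<in> A"
    for b :: "nat \<Rightarrow> nat \<Rightarrow> 'i" and z y D
  proof -
    have "norm (z k j) \<le> B \<and> norm (y k j) \<le> B" if "j \<le> Suc k" for k j
      using h(1,2)[of k] B(2) h(3) that unfolding pseudo_line_def by blast
    moreover have "norm (D k 0) \<le> B" for k using h(1)[of k] B(1) by (simp add: pseudo_line_def)
    ultimately have "head (z, y, D) (s k) \<in> cball 0 B \<times> cball 0 B \<times> cball 0 B \<times> cball 0 B \<times> cball 0 B" for k
      by (simp add: head_def)
    moreover have "bounded (cball (0::plane) B \<times> cball (0::plane) B \<times> cball (0::plane) B \<times> cball (0::plane) B \<times> cball (0::plane) B)"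
      by (intro bounded_Times bounded_cball)
    ultimately show ?thesis by (meson bounded_subset image_subsetI)
  qed
  have "bounded (range (\<lambda>k. head T (s k)))" if "T \<in> I" for T
    using that bdd[OF plA(1) plA(2) bAA(1)] bdd[OF plB(1) plB(2) bAA(2)] bdd[OF pS qS bAA(1)] bdd[OF pT qT bAA(2)]
    unfolding I_def by blast
  moreover have "finite I" by (simp add: I_def)
  ultimately obtain r l where r: "strict_mono (r :: nat \<Rightarrow> nat)"
    and l: "\<And>T. T \<in> I \<Longrightarrow> ((\<lambda>k. head T (s k)) \<circ> r) \<longlonglongrightarrow> l T"
    using bounded_family_subsequence[of I "\<lambda>T k. head T (s k)"] by blast
  define R where "R = s \<circ> r"
  have R: "strict_mono R" unfolding R_def using s r by (rule strict_mono_o)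
  have Rge: "k \<le> R k" "K \<le> R k" for k using seq_suble[OF R] sK by (auto simp: R_def)
  have lim: "(\<lambda>k. z (R k) 0) \<longlonglongrightarrow> fst (l (z, y, D))" "(\<lambda>k. z (R k) (Suc 0)) \<longlonglongrightarrow> fst (snd (l (z, y, D)))"
    "(\<lambda>k. y (R k) 0) \<longlonglongrightarrow> fst (snd (snd (l (z, y, D))))" "(\<lambda>k. y (R k) (Suc 0)) \<longlonglongrightarrow> fst (snd (snd (snd (l (z, y, D)))))"
    "(\<lambda>k. D (R k) 0) \<longlonglongrightarrow> snd (snd (snd (snd (l (z, y, D)))))" if "(z, y, D) \<in> I" for z y D
  proof -
    have *: "(\<lambda>k. head (z, y, D) (R k)) \<longlonglongrightarrow> l (z, y, D)" using l[OF that] by (simp add: R_def o_def)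
    note 2 = tendsto_snd[OF *] note 3 = tendsto_snd[OF 2] note 4 = tendsto_snd[OF 3]
    show "(\<lambda>k. z (R k) 0) \<longlonglongrightarrow> fst (l (z, y, D))" using tendsto_fst[OF *] by (simp add: head_def)
    show "(\<lambda>k. z (R k) (Suc 0)) \<longlonglongrightarrow> fst (snd (l (z, y, D)))" using tendsto_fst[OF 2] by (simp add: head_def)
    show "(\<lambda>k. y (R k) 0) \<longlonglongrightarrow> fst (snd (snd (l (z, y, D))))" using tendsto_fst[OF 3] by (simp add: head_def)
    show "(\<lambda>k. y (R k) (Suc 0)) \<longlonglongrightarrow> fst (snd (snd (snd (l (z, y, D)))))" using tendsto_fst[OF 4] by (simp add: head_def)
    show "(\<lambda>k. D (R k) 0) \<longlonglongrightarrow> snd (snd (snd (snd (l (z, y, D)))))" using tendsto_snd[OF 4] by (simp add: head_def)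
  qed
  have memI: "(zA, yA, DA) \<in> I" "(zB, yB, DB) \<in> I" "(pS, qS, DS) \<in> I" "(pT, qT, DT) \<in> I" by (auto simp: I_def)
  define v where "v = snd (snd (snd (snd (l (zA, yA, DA)))))"
  have limA: "(\<lambda>k. DA (R k) 0) \<longlonglongrightarrow> v" using lim(5)[OF memI(1)] by (simp add: v_def)
  \<comment> \<open>Every direction over a common tail has the same limit as that of rod A: the sine
    of the angle tends to 0 and the inner product stays nonnegative.\<close>
  have same: "v' = v" if lv: "(\<lambda>k. D' (R k) 0) \<longlonglongrightarrow> v'" and h: "\<And>k. pseudo_line e (b' k) (Suc k) (z' k) (D' k)" "\<And>k j. b' k j \<in> A"
      "\<And>k j. j \<le> k \<Longrightarrow> b' k (Suc j) = bA k (Suc j)" and inn: "\<And>k. k \<ge> K \<Longrightarrow> 0 \<le> D' k 0 \<bullet> DA k 0"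
    for b' :: "nat \<Rightarrow> nat \<Rightarrow> 'i" and z' D' :: "nat \<Rightarrow> nat \<Rightarrow> plane" and v'
  proof -
    have n: "norm (D' k 0) = 1" "norm (DA k 0) = 1" for k using h(1)[of k] plA(1)[of k] by (auto simp: pseudo_line_def)
    have nv: "norm v' = 1" "norm v = 1"
      using tendsto_norm[OF lv] tendsto_norm[OF limA] n by (simp_all add: LIMSEQ_const_iff)
    have "(\<lambda>k. D' (R k) 0 \<bullet> DA (R k) 0) \<longlonglongrightarrow> v' \<bullet> v" by (intro tendsto_intros lv limA)
    hence i: "0 \<le> v' \<bullet> v" using inn Rge by (intro LIMSEQ_le_const) auto
    have w: "(\<lambda>k. \<bar>wedge (D' (R k) 0) (DA (R k) 0)\<bar>) \<longlonglongrightarrow> \<bar>wedge v' v\<bar>" by (intro tendsto_intros lv limA)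
    have "\<bar>wedge (D' (R k) 0) (DA (R k) 0)\<bar> \<le> (3 * size_bound / \<eta>) / k" if k: "k \<ge> Suc K" for k
    proof -
      have "\<eta> * real k \<le> \<eta> * real (R k)" "\<eta> * real K \<le> \<eta> * real k" using Rge(1)[of k] k \<eta> by auto
      hence ge: "\<eta> * real (R k) - size_bound \<ge> 2 * (\<eta> * k) / 3" using K by linarith
      have "\<bar>wedge (D' (R k) 0) (DA (R k) 0)\<bar> * (2 * (\<eta> * k) / 3) \<le> 2 * size_bound"
        by (rule order_trans[OF mult_left_mono[OF ge abs_ge_zero]
          angle[where b' = b' and z' = z' and D' = D' and k = "R k", OF h]])
      thus ?thesis using \<eta> k by (simp add: field_simps)
    qed
    hence "\<bar>wedge v' v\<bar> \<le> 0"
      by (intro LIMSEQ_le[OF w lim_const_over_n[of "3 * size_bound / \<eta>"]]) blast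
    hence "wedge v' v = 0" by simp
    thus ?thesis using unit_parallel_eq i nv by blast
  qed
  have limB: "(\<lambda>k. DB (R k) 0) \<longlonglongrightarrow> v"
    using lim(5)[OF memI(2)] same[OF lim(5)[OF memI(2)] plB(1) bAA(2) tails] pos by (simp add: inner_commute less_imp_le)
  have limS: "(\<lambda>k. DS (R k) 0) \<longlonglongrightarrow> v"
    using lim(5)[OF memI(3)] same[OF lim(5)[OF memI(3)] pS bAA(1) refl iS] by simp
  have limT: "(\<lambda>k. DT (R k) 0) \<longlonglongrightarrow> v"
    using lim(5)[OF memI(4)] same[OF lim(5)[OF memI(4)] pT bAA(2) tails iT] by simp
  have cR: "bA (R k) 0 = c" "bB (R k) 0 = c'" "bA (R k) (Suc 0) = a" for k using c0 by (auto simp: R_def s_def)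
  have acc: "a \<in> A" "c \<in> A" "c' \<in> A" "c \<noteq> c'" "a \<noteq> c" "a \<noteq> c'"
  proof -
    show "a \<in> A" "c \<in> A" "c' \<in> A" using bAA cR by metis+
    show "c \<noteq> c'" using heads cR by metis
    show "a \<noteq> c" using flight_nontangent(2)[OF fzA[of "R 0"], of 0] bAA cR by auto
    have "bB (R 0) (Suc 0) = a" using tails[of 0 "R 0"] cR by simp
    thus "a \<noteq> c'" using flight_nontangent(2)[OF fzB[of "R 0"], of 0] bAA cR by auto
  qed
  have Rs: "Suc k \<le> Suc (R k)" for k using Rge by simp
  \<comment> \<open>The subsequence satisfies \<open>k \<le> R k\<close>, so its words may be cut to
    \<open>Suc k\<close> flights and its tolerances replaced by the larger ones of stage
    \<open>k\<close>.\<close>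
  have inv: "inverse (real (Suc (R k))) \<le> inverse (real (Suc k))" for k using Rge(1)[of k] by (simp add: le_imp_inverse_le)
  have UB': "\<exists>m k0. \<forall>k\<ge>k0. \<not> strip e (\<lambda>j. bA (R k) (Suc j)) m (W + \<epsilon>)" if "\<epsilon> > 0" for \<epsilon>
    using UB[OF that] GAB(1) Rge(1) by (meson order_trans)
  have "\<exists>k. lines_cross (zA (R k) (Suc 0)) (DA (R k) 0) (zB (R k) (Suc 0)) (DB (R k) 0)"
  proof (rule split_limit[where bA = "\<lambda>k. bA (R k)" and bB = "\<lambda>k. bB (R k)" and yA = "\<lambda>k. yA (R k)" and yB = "\<lambda>k. yB (R k)"
        and tA = "\<lambda>k. tA (R k)" and sA = "\<lambda>k. sA (R k)" and tB = "\<lambda>k. tB (R k)" and sB = "\<lambda>k. sB (R k)"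
        and pS = "\<lambda>k. pS (R k)" and qS = "\<lambda>k. qS (R k)" and DS = "\<lambda>k. DS (R k)"
        and pT = "\<lambda>k. pT (R k)" and qT = "\<lambda>k. qT (R k)" and DT = "\<lambda>k. DT (R k)" and u = "- v"
        and zA = "\<lambda>k. zA (R k)" and DA = "\<lambda>k. DA (R k)" and zB = "\<lambda>k. zB (R k)" and DB = "\<lambda>k. DB (R k)",
        OF acc(1,2,3,5,6,4) d bAA(1) cR(1,3,2) _ flight_path_mono[OF fzA Rs] flight_path_mono[OF fyA Rs] dA
        flight_path_mono[OF fzB Rs] flight_path_mono[OF fyB Rs] dB pos[OF Rge(2)]
        pseudo_line_mono[OF pS Rs] pseudo_line_mono[OF qS Rs] _ pseudo_line_mono[OF pT Rs] pseudo_line_mono[OF qT Rs] _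
        LIMSEQ_inverse_real_of_nat UB' _ _ _ _ lim(1-4)[OF memI(1)] lim(1-4)[OF memI(2)] lim(1-4)[OF memI(3)] lim(1-4)[OF memI(4)]])
    show "bB (R k) (Suc j) = bA (R k) (Suc j)" if "j \<le> k" for k j using tails[of j "R k"] that Rge(1)[of k] by simp
    show "wedge (qS (R k) (Suc 0) - pS (R k) (Suc 0)) (DS (R k) 0) \<le> - (W - inverse (real (Suc k)))" for k
      using wS[of "R k"] inv[of k] by linarith
    show "wedge (qT (R k) (Suc 0) - pT (R k) (Suc 0)) (DT (R k) 0) \<le> - (W - inverse (real (Suc k)))" for k
      using wT[of "R k"] inv[of k] by linarith
  qed (use limA limB limS limT in simp_all)
  thus False using nc by blast
qed

end

section \<open>Two orbits with the same coding\<close>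

lemma stripI:
  assumes "pseudo_line e b m z D" "pseudo_line e b m z' D" "w \<le> \<bar>wedge (z' 0 - z 0) (D 0)\<bar>"
  shows "strip e b m w"
  using assms unfolding strip_def by blast

text \<open>For unit vectors \<open>u - w\<close> is the bisector \<open>u + w\<close> turned by a
  right angle and multiplied by \<open>2 * wedge w u\<close> over the square of its norm. Here
  \<open>M\<close> is the wedge of \<open>q\<close> with \<open>u - w\<close>.\<close>

lemma crossing_identity:
  fixes q u w :: plane
  assumes "wedge q u = wedge q w + M" "norm u = 1" "norm w = 1"
  shows "M * ((u + w) \<bullet> (u + w)) = 2 * wedge w u * (q \<bullet> (u + w))"
proof -
  have n: "u $ 1 * u $ 1 + u $ 2 * u $ 2 = 1" "w $ 1 * w $ 1 + w $ 2 * w $ 2 = 1"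
    using assms(2,3) by (metis inner_plane norm_eq_1)+
  have M: "M = wedge q u - wedge q w" using assms(1) by simp
  show ?thesis using n unfolding M wedge_def inner_plane by (simp only: vector_add_component) algebra
qed

context edge_system begin

text \<open>A boundary point with equal offsets from both lines is at most \<open>size_bound\<close>
  away from \<open>x\<close>, and the identity for bisectors turns this into a bound on the offset.
  The acute angle makes \<open>u + w\<close> at least as long as a unit vector, so nothing is lost
  in dividing by its norm.\<close>

lemma lines_cross_bound:
  assumes lc: "lines_cross x u y w" and x: "x \<in> edge_seg e a" "a \<in> A"
    and u: "norm u = 1" "norm w = 1" "0 < u \<bullet> w"
  shows "wedge w u \<noteq> 0" "\<bar>wedge (x - y) w\<bar> \<le> 2 * size_bound * \<bar>wedge w u\<bar>"
proof -
  show "wedge w u \<noteq> 0" using lc by (simp add: lines_cross_def)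
  obtain z where z: "z \<in> boundary A e" "wedge (z - x) u = wedge (z - y) w"
    using lc by (auto simp: lines_cross_def)
  define M where "M = wedge (x - y) w"
  define n where "n = norm (u + w)"
  have "wedge (z - x) u = wedge (z - x) w + M" using z(2) by (simp add: M_def wedge_diff)
  from crossing_identity[OF this u(1,2)]
  have "M * n\<^sup>2 = 2 * wedge w u * ((z - x) \<bullet> (u + w))" by (simp add: n_def power2_norm_eq_inner)
  hence "\<bar>M\<bar> * n\<^sup>2 = 2 * \<bar>wedge w u\<bar> * \<bar>(z - x) \<bullet> (u + w)\<bar>"
    by (metis abs_mult abs_numeral abs_power2)
  moreover have "\<bar>(z - x) \<bullet> (u + w)\<bar> \<le> size_bound * n"
  proof -
    have "norm (z - x) \<le> size_bound" using z(1) x size_bound(2) by (auto simp: boundary_def)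
    hence "norm (z - x) * n \<le> size_bound * n" by (intro mult_right_mono) (auto simp: n_def)
    thus ?thesis using Cauchy_Schwarz_ineq2[of "z - x" "u + w"] by (simp add: n_def)
  qed
  ultimately have 1: "\<bar>M\<bar> * n\<^sup>2 \<le> 2 * \<bar>wedge w u\<bar> * (size_bound * n)"
    by (metis abs_ge_zero mult_left_mono mult_nonneg_nonneg zero_le_numeral)
  have "n\<^sup>2 = 2 + 2 * (u \<bullet> w)"
    using u by (simp add: n_def power2_norm_eq_inner inner_add_left inner_add_right inner_commute norm_eq_1)
  hence n2: "n\<^sup>2 \<ge> 1\<^sup>2" using u(3) by simp
  hence n1: "n \<ge> 1" using power2_le_imp_le[OF n2] by (simp add: n_def)
  have "\<bar>M\<bar> * n * n \<le> 2 * size_bound * \<bar>wedge w u\<bar> * n" using 1 by (simp add: power2_eq_square algebra_simps)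
  hence "\<bar>M\<bar> * n \<le> 2 * size_bound * \<bar>wedge w u\<bar>" using n1 by simp
  moreover have "\<bar>M\<bar> * 1 \<le> \<bar>M\<bar> * n" using n1 by (intro mult_left_mono) auto
  ultimately show "\<bar>wedge (x - y) w\<bar> \<le> 2 * size_bound * \<bar>wedge w u\<bar>" by (simp add: M_def)
qed

lemma lines_cross_other_side:
  assumes "lines_cross y1 u y2 w" "wedge (y1 - x1) u = wedge (y2 - x2) w"
  shows "lines_cross x1 u x2 w"
proof -
  obtain z where "wedge w u \<noteq> 0" "z \<in> boundary A e" "wedge (z - y1) u = wedge (z - y2) w"
    using assms(1) by (auto simp: lines_cross_def)
  moreover from this(3) have "wedge (z - x1) u = wedge (z - x2) w" using assms(2) by (simp add: wedge_diff)
  ultimately show ?thesis by (auto simp: lines_cross_def)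
qed

text \<open>The condition on \<open>l\<close> says that \<open>xA\<close> starts inside rod B and
  \<open>yB\<close> inside rod A. Over \<open>xA\<close> the edge \<open>b\<close> is met by
  interpolation in rod B, but only after \<open>c\<close>; over \<open>yB\<close> the edge
  \<open>c\<close> is met by interpolation in rod A, but only after \<open>b\<close>. The two edges
  have exchanged their order, so they would cross.\<close>

lemma interleaved_rods:
  assumes abc: "a \<in> A" "b \<in> A" "c \<in> A" "b \<noteq> c" and u: "norm u = 1"
    and A: "xA \<in> edge_interior e a" "yA \<in> edge_interior e a"
      "xA + tA *\<^sub>R u \<in> edge_interior e c" "yA + sA *\<^sub>R u \<in> edge_interior e c" "0 < tA" "0 < sA"
    and B: "xB \<in> edge_interior e a" "yB \<in> edge_interior e a"
      "xB + tB *\<^sub>R u \<in> edge_interior e b" "yB + sB *\<^sub>R u \<in> edge_interior e b" "0 < tB" "0 < sB"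
    and free: "\<And>r. 0 < r \<Longrightarrow> r < tA \<Longrightarrow> xA + r *\<^sub>R u \<notin> boundary A e"
      "\<And>r. 0 < r \<Longrightarrow> r < sB \<Longrightarrow> yB + r *\<^sub>R u \<notin> boundary A e"
    and w: "wedge (yA - xA) u = \<delta>" "wedge (yB - xB) u = \<delta>" "\<delta> \<noteq> 0"
    and l: "wedge (xA - xB) u = l * \<delta>" "0 \<le> l" "l < 1"
  shows False
proof -
  have seg: "xA \<in> edge_seg e a" "yA \<in> edge_seg e a" "xB \<in> edge_seg e a" "yB \<in> edge_seg e a"
    using A B interior_subset_seg by blast+
  have ta: "wedge (edge_dir e a) u \<noteq> 0" using seg_transversal[OF seg(1,2)] w by simp
  have "wedge (xA - (xB + l *\<^sub>R (yB - xB))) u = wedge (xA - xB) u - l * wedge (yB - xB) u"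
    by (simp add: wedge_diff wedge_add algebra_simps)
  hence xA: "xA = xB + l *\<^sub>R (yB - xB)"
    using same_offset_eq[OF seg(1) seg_affine_mem[OF seg(3,4)] _ ta] l w by simp
  have o: "wedge (yB - (xA + (1 - l) *\<^sub>R (yA - xA))) u = wedge (yB - xB) u - wedge (xA - xB) u - (1 - l) * wedge (yA - xA) u"
    by (simp add: wedge_diff wedge_add algebra_simps)
  have "wedge (yB - (xA + (1 - l) *\<^sub>R (yA - xA))) u = 0" unfolding o w l(1) by (simp add: algebra_simps)
  hence yB: "yB = xA + (1 - l) *\<^sub>R (yA - xA)"
    using same_offset_eq[OF seg(4) seg_affine_mem[OF seg(1,2)] _ ta] l by simp
  define f where "f = (1 - l) * tB + l * sB"
  define g where "g = l * tA + (1 - l) * sA"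
  have "0 < (1 - l) * tB" "0 \<le> l * sB" "0 \<le> l * tA" "0 < (1 - l) * sA" using A(5,6) B(5,6) l by simp_all
  hence f0: "0 < f" and g0: "0 < g" unfolding f_def g_def by linarith+
  have "xA + f *\<^sub>R u = (xB + tB *\<^sub>R u) + l *\<^sub>R ((yB + sB *\<^sub>R u) - (xB + tB *\<^sub>R u))"
    unfolding xA f_def by (simp add: algebra_simps)
  hence R: "xA + f *\<^sub>R u \<in> edge_interior e b"
    using subsetD[OF closed_seg_subset_interior[OF B(3,4)] segment_affine_mem] l by simp
  have "yB + g *\<^sub>R u = (xA + tA *\<^sub>R u) + (1 - l) *\<^sub>R ((yA + sA *\<^sub>R u) - (xA + tA *\<^sub>R u))"
    unfolding yB g_def by (simp add: algebra_simps)
  hence S: "yB + g *\<^sub>R u \<in> edge_interior e c"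
    using subsetD[OF closed_seg_subset_interior[OF A(3,4)] segment_affine_mem] l by simp
  \<comment> \<open>The free flight of \<open>xA\<close> ends on \<open>c\<close> at time
    \<open>tA\<close>, so the point on \<open>b\<close> at height \<open>f\<close> must come
    later.\<close>
  have f: "tA < f"
  proof (rule ccontr)
    assume "\<not> tA < f"
    hence "xA + f *\<^sub>R u \<notin> boundary A e \<or> f = tA" using free(1)[of f] f0 by force
    thus False using R A(3) interior_only_edge[OF abc(2,3)] interior_subset_seg abc(2,4) unfolding boundary_def by blast
  qed
  have g: "sB < g"
  proof (rule ccontr)
    assume "\<not> sB < g"
    hence "yB + g *\<^sub>R u \<notin> boundary A e \<or> g = sB" using free(2)[of g] g0 by force
    thus False using S B(4) interior_only_edge[OF abc(2,3)] interior_subset_seg abc(3,4) unfolding boundary_def by blast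
  qed
  have *: "xA + tA *\<^sub>R u - (xA + f *\<^sub>R u) = (tA - f) *\<^sub>R u"
    "yB + g *\<^sub>R u - (yB + sB *\<^sub>R u) = (g - sB) *\<^sub>R u" by (simp_all add: algebra_simps)
  have "0 < tA - f"
    using edges_do_not_cross[OF abc(2,3,4) closed_seg_subset_interior[OF R B(4)]
        subsetD[OF interior_subset_seg A(3)] subsetD[OF interior_subset_seg S] *] g by simp
  thus False using f by simp
qed

end

section \<open>The rod formed by two orbits, and its splittings\<close>

locale parallel_orbits = edge_system A e for A :: "'i set" and e +
  fixes \<alpha> :: "nat \<Rightarrow> 'i" and x y v :: "nat \<Rightarrow> plane" and tx ty :: "nat \<Rightarrow> real"
  assumes \<alpha>: "\<alpha> n \<in> A"
    and Tx: "trajectory A e \<alpha> x v tx" and Ty: "trajectory A e \<alpha> y v ty"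
    and apart: "wedge (y 0 - x 0) (v 0) \<noteq> 0"
begin

definition width :: real where "width = \<bar>wedge (y 0 - x 0) (v 0)\<bar>"

lemma width_pos: "0 < width"
  using apart by (simp add: width_def)

lemma offset_signed: "wedge (y n - x n) (v n) = (-1) ^ n * wedge (y 0 - x 0) (v 0)"
  using width_signed[OF flight_pathD(1)[OF trajectory_flight_path[OF Tx, of 0 n]]
      flight_pathD(1)[OF trajectory_flight_path[OF Ty, of 0 n]], of n] \<alpha> by simp

lemma offset_abs: "\<bar>wedge (y n - x n) (v n)\<bar> = width"
  unfolding offset_signed[of n] width_def by (simp add: abs_mult power_abs)

text \<open>The sign of the offset alternates along the coding, so neither orbit stays on a fixed
  side. A label chooses, for one position of the rod, which orbit counts as the side of
  \<open>x\<close>.\<close>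

definition is_label :: "(nat \<Rightarrow> plane) \<Rightarrow> (nat \<Rightarrow> plane) \<Rightarrow> bool" where
  "is_label p q \<longleftrightarrow> (p = x \<and> q = y) \<or> (p = y \<and> q = x)"

lemma is_label_trajectories:
  assumes "is_label p q"
  obtains t s where "trajectory A e \<alpha> p v t" "trajectory A e \<alpha> q v s"
proof (cases "p = x \<and> q = y")
  case True
  thus ?thesis using that[of tx ty] Tx Ty by simp
next
  case False
  hence "p = y" "q = x" using assms by (auto simp: is_label_def)
  thus ?thesis using that[of ty tx] Tx Ty by simp
qed

lemma is_label_offset:
  assumes "is_label p q"
  shows "\<bar>wedge (q n - p n) (v n)\<bar> = width"
proof (cases "p = x \<and> q = y")
  case True
  thus ?thesis using offset_abs[of n] by simp
next
  case False
  hence "p = y" "q = x" using assms unfolding is_label_def by blast+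
  hence "wedge (q n - p n) (v n) = - wedge (y n - x n) (v n)" by (simp only: wedge_diff)
  thus ?thesis using offset_abs[of n] by (simp only: abs_minus_cancel)
qed

text \<open>The supremum is taken over widths that every length admits at arbitrarily late
  positions. It exists because the rod itself is such a strip and because one letter already bounds
  the width by \<open>size_bound\<close>. The upper bound holds uniformly from some position on, the
  lower bound only recurrently.\<close>

lemma recurrent_width:
  obtains W where
    "\<And>\<epsilon>. \<epsilon> > 0 \<Longrightarrow> \<exists>N n0. \<forall>n\<ge>n0. \<not> strip e (\<lambda>j. \<alpha> (n + j)) N (W + \<epsilon>)"
    "\<And>\<epsilon> N n0. \<epsilon> > 0 \<Longrightarrow> \<exists>n\<ge>n0. strip e (\<lambda>j. \<alpha> (n + j)) N (W - \<epsilon>)"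
proof -
  define S where "S = {w. \<forall>N n0. \<exists>n\<ge>n0. strip e (\<lambda>j. \<alpha> (n + j)) N w}"
  have str: "strip e (\<lambda>j. \<alpha> (n + j)) N width" for n N
  proof -
    have "width \<le> \<bar>wedge (y (n + 0) - x (n + 0)) (v (n + 0))\<bar>" unfolding add_0_right offset_abs by (rule order_refl)
    from stripI[OF flight_pathD(1)[OF trajectory_flight_path[OF Tx, of n N]]
        flight_pathD(1)[OF trajectory_flight_path[OF Ty, of n N]] this]
    show ?thesis .
  qed
  have "\<exists>n\<ge>n0. strip e (\<lambda>j. \<alpha> (n + j)) N width" for N n0
    by (rule exI[of _ n0], rule conjI[OF order_refl str])
  hence ne: "width \<in> S" unfolding S_def mem_Collect_eq by (intro allI)
  have "w \<le> size_bound" if w: "w \<in> S" for w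
  proof -
    note w[unfolded S_def mem_Collect_eq]
    from spec[OF spec[OF this, of 0], of 0]
    obtain n where "strip e (\<lambda>j. \<alpha> (n + j)) 0 w" by (elim exE conjE)
    then obtain z z' D where 1: "pseudo_line e (\<lambda>j. \<alpha> (n + j)) 0 z D" "pseudo_line e (\<lambda>j. \<alpha> (n + j)) 0 z' D"
      "w \<le> \<bar>wedge (z' 0 - z 0) (D 0)\<bar>" unfolding strip_def by blast
    have "z 0 \<in> edge_seg e (\<alpha> (n + 0))" "z' 0 \<in> edge_seg e (\<alpha> (n + 0))" "norm (D 0) = 1"
      using 1(1,2) by (simp_all add: pseudo_line_def)
    hence "norm (z' 0 - z 0) \<le> size_bound" "norm (D 0) = 1" using size_bound(2)[OF \<alpha> \<alpha>] by blast+
    thus ?thesis using 1(3) abs_wedge_le[of "z' 0 - z 0" "D 0"] by simp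
  qed
  hence bdd: "bdd_above S" by (rule bdd_aboveI)
  show ?thesis
  proof (rule that[of "Sup S"])
    fix \<epsilon> :: real assume "\<epsilon> > 0"
    hence nS: "Sup S + \<epsilon> \<notin> S" using cSup_upper[OF _ bdd, of "Sup S + \<epsilon>"] by linarith
    show "\<exists>N n0. \<forall>n\<ge>n0. \<not> strip e (\<lambda>j. \<alpha> (n + j)) N (Sup S + \<epsilon>)"
      using nS[unfolded S_def mem_Collect_eq, folded S_def]
      by (simp only: not_all not_ex de_Morgan_conj imp_conv_disj simp_thms)
  next
    fix \<epsilon> :: real and N n0 :: nat assume "\<epsilon> > 0"
    hence "Sup S - \<epsilon> < Sup S" by simp
    moreover have "S \<noteq> {}" using ne by (metis empty_iff)
    ultimately obtain w where w: "w \<in> S" "Sup S - \<epsilon> < w" by (rule less_cSupE)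
    note w(1)[unfolded S_def mem_Collect_eq]
    from spec[OF spec[OF this, of N], of n0]
    obtain n where n: "n \<ge> n0" "strip e (\<lambda>j. \<alpha> (n + j)) N w" by (elim exE conjE)
    have "strip e (\<lambda>j. \<alpha> (n + j)) N (Sup S - \<epsilon>)" by (rule strip_antimono[OF n(2) less_imp_le[OF w(2)]])
    thus "\<exists>n\<ge>n0. strip e (\<lambda>j. \<alpha> (n + j)) N (Sup S - \<epsilon>)" using n(1) by (intro exI[of _ n] conjI)
  qed
qed

text \<open>The directions of the orbit run backwards from bounce \<open>n + Suc k\<close> to bounce
  \<open>n\<close>; in contrast to reversed pseudo-lines they carry the sign that makes all flight
  times positive.\<close>

definition reversed_direction :: "nat \<Rightarrow> nat \<Rightarrow> nat \<Rightarrow> plane" where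
  "reversed_direction k n = (\<lambda>j. - reflect (edge_dir e (\<alpha> (n + (Suc k - j)))) (v (n + (Suc k - j))))"

lemma reversed_direction_0: "reversed_direction k n 0 = - v (n + k)"
proof -
  have "v (Suc (n + k)) = reflect (edge_dir e (\<alpha> (Suc (n + k)))) (v (n + k))"
    by (rule trajectoryD(6)[OF \<alpha> Tx])
  thus ?thesis by (simp add: reversed_direction_def reflect_dir_reflect[OF \<alpha>])
qed

lemma reversed_trajectory:
  assumes T: "trajectory A e \<alpha> p v t"
  shows "flight_path A e (\<lambda>j. \<alpha> (n + (Suc k - j))) (Suc k) (\<lambda>j. p (n + (Suc k - j)))
    (reversed_direction k n) (\<lambda>j. t (n + (Suc k - Suc j)))"
  unfolding reversed_direction_def
  by (rule flight_path_reverse[OF trajectory_flight_path[OF T, of n "Suc k"] \<alpha>])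

lemma is_label_step:
  assumes "is_label p q"
  shows "wedge (q (Suc i) - p (Suc i)) (v i) = wedge (q i - p i) (v i)"
proof -
  obtain t s where T: "trajectory A e \<alpha> p v t" "trajectory A e \<alpha> q v s" using is_label_trajectories[OF assms] .
  show ?thesis
    unfolding trajectoryD(5)[OF \<alpha> T(1), of i] trajectoryD(5)[OF \<alpha> T(2), of i]
    by (simp add: wedge_diff wedge_add)
qed

text \<open>If the common offset has the other sign, the sides are exchanged in both rods at once.
  As the rods have the same signed offset, a crossing of the lines of one side is also a crossing of
  the lines of the other.\<close>

lemma lines_cross_labels:
  assumes main: "\<And>p q p' q'. is_label p q \<Longrightarrow> is_label p' q' \<Longrightarrow> wedge (q a - p a) u = - width \<Longrightarrow>
      wedge (q' b - p' b) w = - width \<Longrightarrow> lines_cross (p a) u (p' b) w"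
    and l: "is_label p q" "is_label p' q'"
    and eq: "wedge (q a - p a) u = wedge (q' b - p' b) w" "\<bar>wedge (q a - p a) u\<bar> = width"
  shows "lines_cross (p a) u (p' b) w"
proof (cases "wedge (q a - p a) u = - width")
  case True
  thus ?thesis using main[OF l] eq by simp
next
  case False
  have "wedge (p a - q a) u = - wedge (q a - p a) u" "wedge (p' b - q' b) w = - wedge (q' b - p' b) w"
    by (simp_all add: wedge_diff)
  hence "wedge (p a - q a) u = - width" "wedge (p' b - q' b) w = - width" using False eq by linarith+
  moreover have "is_label q p" "is_label q' p'" using l by (auto simp: is_label_def)
  ultimately have "lines_cross (q a) u (q' b) w" using main by blast
  thus ?thesis using lines_cross_other_side eq(1) by blast
qed

lemma forward_split:
  assumes UB: "\<And>\<epsilon>. \<epsilon> > 0 \<Longrightarrow> \<exists>N n0. \<forall>n\<ge>n0. \<not> strip e (\<lambda>j. \<alpha> (n + j)) N (W + \<epsilon>)"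
  shows "\<exists>k. \<forall>i j p q p' q'. k \<le> i \<longrightarrow> k \<le> j \<longrightarrow> is_label p q \<longrightarrow> is_label p' q' \<longrightarrow>
    wedge (q i - p i) (v i) = wedge (q' j - p' j) (v j) \<longrightarrow>
    strip e (\<lambda>l. \<alpha> (i + l)) (Suc k) (W - inverse (real (Suc k))) \<longrightarrow>
    strip e (\<lambda>l. \<alpha> (j + l)) (Suc k) (W - inverse (real (Suc k))) \<longrightarrow>
    \<alpha> i \<noteq> \<alpha> j \<longrightarrow> (\<forall>l\<le>k. \<alpha> (Suc i + l) = \<alpha> (Suc j + l)) \<longrightarrow>
    lines_cross (p (Suc i)) (v i) (p' (Suc j)) (v j)"
proof -
  define G where "G k b \<longleftrightarrow> (\<exists>n\<ge>k. b = (\<lambda>l. \<alpha> (n + l)))" for k b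
  have "\<exists>k. \<forall>bA bB zA yA DA tA sA zB yB DB tB sB. G k bA \<longrightarrow> G k bB \<longrightarrow>
    strip e bA (Suc k) (W - inverse (real (Suc k))) \<longrightarrow> strip e bB (Suc k) (W - inverse (real (Suc k))) \<longrightarrow>
    split_rods k width bA bB zA yA DA tA sA zB yB DB tB sB \<longrightarrow>
    lines_cross (zA (Suc 0)) (DA 0) (zB (Suc 0)) (DB 0)"
  proof (rule rods_cross_at_split[OF width_pos])
    show "b j \<in> A" if "G k b" for k b j using that \<alpha> by (auto simp: G_def)
    show "\<exists>m k0. \<forall>k b. k \<ge> k0 \<longrightarrow> G k b \<longrightarrow> \<not> strip e (\<lambda>j. b (Suc j)) m (W + \<epsilon>)" if pos: "\<epsilon> > 0" for \<epsilon>
    proof -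
      obtain N n0 where N: "\<And>n. n \<ge> n0 \<Longrightarrow> \<not> strip e (\<lambda>j. \<alpha> (n + j)) N (W + \<epsilon>)" using UB[OF pos] by blast
      have "\<not> strip e (\<lambda>j. b (Suc j)) N (W + \<epsilon>)" if h: "n0 \<le> k" "G k b" for k b
      proof -
        obtain n where "n \<ge> k" "b = (\<lambda>l. \<alpha> (n + l))" using h(2) by (auto simp: G_def)
        thus ?thesis using N[of "Suc n"] h(1) by simp
      qed
      thus ?thesis by blast
    qed
  qed
  then obtain k where k: "\<forall>bA bB zA yA DA tA sA zB yB DB tB sB. G k bA \<longrightarrow> G k bB \<longrightarrow>
    strip e bA (Suc k) (W - inverse (real (Suc k))) \<longrightarrow> strip e bB (Suc k) (W - inverse (real (Suc k))) \<longrightarrow>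
    split_rods k width bA bB zA yA DA tA sA zB yB DB tB sB \<longrightarrow>
    lines_cross (zA (Suc 0)) (DA 0) (zB (Suc 0)) (DB 0)" ..
  have "lines_cross (p (Suc i)) (v i) (p' (Suc j)) (v j)"
    if h: "k \<le> i" "k \<le> j" "is_label p q" "is_label p' q'"
      "wedge (q i - p i) (v i) = wedge (q' j - p' j) (v j)"
      "strip e (\<lambda>l. \<alpha> (i + l)) (Suc k) (W - inverse (real (Suc k)))"
      "strip e (\<lambda>l. \<alpha> (j + l)) (Suc k) (W - inverse (real (Suc k)))"
      "\<alpha> i \<noteq> \<alpha> j" "\<forall>l\<le>k. \<alpha> (Suc i + l) = \<alpha> (Suc j + l)" for i j p q p' q'
  proof (rule lines_cross_labels[OF _ h(3,4)])
    show "wedge (q (Suc i) - p (Suc i)) (v i) = wedge (q' (Suc j) - p' (Suc j)) (v j)"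
      "\<bar>wedge (q (Suc i) - p (Suc i)) (v i)\<bar> = width"
      using h(5) is_label_offset[OF h(3), of i] by (simp_all add: is_label_step[OF h(3)] is_label_step[OF h(4)])
    fix p q p' q'
    assume l: "is_label p q" "is_label p' q'" and w: "wedge (q (Suc i) - p (Suc i)) (v i) = - width"
      "wedge (q' (Suc j) - p' (Suc j)) (v j) = - width"
    obtain t s where T: "trajectory A e \<alpha> p v t" "trajectory A e \<alpha> q v s" using is_label_trajectories[OF l(1)] .
    obtain t' s' where T': "trajectory A e \<alpha> p' v t'" "trajectory A e \<alpha> q' v s'" using is_label_trajectories[OF l(2)] .
    have "split_rods k width (\<lambda>l. \<alpha> (i + l)) (\<lambda>l. \<alpha> (j + l)) (\<lambda>l. p (i + l)) (\<lambda>l. q (i + l)) (\<lambda>l. v (i + l))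
      (\<lambda>l. t (i + l)) (\<lambda>l. s (i + l)) (\<lambda>l. p' (j + l)) (\<lambda>l. q' (j + l)) (\<lambda>l. v (j + l)) (\<lambda>l. t' (j + l)) (\<lambda>l. s' (j + l))"
      unfolding split_rods_def
      using h(8,9) w trajectory_flight_path[OF T(1), of i "Suc k"] trajectory_flight_path[OF T(2), of i "Suc k"]
        trajectory_flight_path[OF T'(1), of j "Suc k"] trajectory_flight_path[OF T'(2), of j "Suc k"] by simp
    moreover have "G k (\<lambda>l. \<alpha> (i + l))" "G k (\<lambda>l. \<alpha> (j + l))" using h(1,2) by (auto simp: G_def)
    ultimately have "lines_cross (p (i + Suc 0)) (v (i + 0)) (p' (j + Suc 0)) (v (j + 0))"
      using h(6,7) k by blast
    thus "lines_cross (p (Suc i)) (v i) (p' (Suc j)) (v j)" by simp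
  qed
  thus ?thesis by blast
qed

text \<open>The same statement for the time-reversed rods: the differing letters now follow the
  common word.\<close>

lemma backward_split:
  assumes UB: "\<And>\<epsilon>. \<epsilon> > 0 \<Longrightarrow> \<exists>N n0. \<forall>n\<ge>n0. \<not> strip e (\<lambda>j. \<alpha> (n + j)) N (W + \<epsilon>)"
  shows "\<exists>k. \<forall>i j p q p' q'. k \<le> i \<longrightarrow> k \<le> j \<longrightarrow> is_label p q \<longrightarrow> is_label p' q' \<longrightarrow>
    wedge (q (i + k) - p (i + k)) (v (i + k)) = wedge (q' (j + k) - p' (j + k)) (v (j + k)) \<longrightarrow>
    strip e (\<lambda>l. \<alpha> (i + l)) (Suc k) (W - inverse (real (Suc k))) \<longrightarrow>
    strip e (\<lambda>l. \<alpha> (j + l)) (Suc k) (W - inverse (real (Suc k))) \<longrightarrow>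
    \<alpha> (i + Suc k) \<noteq> \<alpha> (j + Suc k) \<longrightarrow> (\<forall>l\<le>k. \<alpha> (i + l) = \<alpha> (j + l)) \<longrightarrow>
    lines_cross (p (i + k)) (v (i + k)) (p' (j + k)) (v (j + k))"
proof -
  define G where "G k b \<longleftrightarrow> (\<exists>n\<ge>k. b = (\<lambda>l. \<alpha> (n + (Suc k - l))))" for k b
  have "\<exists>k. \<forall>bA bB zA yA DA tA sA zB yB DB tB sB. G k bA \<longrightarrow> G k bB \<longrightarrow>
    strip e bA (Suc k) (W - inverse (real (Suc k))) \<longrightarrow> strip e bB (Suc k) (W - inverse (real (Suc k))) \<longrightarrow>
    split_rods k width bA bB zA yA DA tA sA zB yB DB tB sB \<longrightarrow>
    lines_cross (zA (Suc 0)) (DA 0) (zB (Suc 0)) (DB 0)"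
  proof (rule rods_cross_at_split[OF width_pos])
    show "b j \<in> A" if "G k b" for k b j using that \<alpha> by (auto simp: G_def)
    show "\<exists>m k0. \<forall>k b. k \<ge> k0 \<longrightarrow> G k b \<longrightarrow> \<not> strip e (\<lambda>j. b (Suc j)) m (W + \<epsilon>)" if pos: "\<epsilon> > 0" for \<epsilon>
    proof -
      obtain N n0 where N: "\<And>n. n \<ge> n0 \<Longrightarrow> \<not> strip e (\<lambda>j. \<alpha> (n + j)) N (W + \<epsilon>)" using UB[OF pos] by blast
      \<comment> \<open>The reversed word begins with the letters of \<alpha> at
        \<open>n + k\<close>, \<open>n + k - 1\<close>, and so on. Its first \<open>N\<close> steps
        reach back to \<open>n + k - N\<close>, which must still be at least
        \<open>n0\<close>.\<close>
      have "\<not> strip e (\<lambda>j. b (Suc j)) N (W + \<epsilon>)" if h: "n0 + N \<le> k" "G k b" for k b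
      proof
        assume s: "strip e (\<lambda>j. b (Suc j)) N (W + \<epsilon>)"
        obtain n where n: "n \<ge> k" "b = (\<lambda>l. \<alpha> (n + (Suc k - l)))" using h(2) by (auto simp: G_def)
        have "strip e (\<lambda>j. b (Suc (N - j))) N (W + \<epsilon>)" using strip_reverse[OF s] n(2) \<alpha> by simp
        hence s': "strip e (\<lambda>j. \<alpha> (n + k - N + j)) N (W + \<epsilon>)"
          by (rule strip_cong) (use h n in \<open>simp add: add.assoc\<close>)
        have "n0 \<le> n + k - N" using h(1) n(1) by simp
        from N[OF this] s' show False by (rule notE)
      qed
      thus ?thesis by blast
    qed
  qed
  then obtain k where k: "\<forall>bA bB zA yA DA tA sA zB yB DB tB sB. G k bA \<longrightarrow> G k bB \<longrightarrow>
    strip e bA (Suc k) (W - inverse (real (Suc k))) \<longrightarrow> strip e bB (Suc k) (W - inverse (real (Suc k))) \<longrightarrow>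
    split_rods k width bA bB zA yA DA tA sA zB yB DB tB sB \<longrightarrow>
    lines_cross (zA (Suc 0)) (DA 0) (zB (Suc 0)) (DB 0)" ..
  have "lines_cross (p (i + k)) (v (i + k)) (p' (j + k)) (v (j + k))"
    if h: "k \<le> i" "k \<le> j" "is_label p q" "is_label p' q'"
      "wedge (q (i + k) - p (i + k)) (v (i + k)) = wedge (q' (j + k) - p' (j + k)) (v (j + k))"
      "strip e (\<lambda>l. \<alpha> (i + l)) (Suc k) (W - inverse (real (Suc k)))"
      "strip e (\<lambda>l. \<alpha> (j + l)) (Suc k) (W - inverse (real (Suc k)))"
      "\<alpha> (i + Suc k) \<noteq> \<alpha> (j + Suc k)" "\<forall>l\<le>k. \<alpha> (i + l) = \<alpha> (j + l)" for i j p q p' q'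
  proof -
    have "lines_cross (p (i + k)) (- v (i + k)) (p' (j + k)) (- v (j + k))"
    proof (rule lines_cross_labels[OF _ h(3,4)])
      show "wedge (q (i + k) - p (i + k)) (- v (i + k)) = wedge (q' (j + k) - p' (j + k)) (- v (j + k))"
        "\<bar>wedge (q (i + k) - p (i + k)) (- v (i + k))\<bar> = width"
        using h(5) is_label_offset[OF h(3), of "i + k"] by simp_all
      fix p q p' q'
      assume l: "is_label p q" "is_label p' q'" and w: "wedge (q (i + k) - p (i + k)) (- v (i + k)) = - width"
        "wedge (q' (j + k) - p' (j + k)) (- v (j + k)) = - width"
      obtain t s where T: "trajectory A e \<alpha> p v t" "trajectory A e \<alpha> q v s" using is_label_trajectories[OF l(1)] .
      obtain t' s' where T': "trajectory A e \<alpha> p' v t'" "trajectory A e \<alpha> q' v s'" using is_label_trajectories[OF l(2)] .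
      define t1 s1 t2 s2 where "t1 = (\<lambda>l. t (i + (Suc k - Suc l)))" and "s1 = (\<lambda>l. s (i + (Suc k - Suc l)))"
        and "t2 = (\<lambda>l. t' (j + (Suc k - Suc l)))" and "s2 = (\<lambda>l. s' (j + (Suc k - Suc l)))"
      note f = reversed_trajectory[OF T(1), of i k, folded t1_def] reversed_trajectory[OF T(2), of i k, folded s1_def]
        reversed_trajectory[OF T'(1), of j k, folded t2_def] reversed_trajectory[OF T'(2), of j k, folded s2_def]
      have tl: "\<forall>l\<le>k. \<alpha> (j + k - l) = \<alpha> (i + k - l)"
      proof (intro allI impI)
        fix l assume "l \<le> k"
        thus "\<alpha> (j + k - l) = \<alpha> (i + k - l)" using h(9)[rule_format, of "k - l"] by simp
      qed
      have "split_rods k width (\<lambda>l. \<alpha> (i + (Suc k - l))) (\<lambda>l. \<alpha> (j + (Suc k - l))) (\<lambda>l. p (i + (Suc k - l)))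
        (\<lambda>l. q (i + (Suc k - l))) (reversed_direction k i) t1 s1 (\<lambda>l. p' (j + (Suc k - l))) (\<lambda>l. q' (j + (Suc k - l))) (reversed_direction k j) t2 s2"
        unfolding split_rods_def using h(8) tl w f by (simp add: reversed_direction_0)
      moreover have "G k (\<lambda>l. \<alpha> (i + (Suc k - l)))" "G k (\<lambda>l. \<alpha> (j + (Suc k - l)))" using h(1,2) by (auto simp: G_def)
      moreover have "strip e (\<lambda>l. \<alpha> (i + (Suc k - l))) (Suc k) (W - inverse (real (Suc k)))"
        "strip e (\<lambda>l. \<alpha> (j + (Suc k - l))) (Suc k) (W - inverse (real (Suc k)))"
        using strip_reverse[OF h(6)] strip_reverse[OF h(7)] \<alpha> by blast+
      ultimately have "lines_cross (p (i + (Suc k - Suc 0))) (reversed_direction k i 0) (p' (j + (Suc k - Suc 0))) (reversed_direction k j 0)"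
        using k by blast
      thus "lines_cross (p (i + k)) (- v (i + k)) (p' (j + k)) (- v (j + k))" by (simp add: reversed_direction_0)
    qed
    thus ?thesis unfolding lines_cross_uminus .
  qed
  thus ?thesis by blast
qed

end

section \<open>From bispecial words to periodic runs\<close>

lemma finite_word_repeats:
  fixes \<alpha> :: "nat \<Rightarrow> 'i"
  assumes "finite A" "\<And>n. \<alpha> n \<in> A"
  shows "\<exists>T. \<forall>c. \<exists>i j. c \<le> i \<and> i < j \<and> j \<le> c + T \<and> (\<forall>l<L. \<alpha> (i + l) = \<alpha> (j + l))"
proof -
  define F where "F = {xs. set xs \<subseteq> A \<and> length xs = L}"
  define f where "f i = map (\<lambda>l. \<alpha> (i + l)) [0..<L]" for i
  have fin: "finite F" unfolding F_def using assms(1) by (rule finite_lists_length_eq)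
  have main: "\<exists>i j. c \<le> i \<and> i < j \<and> j \<le> c + card F \<and> (\<forall>l<L. \<alpha> (i + l) = \<alpha> (j + l))" for c
  proof -
    have "f ` {c..c + card F} \<subseteq> F" using assms(2) by (auto simp: f_def F_def)
    hence "card (f ` {c..c + card F}) \<le> card F" by (rule card_mono[OF fin])
    hence "card (f ` {c..c + card F}) < card {c..c + card F}" by simp
    hence "\<not> inj_on f {c..c + card F}" by (rule pigeonhole)
    then obtain i j where ij: "i \<in> {c..c + card F}" "j \<in> {c..c + card F}" "i \<noteq> j" "f i = f j"
      by (auto simp: inj_on_def)
    have eq: "\<alpha> (i + l) = \<alpha> (j + l)" if "l < L" for l
      using arg_cong[OF ij(4), of "\<lambda>xs. xs ! l"] that by (simp add: f_def)
    show ?thesis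
    proof (cases "i < j")
      case True
      thus ?thesis using ij eq by (intro exI[of _ i] exI[of _ j]) simp
    next
      case False
      thus ?thesis using ij eq by (intro exI[of _ j] exI[of _ i]) simp
    qed
  qed
  show ?thesis by (rule exI[of _ "card F"], rule allI, rule main)
qed

lemma first_failure:
  fixes P :: "nat \<Rightarrow> bool"
  assumes "\<not> (\<forall>l\<le>n. P l)"
  obtains r where "r \<le> n" "\<not> P r" "\<And>l. l < r \<Longrightarrow> P l"
proof -
  obtain r0 where r0: "r0 \<le> n" "\<not> P r0" using assms by auto
  have "\<not> P (LEAST r. \<not> P r)" by (rule LeastI[of "\<lambda>r. \<not> P r", OF r0(2)])
  moreover have "(LEAST r. \<not> P r) \<le> n" using Least_le[of "\<lambda>r. \<not> P r", OF r0(2)] r0(1) by simp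
  moreover have "P l" if "l < (LEAST r. \<not> P r)" for l using not_less_Least[OF that] by simp
  ultimately show ?thesis using that by blast
qed

context parallel_orbits begin

lemma is_label_signed:
  assumes "is_label p q"
  shows "wedge (q (n + l) - p (n + l)) (v (n + l)) = (-1) ^ l * wedge (q n - p n) (v n)"
proof -
  obtain t s where T: "trajectory A e \<alpha> p v t" "trajectory A e \<alpha> q v s" using is_label_trajectories[OF assms] .
  show ?thesis
    using width_signed[OF flight_pathD(1)[OF trajectory_flight_path[OF T(1), of n l]]
      flight_pathD(1)[OF trajectory_flight_path[OF T(2), of n l]], of l] \<alpha> by simp
qed

text \<open>The growth rate depends on the width of the rod alone, hence is uniform in the starting
  position \<open>s\<close>.\<close>

lemma orbit_length:
  "\<exists>\<eta>>0. \<forall>s m. \<eta> * real m - size_bound \<le> (\<Sum>l<m. tx (s + l))"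
proof -
  obtain \<eta> where \<eta>: "\<eta> > 0" and len: "\<And>b m z z' D t t'. (\<forall>j\<le>m. b j \<in> A) \<Longrightarrow> flight_path A e b m z D t \<Longrightarrow>
    flight_path A e b m z' D t' \<Longrightarrow> width \<le> \<bar>wedge (z' 0 - z 0) (D 0)\<bar> \<Longrightarrow> \<eta> * m - size_bound \<le> sum t {..<m}"
    using flight_length[OF width_pos] by blast
  have "\<eta> * real m - size_bound \<le> (\<Sum>l<m. tx (s + l))" for s m
    by (rule len[OF _ trajectory_flight_path[OF Tx] trajectory_flight_path[OF Ty]]) (simp_all add: \<alpha> offset_abs)
  thus ?thesis using \<eta> by blast
qed

text \<open>The lines of two such positions of the rod would cross near both ends of the common word, while
  their offset changes by the angle times the length of the word.\<close>

lemma no_long_bispecial_word: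
  assumes UB: "\<And>\<epsilon>. \<epsilon> > 0 \<Longrightarrow> \<exists>N n0. \<forall>n\<ge>n0. \<not> strip e (\<lambda>j. \<alpha> (n + j)) N (W + \<epsilon>)"
  shows "\<exists>L n1 \<delta>. \<delta> > 0 \<and> (\<forall>i j M. n1 \<le> i \<longrightarrow> n1 \<le> j \<longrightarrow> L \<le> M \<longrightarrow>
    strip e (\<lambda>l. \<alpha> (i + l)) (Suc M) (W - \<delta>) \<longrightarrow> strip e (\<lambda>l. \<alpha> (j + l)) (Suc M) (W - \<delta>) \<longrightarrow>
    \<alpha> i \<noteq> \<alpha> j \<longrightarrow> (\<forall>l<M. \<alpha> (Suc i + l) = \<alpha> (Suc j + l)) \<longrightarrow> \<alpha> (i + Suc M) = \<alpha> (j + Suc M))"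
proof -
  obtain k where k: "\<forall>i j p q p' q'. k \<le> i \<longrightarrow> k \<le> j \<longrightarrow> is_label p q \<longrightarrow> is_label p' q' \<longrightarrow>
    wedge (q i - p i) (v i) = wedge (q' j - p' j) (v j) \<longrightarrow>
    strip e (\<lambda>l. \<alpha> (i + l)) (Suc k) (W - inverse (real (Suc k))) \<longrightarrow>
    strip e (\<lambda>l. \<alpha> (j + l)) (Suc k) (W - inverse (real (Suc k))) \<longrightarrow>
    \<alpha> i \<noteq> \<alpha> j \<longrightarrow> (\<forall>l\<le>k. \<alpha> (Suc i + l) = \<alpha> (Suc j + l)) \<longrightarrow>
    lines_cross (p (Suc i)) (v i) (p' (Suc j)) (v j)"
    using forward_split[OF UB] ..
  obtain k' where k': "\<forall>i j p q p' q'. k' \<le> i \<longrightarrow> k' \<le> j \<longrightarrow> is_label p q \<longrightarrow> is_label p' q' \<longrightarrow>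
    wedge (q (i + k') - p (i + k')) (v (i + k')) = wedge (q' (j + k') - p' (j + k')) (v (j + k')) \<longrightarrow>
    strip e (\<lambda>l. \<alpha> (i + l)) (Suc k') (W - inverse (real (Suc k'))) \<longrightarrow>
    strip e (\<lambda>l. \<alpha> (j + l)) (Suc k') (W - inverse (real (Suc k'))) \<longrightarrow>
    \<alpha> (i + Suc k') \<noteq> \<alpha> (j + Suc k') \<longrightarrow> (\<forall>l\<le>k'. \<alpha> (i + l) = \<alpha> (j + l)) \<longrightarrow>
    lines_cross (p (i + k')) (v (i + k')) (p' (j + k')) (v (j + k'))"
    using backward_split[OF UB] ..
  obtain \<eta> where \<eta>: "\<eta> > 0" and len: "\<And>s m. \<eta> * real m - size_bound \<le> (\<Sum>l<m. tx (s + l))"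
    using orbit_length by blast
  \<comment> \<open>Crossings near both ends allow a change of offset of at most four times
    \<open>size_bound\<close> per unit of the sine; a fifth one is lost in the length
    estimate.\<close>
  obtain K :: nat where K: "5 * size_bound < \<eta> * K" using \<eta> by (metis mult.commute reals_Archimedean3)
  define L where "L = Suc k + Suc k' + Suc K"
  define \<delta> where "\<delta> = min (inverse (real (Suc k))) (inverse (real (Suc k')))"
  have \<delta>: "\<delta> > 0" "W - inverse (real (Suc k)) \<le> W - \<delta>" "W - inverse (real (Suc k')) \<le> W - \<delta>" by (auto simp: \<delta>_def)
  have main: "\<alpha> (i + Suc M) = \<alpha> (j + Suc M)"
    if h: "k + k' \<le> i" "k + k' \<le> j" "L \<le> M" "strip e (\<lambda>l. \<alpha> (i + l)) (Suc M) (W - \<delta>)"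
      "strip e (\<lambda>l. \<alpha> (j + l)) (Suc M) (W - \<delta>)" "\<alpha> i \<noteq> \<alpha> j" "\<forall>l<M. \<alpha> (Suc i + l) = \<alpha> (Suc j + l)" for i j M
  proof (rule ccontr)
    assume ne: "\<alpha> (i + Suc M) \<noteq> \<alpha> (j + Suc M)"
    have M: "k \<le> M" "k' < M" "k < M" "K < M" using h(3) by (auto simp: L_def)
    have lx: "is_label x y" by (simp add: is_label_def)
    \<comment> \<open>The sides of the rod at \<open>j\<close> are named so that its signed offset
      agrees with that at \<open>i\<close>. Both then alternate together along the common
      word.\<close>
    obtain p q where l: "is_label p q" and eq0: "wedge (y i - x i) (v i) = wedge (q j - p j) (v j)"
    proof (cases "wedge (y i - x i) (v i) = wedge (y j - x j) (v j)")
      case True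
      show ?thesis by (rule that[OF lx True])
    next
      case False
      have "wedge (x j - y j) (v j) = - wedge (y j - x j) (v j)" by (simp add: wedge_diff)
      hence eq: "wedge (y i - x i) (v i) = wedge (x j - y j) (v j)" using False offset_abs[of i] offset_abs[of j] by linarith
      have lyx: "is_label y x" by (simp add: is_label_def)
      show ?thesis by (rule that[OF lyx eq])
    qed
    have eq: "wedge (y (i + r) - x (i + r)) (v (i + r)) = wedge (q (j + r) - p (j + r)) (v (j + r))" for r
      unfolding is_label_signed[OF lx, of i r] is_label_signed[OF l, of j r] eq0 ..
    obtain t s where T: "trajectory A e \<alpha> p v t" "trajectory A e \<alpha> q v s" using is_label_trajectories[OF l] .
    have st: "strip e (\<lambda>r. \<alpha> (n + a + r)) m w" if "strip e (\<lambda>r. \<alpha> (n + r)) (Suc M) (W - \<delta>)" "w \<le> W - \<delta>" "a + m \<le> Suc M" for n a m w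
      using strip_antimono[OF strip_shift[OF that(1) _ that(3)] that(2)] \<alpha> by (simp add: add.assoc)
    have st1: "strip e (\<lambda>r. \<alpha> (i + r)) (Suc k) (W - inverse (real (Suc k)))" "strip e (\<lambda>r. \<alpha> (j + r)) (Suc k) (W - inverse (real (Suc k)))"
      using st[OF h(4) \<delta>(2), of 0 "Suc k"] st[OF h(5) \<delta>(2), of 0 "Suc k"] M by simp_all
    have c1: "lines_cross (x (Suc i)) (v i) (p (Suc j)) (v j)"
    proof -
      have le: "k \<le> i" "k \<le> j" using h(1,2) by auto
      show ?thesis by (rule k[rule_format, OF le lx l eq0 st1 h(6)]) (use h(7) M in simp)
    qed
    \<comment> \<open>The windows for the splitting after the common word: their
      \<open>Suc k'\<close> letters from \<open>i'\<close> on are the last ones of that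
      word.\<close>
    define i' j' where "i' = i + (M - k')" and "j' = j + (M - k')"
    have ij': "i' + k' = i + M" "j' + k' = j + M" "i' + Suc k' = i + Suc M" "j' + Suc k' = j + Suc M" using M by (auto simp: i'_def j'_def)
    have c2: "lines_cross (x (i + M)) (v (i + M)) (p (j + M)) (v (j + M))"
    proof -
      have st2: "strip e (\<lambda>r. \<alpha> (i' + r)) (Suc k') (W - inverse (real (Suc k')))"
        "strip e (\<lambda>r. \<alpha> (j' + r)) (Suc k') (W - inverse (real (Suc k')))"
        unfolding i'_def j'_def using M by (intro st[OF h(4) \<delta>(3)] st[OF h(5) \<delta>(3)]; simp)+
      have com: "\<alpha> (i' + r) = \<alpha> (j' + r)" if "r \<le> k'" for r
      proof -
        have "M - k' - 1 + r < M" and "Suc i + (M - k' - 1 + r) = i' + r" "Suc j + (M - k' - 1 + r) = j' + r"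
          using that M by (auto simp: i'_def j'_def)
        thus ?thesis using h(7)[rule_format, of "M - k' - 1 + r"] by (simp only:)
      qed
      have le: "k' \<le> i'" "k' \<le> j'" using h(1,2) by (auto simp: i'_def j'_def)
      have "wedge (y (i' + k') - x (i' + k')) (v (i' + k')) = wedge (q (j' + k') - p (j' + k')) (v (j' + k'))"
        unfolding ij' by (rule eq)
      moreover have "\<alpha> (i' + Suc k') \<noteq> \<alpha> (j' + Suc k')" unfolding ij' by (rule ne)
      ultimately have "lines_cross (x (i' + k')) (v (i' + k')) (p (j' + k')) (v (j' + k'))"
        by (rule k'[rule_format, OF le lx l _ st2 _ com])
      thus ?thesis unfolding ij' .
    qed
    define m where "m = M - 1"
    have Mm: "M = Suc m" using M by (simp add: m_def)
    have plx: "pseudo_line e (\<lambda>r. \<alpha> (Suc i + r)) m (\<lambda>r. x (Suc i + r)) (\<lambda>r. v (Suc i + r))"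
      by (rule flight_pathD(1)[OF trajectory_flight_path[OF Tx]])
    have "pseudo_line e (\<lambda>r. \<alpha> (Suc j + r)) m (\<lambda>r. p (Suc j + r)) (\<lambda>r. v (Suc j + r))"
      by (rule flight_pathD(1)[OF trajectory_flight_path[OF T(1)]])
    hence plp: "pseudo_line e (\<lambda>r. \<alpha> (Suc i + r)) m (\<lambda>r. p (Suc j + r)) (\<lambda>r. v (Suc j + r))"
      by (rule pseudo_line_cong) (use h(7) in \<open>simp add: Mm\<close>)
    note tr = trajectoryD[OF \<alpha> Tx] and tr' = trajectoryD[OF \<alpha> T(1)]
    define S where "S = (\<Sum>l<m. tx (Suc i + l))"
    have "\<eta> * real K \<le> \<eta> * real m" using \<eta> M by (simp add: m_def)
    hence S: "4 * size_bound < S" using len[of m "Suc i"] K by (simp add: S_def)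
    have "v (Suc j + 0) \<bullet> v (Suc i + 0) > 0"
      using direction_inner_pos[OF plx plp, of "\<lambda>l. tx (Suc i + l)" "\<lambda>l. t (Suc j + l)"] \<alpha> tr(4,5) tr'(4,5) S size_bound(1)
      by (simp add: S_def)
    hence i1: "v (Suc j) \<bullet> v (Suc i) > 0" by simp
    have e1: "\<alpha> (Suc j) = \<alpha> (Suc i)" using h(7) Mm by (metis add_0_right zero_less_Suc)
    have rf: "v (Suc i) = reflect (edge_dir e (\<alpha> (Suc i))) (v i)" "v (Suc j) = reflect (edge_dir e (\<alpha> (Suc i))) (v j)"
      using tr(6)[of i] tr(6)[of j] e1 by simp_all
    have i0: "v i \<bullet> v j > 0" using i1 unfolding rf reflect_inner[OF dir_nonzero[OF \<alpha>]] by (simp add: inner_commute)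
    have ks: "\<bar>wedge (v (Suc j)) (v (Suc i))\<bar> = \<bar>wedge (v j) (v i)\<bar>"
      unfolding rf reflect_wedge[OF dir_nonzero[OF \<alpha>]] by simp
    have px: "x (Suc i) \<in> edge_seg e (\<alpha> (Suc i))" "p (Suc j) \<in> edge_seg e (\<alpha> (Suc i))" using tr(2) tr'(2)[of "Suc j"] e1 by simp_all
    obtain c where c: "x (Suc i) - p (Suc j) = c *\<^sub>R edge_dir e (\<alpha> (Suc i))" using seg_diff_parallel[OF px] by blast
    have "\<bar>wedge (x (Suc i) - p (Suc j)) (v (Suc j))\<bar> = \<bar>wedge (x (Suc i) - p (Suc j)) (v j)\<bar>"
      unfolding rf(2) wedge_reflect_parallel[OF dir_nonzero[OF \<alpha>] c] by simp
    moreover note lines_cross_bound[OF c1 px(1) \<alpha> tr(3) tr(3) i0]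
    ultimately have b0: "\<bar>wedge (x (Suc i) - p (Suc j)) (v (Suc j))\<bar> \<le> 2 * size_bound * \<bar>wedge (v (Suc j)) (v (Suc i))\<bar>"
      and k0: "wedge (v (Suc j)) (v (Suc i)) \<noteq> 0" using ks by auto
    have iM: "v (Suc j + m) \<bullet> v (Suc i + m) > 0" "\<bar>wedge (v (Suc j + m)) (v (Suc i + m))\<bar> = \<bar>wedge (v (Suc j)) (v (Suc i))\<bar>"
      using direction_invariants[OF plx plp _ order_refl] \<alpha> i1 by (simp_all add: abs_mult power_abs)
    have c2': "lines_cross (x (Suc i + m)) (v (Suc i + m)) (p (Suc j + m)) (v (Suc j + m))" using c2 by (simp add: Mm)
    have i2: "v (Suc i + m) \<bullet> v (Suc j + m) > 0" using iM(1) by (simp only: inner_commute)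
    have bM: "\<bar>wedge (x (Suc i + m) - p (Suc j + m)) (v (Suc j + m))\<bar> \<le> 2 * size_bound * \<bar>wedge (v (Suc j)) (v (Suc i))\<bar>"
      using lines_cross_bound(2)[OF c2' tr(2) \<alpha> tr(3) tr(3) i2] iM(2) by simp
    have "wedge (x (Suc i + m) - p (Suc j + m)) (v (Suc j + m)) = (-1) ^ m *
      (wedge (x (Suc i) - p (Suc j)) (v (Suc j)) - wedge (v (Suc j)) (v (Suc i)) * S)"
      using crossing_drift[OF plx plp, of "\<lambda>l. tx (Suc i + l)" m] \<alpha> tr(5) by (simp add: S_def)
    hence "\<bar>wedge (x (Suc i + m) - p (Suc j + m)) (v (Suc j + m))\<bar> =
      \<bar>wedge (x (Suc i) - p (Suc j)) (v (Suc j)) - wedge (v (Suc j)) (v (Suc i)) * S\<bar>"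
      by (simp add: abs_mult power_abs)
    \<comment> \<open>The drift over the common word is the difference of two offsets, each bounded
      by the crossing at its end. Since the sine is nonzero it can be cancelled, leaving a length
      \<open>S\<close> of at most \<open>4 * size_bound\<close>.\<close>
    hence "\<bar>wedge (v (Suc j)) (v (Suc i)) * S\<bar> \<le> 4 * size_bound * \<bar>wedge (v (Suc j)) (v (Suc i))\<bar>"
      using b0 bM by linarith
    hence "\<bar>wedge (v (Suc j)) (v (Suc i))\<bar> * S \<le> \<bar>wedge (v (Suc j)) (v (Suc i))\<bar> * (4 * size_bound)"
      using S size_bound(1) by (simp add: abs_mult mult.commute)
    thus False using k0 S by simp
  qed
  show ?thesis
    by (rule exI[of _ L], rule exI[of _ "k + k'"], rule exI[of _ \<delta>], rule conjI[OF \<delta>(1)],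
      intro allI impI, rule main; assumption)
qed

text \<open>Two nearby occurrences of one word are extended as far as they agree, in both
  directions. If both extensions stopped within \<open>n\<close> letters, the result would be a
  forbidden bispecial word, so one of them goes on for \<open>n\<close> letters and is a run whose
  period is the distance of the occurrences.\<close>

lemma long_periodic_runs:
  "\<exists>T0. \<forall>n. \<exists>s T. 1 \<le> T \<and> T \<le> T0 \<and> (\<forall>l\<le>n. \<alpha> (s + T + l) = \<alpha> (s + l))"
proof (rule recurrent_width)
  fix W
  assume UB: "\<And>\<epsilon>. \<epsilon> > 0 \<Longrightarrow> \<exists>N n0. \<forall>n\<ge>n0. \<not> strip e (\<lambda>j. \<alpha> (n + j)) N (W + \<epsilon>)"
    and LB: "\<And>\<epsilon> N n0. \<epsilon> > 0 \<Longrightarrow> \<exists>n\<ge>n0. strip e (\<lambda>j. \<alpha> (n + j)) N (W - \<epsilon>)"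
  have "\<exists>L n1 \<delta>. \<delta> > 0 \<and> (\<forall>i j M. n1 \<le> i \<longrightarrow> n1 \<le> j \<longrightarrow> L \<le> M \<longrightarrow>
    strip e (\<lambda>l. \<alpha> (i + l)) (Suc M) (W - \<delta>) \<longrightarrow> strip e (\<lambda>l. \<alpha> (j + l)) (Suc M) (W - \<delta>) \<longrightarrow>
    \<alpha> i \<noteq> \<alpha> j \<longrightarrow> (\<forall>l<M. \<alpha> (Suc i + l) = \<alpha> (Suc j + l)) \<longrightarrow> \<alpha> (i + Suc M) = \<alpha> (j + Suc M))"
    by (rule no_long_bispecial_word) (rule UB)
  then obtain L n1 \<delta> where \<delta>: "\<delta> > 0" and bi: "\<forall>i j M. n1 \<le> i \<longrightarrow> n1 \<le> j \<longrightarrow> L \<le> M \<longrightarrow>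
    strip e (\<lambda>l. \<alpha> (i + l)) (Suc M) (W - \<delta>) \<longrightarrow> strip e (\<lambda>l. \<alpha> (j + l)) (Suc M) (W - \<delta>) \<longrightarrow>
    \<alpha> i \<noteq> \<alpha> j \<longrightarrow> (\<forall>l<M. \<alpha> (Suc i + l) = \<alpha> (Suc j + l)) \<longrightarrow> \<alpha> (i + Suc M) = \<alpha> (j + Suc M)"
    by (elim exE conjE)
  obtain T0 where T0: "\<forall>c. \<exists>i j. c \<le> i \<and> i < j \<and> j \<le> c + T0 \<and> (\<forall>l<Suc L. \<alpha> (i + l) = \<alpha> (j + l))"
    using finite_word_repeats[where \<alpha> = \<alpha> and L = "Suc L", OF finite_A \<alpha>] by (elim exE)
  have main: "\<exists>s T. 1 \<le> T \<and> T \<le> T0 \<and> (\<forall>l\<le>n. \<alpha> (s + T + l) = \<alpha> (s + l))" for n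
  proof -
    \<comment> \<open>The wide strip leaves \<open>n\<close> letters on either side of all
      \<open>T0 + 1\<close> candidate positions, so it covers every maximal extension that has to be
      excluded.\<close>
    obtain n2 where n2: "n2 \<ge> n1" "strip e (\<lambda>j. \<alpha> (n2 + j)) (n + T0 + n) (W - \<delta>)"
      using LB[OF \<delta>, of n1 "n + T0 + n"] by (elim exE conjE)
    obtain i j where ij: "n2 + n \<le> i" "i < j" "j \<le> n2 + n + T0" "\<forall>l<Suc L. \<alpha> (i + l) = \<alpha> (j + l)"
      using spec[OF T0, of "n2 + n"] by (elim exE conjE)
    have T: "1 \<le> j - i" "j - i \<le> T0" using ij by auto
    have "(\<forall>l\<le>n. \<alpha> (i + l) = \<alpha> (j + l)) \<or> (\<forall>l\<le>n. \<alpha> (i - l) = \<alpha> (j - l))"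
    proof (rule ccontr)
      assume asm: "\<not> ?thesis"
      hence nr: "\<not> (\<forall>l\<le>n. \<alpha> (i + l) = \<alpha> (j + l))" and nl: "\<not> (\<forall>l\<le>n. \<alpha> (i - l) = \<alpha> (j - l))" by simp_all
      obtain r where r: "r \<le> n" "\<alpha> (i + r) \<noteq> \<alpha> (j + r)" "\<And>l. l < r \<Longrightarrow> \<alpha> (i + l) = \<alpha> (j + l)"
        by (rule first_failure[OF nr]) blast
      obtain l where l: "l \<le> n" "\<alpha> (i - l) \<noteq> \<alpha> (j - l)" "\<And>k. k < l \<Longrightarrow> \<alpha> (i - k) = \<alpha> (j - k)"
        by (rule first_failure[OF nl]) blast
      \<comment> \<open>The repeated word has \<open>Suc L\<close> letters, so the common part is
        long enough for the exclusion of bispecial words to apply.\<close>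
      have rL: "Suc L \<le> r" using r(2) ij(4) not_less by blast
      have l1: "1 \<le> l" using l(2) ij(4)[rule_format, of 0] by (cases l) auto
      define M where "M = l + r - 1"
      have M: "Suc M = l + r" using l1 by (simp add: M_def)
      have sub: "strip e (\<lambda>q. \<alpha> (a - l + q)) (Suc M) (W - \<delta>)" if a: "n2 + n \<le> a" "a \<le> n2 + n + T0" for a
      proof -
        have st: "strip e (\<lambda>q. \<alpha> (n2 + (a - l - n2 + q))) (Suc M) (W - \<delta>)"
          by (rule strip_shift[OF n2(2)]) (use a l(1) r(1) \<alpha> in \<open>auto simp: M\<close>)
        have "n2 + (a - l - n2 + q) = a - l + q" for q using a l(1) by simp
        with st show ?thesis by (simp only:)
      qed
      have "\<alpha> (Suc (i - l) + q) = \<alpha> (Suc (j - l) + q)" if "q < M" for q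
      proof (cases "Suc q \<le> l")
        case True
        have e: "Suc (i - l) + q = i - (l - Suc q)" "Suc (j - l) + q = j - (l - Suc q)" using True l(1) ij by auto
        show ?thesis unfolding e by (rule l(3)) (use l1 in simp)
      next
        case False
        have e: "Suc (i - l) + q = i + (Suc q - l)" "Suc (j - l) + q = j + (Suc q - l)" using False l(1) ij by auto
        show ?thesis unfolding e by (rule r(3)) (use that False M in simp)
      qed
      hence com: "\<forall>q<M. \<alpha> (Suc (i - l) + q) = \<alpha> (Suc (j - l) + q)" by (intro allI impI)
      have le: "n1 \<le> i - l" "n1 \<le> j - l" "L \<le> M" using ij l(1) n2(1) rL l1 M by auto
      have si: "strip e (\<lambda>q. \<alpha> (i - l + q)) (Suc M) (W - \<delta>)" by (rule sub) (use ij in auto)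
      have sj: "strip e (\<lambda>q. \<alpha> (j - l + q)) (Suc M) (W - \<delta>)" by (rule sub) (use ij in auto)
      have "\<alpha> (i - l + Suc M) = \<alpha> (j - l + Suc M)"
        by (rule bi[rule_format, OF le si sj l(2) com[rule_format]])
      moreover have "i - l + Suc M = i + r" "j - l + Suc M = j + r" using M l(1) ij by auto
      ultimately show False using r(2) by simp
    qed
    thus ?thesis
    proof
      assume "\<forall>l\<le>n. \<alpha> (i + l) = \<alpha> (j + l)"
      hence "\<forall>l\<le>n. \<alpha> (i + (j - i) + l) = \<alpha> (i + l)" using ij(2) by simp
      thus ?thesis using T by (intro exI[of _ i] exI[of _ "j - i"] conjI)
    next
      \<comment> \<open>Agreement to the left of \<open>i\<close> and \<open>j\<close> is a run as
        well, starting \<open>n\<close> letters earlier.\<close>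
      assume a: "\<forall>l\<le>n. \<alpha> (i - l) = \<alpha> (j - l)"
      have "\<alpha> (i - n + (j - i) + l) = \<alpha> (i - n + l)" if "l \<le> n" for l
      proof -
        have e: "i - n + (j - i) + l = j - (n - l)" "i - n + l = i - (n - l)" using that ij by auto
        show ?thesis unfolding e by (rule a[rule_format, symmetric]) simp
      qed
      thus ?thesis using T by (intro exI[of _ "i - n"] exI[of _ "j - i"] conjI allI impI)
    qed
  qed
  show ?thesis by (rule exI[of _ T0], rule allI, rule main)
qed

end

section \<open>Periodicity\<close>

text \<open>Twice the first coordinate of the vector (g, h) after reflection in the directions (a,
  b) and (c, d), where \<open>p\<close> and \<open>q\<close> stand for 2 over the squared norms.
  Exchanging the coordinates gives the second one.\<close>

lemma double_reflection_component:
  fixes a b c d g h p q :: real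
  assumes p: "p * (a * a + b * b) = 2" and q: "q * (c * c + d * d) = 2"
  shows "2 * (q * ((p * (g * a + h * b) * a - g) * c + (p * (g * a + h * b) * b - h) * d) * c - (p * (g * a + h * b) * a - g)) =
    (p * q * (a * c + b * d) * (a * c + b * d) - 2) * g - p * q * (a * c + b * d) * (a * d - b * c) * h" (is "?L = ?R")
proof -
  define N M where "N = a * a + b * b" and "M = c * c + d * d"
  have N: "p * N = 2" and M: "q * M = 2" using p q by (simp_all add: N_def M_def)
  have "?L = 2 * p * q * (g * a + h * b) * (a * c + b * d) * c - 2 * q * (g * c + h * d) * c - 2 * p * (g * a + h * b) * a + (2 * 2 - 2) * g"
    by (simp add: algebra_simps)
  also have "\<dots> = 2 * p * q * (g * a + h * b) * (a * c + b * d) * c - (p * N) * q * (g * c + h * d) * c -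
      (q * M) * p * (g * a + h * b) * a + ((p * N) * (q * M) - 2) * g"
    unfolding N M ..
  also have "\<dots> = ?R" unfolding N_def M_def by (simp add: algebra_simps)
  finally show ?thesis .
qed

text \<open>Two reflections compose to the rotation by twice the angle from \<open>d1\<close> to
  \<open>d2\<close>; \<open>a\<close> and \<open>b\<close> are its cosine and sine, and the formulas
  are the addition theorems.\<close>

lemma double_reflection:
  fixes d1 d2 :: plane
  assumes "d1 \<noteq> 0" "d2 \<noteq> 0"
  shows "\<exists>a b. \<forall>u w. u \<bullet> reflect d2 (reflect d1 w) = a * (u \<bullet> w) - b * wedge u w \<and>
    wedge u (reflect d2 (reflect d1 w)) = a * wedge u w + b * (u \<bullet> w)"
proof -
  define p q where "p = 2 / (d1 \<bullet> d1)" and "q = 2 / (d2 \<bullet> d2)"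
  have p: "p * (d1 $ 1 * d1 $ 1 + d1 $ 2 * d1 $ 2) = 2" and q: "q * (d2 $ 1 * d2 $ 1 + d2 $ 2 * d2 $ 2) = 2"
    using assms unfolding p_def q_def inner_plane[symmetric] by simp_all
  have r: "reflect d1 w = (p * (w \<bullet> d1)) *\<^sub>R d1 - w" "reflect d2 w = (q * (w \<bullet> d2)) *\<^sub>R d2 - w" for w
    by (simp_all add: reflect_def p_def q_def)
  define D where "D = d1 $ 1 * d2 $ 1 + d1 $ 2 * d2 $ 2"
  define E where "E = d1 $ 1 * d2 $ 2 - d1 $ 2 * d2 $ 1"
  have main: "\<forall>u w. u \<bullet> reflect d2 (reflect d1 w) = (p * q * D * D / 2 - 1) * (u \<bullet> w) - (p * q * D * E / 2) * wedge u w \<and>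
    wedge u (reflect d2 (reflect d1 w)) = (p * q * D * D / 2 - 1) * wedge u w + (p * q * D * E / 2) * (u \<bullet> w)"
  proof (intro allI)
    fix u w :: plane
    define z where "z = reflect d2 (reflect d1 w)"
    have z1: "2 * z $ 1 = (p * q * D * D - 2) * w $ 1 - p * q * D * E * w $ 2"
      using double_reflection_component[OF p q, of "w $ 1" "w $ 2"]
      unfolding z_def r inner_plane D_def E_def vector_minus_component vector_scaleR_component real_scaleR_def .
    have z2: "2 * z $ 2 = (p * q * D * D - 2) * w $ 2 + p * q * D * E * w $ 1"
      using double_reflection_component[of p "d1 $ 2" "d1 $ 1" q "d2 $ 2" "d2 $ 1" "w $ 2" "w $ 1"] p q
      unfolding z_def r inner_plane D_def E_def vector_minus_component vector_scaleR_component real_scaleR_def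
      by (simp add: algebra_simps)
    have z: "z $ 1 = (p * q * D * D / 2 - 1) * w $ 1 - (p * q * D * E / 2) * w $ 2"
      "z $ 2 = (p * q * D * D / 2 - 1) * w $ 2 + (p * q * D * E / 2) * w $ 1"
      using z1 z2 by (simp_all add: field_simps)
    show "u \<bullet> reflect d2 (reflect d1 w) = (p * q * D * D / 2 - 1) * (u \<bullet> w) - (p * q * D * E / 2) * wedge u w \<and>
      wedge u (reflect d2 (reflect d1 w)) = (p * q * D * D / 2 - 1) * wedge u w + (p * q * D * E / 2) * (u \<bullet> w)"
      unfolding z_def[symmetric] wedge_def inner_plane z by (simp add: algebra_simps)
  qed
  show ?thesis by (rule exI, rule exI, rule main)
qed

context parallel_orbits begin

text \<open>The pair is the cosine and sine of the turn made in \<open>2 * m\<close> bounces. Each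
  further pair of bounces composes it with one of the finitely many rotations indexed by
  \<open>A \<times> A\<close>, so the turn depends on the letters passed and not on
  \<open>v s\<close>.\<close>

lemma finite_turns: "finite (range (\<lambda>s. (v s \<bullet> v (s + 2 * m), wedge (v s) (v (s + 2 * m)))))"
proof (induction m)
  case 0
  have "range (\<lambda>s. (v s \<bullet> v (s + 2 * 0), wedge (v s) (v (s + 2 * 0)))) \<subseteq> {(1, 0)}"
    using trajectoryD(3)[OF \<alpha> Tx] by (auto simp: norm_eq_1)
  thus ?case by (rule finite_subset) simp
next
  case (Suc m)
  have "\<exists>c d. \<forall>u w. u \<bullet> reflect (edge_dir e j) (reflect (edge_dir e i) w) = c * (u \<bullet> w) - d * wedge u w \<and>
      wedge u (reflect (edge_dir e j) (reflect (edge_dir e i) w)) = c * wedge u w + d * (u \<bullet> w)"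
    if "i \<in> A" "j \<in> A" for i j
    by (rule double_reflection) (use that dir_nonzero in blast)+
  then obtain c d where cd: "\<And>i j u w. i \<in> A \<Longrightarrow> j \<in> A \<Longrightarrow>
      u \<bullet> reflect (edge_dir e j) (reflect (edge_dir e i) w) = c i j * (u \<bullet> w) - d i j * wedge u w \<and>
      wedge u (reflect (edge_dir e j) (reflect (edge_dir e i) w)) = c i j * wedge u w + d i j * (u \<bullet> w)"
    by metis
  define C where "C = range (\<lambda>s. (v s \<bullet> v (s + 2 * m), wedge (v s) (v (s + 2 * m))))"
  define g where "g = (\<lambda>((i, j), (a, b)). (c i j * a - d i j * b, c i j * b + d i j * a))"
  have "(v s \<bullet> v (s + 2 * Suc m), wedge (v s) (v (s + 2 * Suc m))) \<in> g ` ((A \<times> A) \<times> C)" for s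
  proof (rule image_eqI)
    show "((\<alpha> (Suc (s + 2 * m)), \<alpha> (Suc (Suc (s + 2 * m)))), (v s \<bullet> v (s + 2 * m), wedge (v s) (v (s + 2 * m)))) \<in> (A \<times> A) \<times> C"
      using \<alpha> by (auto simp: C_def)
    have "v (s + 2 * Suc m) = reflect (edge_dir e (\<alpha> (Suc (Suc (s + 2 * m))))) (reflect (edge_dir e (\<alpha> (Suc (s + 2 * m)))) (v (s + 2 * m)))"
      using trajectoryD(6)[OF \<alpha> Tx, of "s + 2 * m"] trajectoryD(6)[OF \<alpha> Tx, of "Suc (s + 2 * m)"] by simp
    thus "(v s \<bullet> v (s + 2 * Suc m), wedge (v s) (v (s + 2 * Suc m))) =
      g ((\<alpha> (Suc (s + 2 * m)), \<alpha> (Suc (Suc (s + 2 * m)))), (v s \<bullet> v (s + 2 * m), wedge (v s) (v (s + 2 * m))))"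
      using cd[OF \<alpha> \<alpha>] by (simp add: g_def)
  qed
  moreover have "finite (g ` ((A \<times> A) \<times> C))" using finite_A Suc by (simp add: C_def)
  ultimately show ?case by (blast intro: finite_subset)
qed

lemma turns_isolated:
  "\<exists>\<kappa>>0. \<forall>s. \<forall>m\<le>T0. wedge (v s) (v (s + 2 * m)) = 0 \<or> \<kappa> \<le> \<bar>wedge (v s) (v (s + 2 * m))\<bar>"
proof -
  define F where "F = (\<Union>m\<in>{..T0}. snd ` range (\<lambda>s. (v s \<bullet> v (s + 2 * m), wedge (v s) (v (s + 2 * m)))))"
  define \<kappa> where "\<kappa> = Min (insert 1 (abs ` (F - {0})))"
  have fin: "finite F" using finite_turns by (simp add: F_def)
  have "\<kappa> > 0" using fin by (auto simp: \<kappa>_def)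
  moreover have "wedge (v s) (v (s + 2 * m)) = 0 \<or> \<kappa> \<le> \<bar>wedge (v s) (v (s + 2 * m))\<bar>" if "m \<le> T0" for s m
  proof (cases "wedge (v s) (v (s + 2 * m)) = 0")
    case False
    have "wedge (v s) (v (s + 2 * m)) \<in> F" unfolding F_def using that by (auto simp: image_image)
    hence "\<kappa> \<le> \<bar>wedge (v s) (v (s + 2 * m))\<bar>" unfolding \<kappa>_def using fin False by (intro Min_le) auto
    thus ?thesis ..
  qed simp
  ultimately show ?thesis by blast
qed

lemma run_pseudo_line:
  assumes "\<forall>l\<le>n. \<alpha> (s + P + l) = \<alpha> (s + l)"
  shows "pseudo_line e (\<lambda>l. \<alpha> (s + l)) n (\<lambda>l. x (s + P + l)) (\<lambda>l. v (s + P + l))"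
  by (rule pseudo_line_cong[OF flight_pathD(1)[OF trajectory_flight_path[OF Tx]]]) (use assms in simp)

text \<open>The two copies of the run are lines over one word, so the sine of their angle is at most
  \<open>2 * size_bound\<close> divided by the length. A long run pushes it below the gap \<kappa>,
  hence to zero, and the positive inner product excludes a half turn.\<close>

lemma run_direction:
  assumes run: "\<forall>l\<le>n. \<alpha> (s + P + l) = \<alpha> (s + l)"
    and turn: "wedge (v s) (v (s + P)) = 0 \<or> \<kappa> \<le> \<bar>wedge (v s) (v (s + P))\<bar>"
    and long: "2 * size_bound < (\<Sum>l<n. tx (s + l))" "2 * size_bound < \<kappa> * (\<Sum>l<n. tx (s + l))"
  shows "v (s + P) = v s"
proof -
  have pl: "pseudo_line e (\<lambda>l. \<alpha> (s + l)) n (\<lambda>l. x (s + l)) (\<lambda>l. v (s + l))"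
    by (rule flight_pathD(1)[OF trajectory_flight_path[OF Tx]])
  note pl' = run_pseudo_line[OF run] and tr = trajectoryD[OF \<alpha> Tx]
  have "\<bar>wedge (v (s + P + 0)) (v (s + 0))\<bar> * (\<Sum>l<n. tx (s + l)) \<le> 2 * size_bound"
    by (rule angle_bound[OF pl pl']) (use \<alpha> tr(4,5) in simp_all)
  hence "\<bar>wedge (v s) (v (s + P))\<bar> * (\<Sum>l<n. tx (s + l)) < \<kappa> * (\<Sum>l<n. tx (s + l))"
    using long(2) wedge_swap[of "v s" "v (s + P)"] by simp
  hence "\<bar>wedge (v s) (v (s + P))\<bar> < \<kappa>" using long(1) size_bound(1) by (simp add: mult_less_cancel_right)
  hence "wedge (v (s + P)) (v s) = 0" using turn wedge_swap[of "v s" "v (s + P)"] by linarith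
  moreover have "v (s + P + 0) \<bullet> v (s + 0) > 0"
    by (rule direction_inner_pos[OF pl pl', of "\<lambda>l. tx (s + l)" "\<lambda>l. tx (s + P + l)"]) (use \<alpha> tr(4,5) long(1) in simp_all)
  ultimately show ?thesis using unit_parallel_eq[of "v (s + P)" "v s"] tr(3) by simp
qed

lemma run_same_directions:
  assumes "\<forall>l\<le>n. \<alpha> (s + P + l) = \<alpha> (s + l)" "v (s + P) = v s" "l \<le> n"
  shows "v (s + P + l) = v (s + l)"
  using assms(3)
proof (induction l)
  case 0
  show ?case using assms(2) by simp
next
  case (Suc l)
  have "\<alpha> (Suc (s + P + l)) = \<alpha> (Suc (s + l))" using assms(1)[rule_format, of "Suc l"] Suc.prems by simp
  thus ?case using Suc trajectoryD(6)[OF \<alpha> Tx, of "s + P + l"] trajectoryD(6)[OF \<alpha> Tx, of "s + l"] by simp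
qed

lemma run_offset:
  assumes "\<forall>l\<le>n. \<alpha> (s + P + l) = \<alpha> (s + l)" "v (s + P) = v s" "l \<le> n"
  shows "wedge (x (s + P + l) - x (s + l)) (v (s + l)) = (-1) ^ l * wedge (x (s + P) - x s) (v s)"
proof -
  have pl: "pseudo_line e (\<lambda>l. \<alpha> (s + l)) n (\<lambda>l. x (s + l)) (\<lambda>l. v (s + l))"
    by (rule flight_pathD(1)[OF trajectory_flight_path[OF Tx]])
  have pl': "pseudo_line e (\<lambda>l. \<alpha> (s + l)) n (\<lambda>l. x (s + P + l)) (\<lambda>l. v (s + l))"
    by (rule pseudo_line_direction_cong[OF run_pseudo_line[OF assms(1)] run_same_directions[OF assms(1,2)]])
  show ?thesis using width_signed[OF pl pl' _ assms(3)] \<alpha> by simp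
qed

text \<open>Each shift by the period adds the same offset, with the same sign because the period is
  even. After \<open>k\<close> shifts the sum is still the offset of two points of the
  boundary.\<close>

lemma run_drift_bound:
  assumes run: "\<forall>l\<le>n. \<alpha> (s + P + l) = \<alpha> (s + l)" and v: "v (s + P) = v s" and P: "even P" and k: "k * P \<le> n"
  shows "real k * \<bar>wedge (x (s + P) - x s) (v s)\<bar> \<le> size_bound"
proof -
  have "v (s + j * P) = v s \<and> wedge (x (s + j * P) - x s) (v s) = real j * wedge (x (s + P) - x s) (v s)" if "j \<le> k" for j
    using that
  proof (induction j)
    case 0
    show ?case by simp
  next
    case (Suc j)
    have "j * P \<le> k * P" using Suc.prems by simp
    hence jP: "j * P \<le> n" using k by linarith
    have e: "s + P + j * P = s + Suc j * P" by simp
    have IH: "v (s + j * P) = v s" "wedge (x (s + j * P) - x s) (v s) = real j * wedge (x (s + P) - x s) (v s)"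
      using Suc by simp_all
    have v1: "v (s + Suc j * P) = v s" using run_same_directions[OF run v jP] IH(1) unfolding e by simp
    have "wedge (x (s + Suc j * P) - x (s + j * P)) (v s) = wedge (x (s + P) - x s) (v s)"
      using run_offset[OF run v jP] P unfolding e IH(1) by simp
    thus ?case using v1 IH(2) by (simp add: wedge_diff algebra_simps)
  qed
  hence "\<bar>wedge (x (s + k * P) - x s) (v s)\<bar> = real k * \<bar>wedge (x (s + P) - x s) (v s)\<bar>"
    by (simp add: abs_mult)
  moreover have "norm (x (s + k * P) - x s) \<le> size_bound"
    by (rule size_bound(2)[OF \<alpha> \<alpha> trajectoryD(2)[OF \<alpha> Tx] trajectoryD(2)[OF \<alpha> Tx]])
  ultimately show ?thesis
    using abs_wedge_le[of "x (s + k * P) - x s" "v s"] trajectoryD(3)[OF \<alpha> Tx, of s] by simp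
qed

text \<open>Two parallel positions of the rod, equally oriented and displaced by less than its
  width, overlap. The sign of the displacement decides which of them plays the first rod, so that
  its displacement is a fraction of the width in the half-open unit interval.\<close>

lemma close_rods_do_not_split:
  assumes "\<alpha> i = \<alpha> j" "v i = v j" "wedge (y i - x i) (v i) = wedge (y j - x j) (v j)"
    and "\<bar>wedge (x i - x j) (v i)\<bar> < width"
  shows "\<alpha> (Suc i) = \<alpha> (Suc j)"
proof -
  have ordered: "\<alpha> (Suc j) = \<alpha> (Suc i)"
    if h: "\<alpha> i = \<alpha> j" "v i = v j" "wedge (y i - x i) (v i) = wedge (y j - x j) (v j)"
      "\<bar>wedge (x i - x j) (v i)\<bar> < width" "0 \<le> wedge (x i - x j) (v i) / wedge (y i - x i) (v i)" for i j
  proof (rule ccontr)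
    assume ne: "\<alpha> (Suc j) \<noteq> \<alpha> (Suc i)"
    define l where "l = wedge (x i - x j) (v i) / wedge (y i - x i) (v i)"
    define d where "d = wedge (y i - x i) (v i)"
    have d: "\<bar>d\<bar> = width" unfolding d_def by (rule offset_abs)
    hence d0: "d \<noteq> 0" using width_pos by auto
    have l: "wedge (x i - x j) (v i) = l * d" using d0 by (simp add: l_def d_def)
    have "\<bar>l\<bar> * width < 1 * width" using h(4) unfolding l abs_mult d by simp
    hence l1: "\<bar>l\<bar> < 1" using width_pos by (simp only: mult_less_cancel_right_pos)
    have l0: "0 \<le> l" "l < 1" using h(5) l1 by (simp only: l_def, linarith)
    note X = trajectoryD[OF \<alpha> Tx] and Y = trajectoryD[OF \<alpha> Ty]
    have m: "x i + tx i *\<^sub>R v i \<in> edge_interior e (\<alpha> (Suc i))" "y i + ty i *\<^sub>R v i \<in> edge_interior e (\<alpha> (Suc i))"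
      "x j + tx j *\<^sub>R v i \<in> edge_interior e (\<alpha> (Suc j))" "y j + ty j *\<^sub>R v i \<in> edge_interior e (\<alpha> (Suc j))"
      using X(1)[of "Suc i"] Y(1)[of "Suc i"] X(1)[of "Suc j"] Y(1)[of "Suc j"] h(2)
      unfolding X(5) Y(5) by simp_all
    have b: "x j \<in> edge_interior e (\<alpha> i)" "y j \<in> edge_interior e (\<alpha> i)" using X(1)[of j] Y(1)[of j] h(1) by simp_all
    have f: "y j + r *\<^sub>R v i \<notin> boundary A e" if "0 < r" "r < ty j" for r using Y(7)[OF that] h(2) by simp
    have w: "wedge (y j - x j) (v i) = d" using h(2,3) by (simp add: d_def)
    show False
      by (rule interleaved_rods[OF \<alpha> \<alpha> \<alpha> ne X(3) X(1) Y(1) m(1,2) X(4) Y(4) b m(3,4) X(4) Y(4) X(7) f d_def[symmetric] w d0 l l0])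
  qed
  show ?thesis
  proof (cases "0 \<le> wedge (x i - x j) (v i) / wedge (y i - x i) (v i)")
    case True
    show ?thesis by (rule ordered[OF assms True, symmetric])
  next
    case False
    have s: "wedge (x j - x i) (v j) = - wedge (x i - x j) (v i)" using assms(2) by (simp add: wedge_diff)
    have 1: "\<bar>wedge (x j - x i) (v j)\<bar> < width" unfolding s using assms(4) by simp
    have 2: "0 \<le> wedge (x j - x i) (v j) / wedge (y j - x j) (v j)" unfolding s assms(3)[symmetric] using False by simp
    show ?thesis by (rule ordered[OF assms(1)[symmetric] assms(2)[symmetric] assms(3)[symmetric] 1 2])
  qed
qed

lemma long_runs_never_end:
  "\<exists>L. \<forall>s m. 1 \<le> m \<longrightarrow> m \<le> T0 \<longrightarrow> (\<forall>l\<le>L. \<alpha> (s + 2 * m + l) = \<alpha> (s + l)) \<longrightarrow>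
    v (s + 2 * m) = v s \<and> (\<forall>l. \<alpha> (s + 2 * m + l) = \<alpha> (s + l))"
proof -
  obtain \<kappa> where \<kappa>: "\<kappa> > 0" and turn: "\<And>s m. m \<le> T0 \<Longrightarrow> wedge (v s) (v (s + 2 * m)) = 0 \<or> \<kappa> \<le> \<bar>wedge (v s) (v (s + 2 * m))\<bar>"
    using turns_isolated[of T0] by blast
  obtain \<eta> where \<eta>: "\<eta> > 0" and len: "\<And>s m. \<eta> * real m - size_bound \<le> (\<Sum>l<m. tx (s + l))"
    using orbit_length by blast
  obtain N :: nat where N: "(3 * size_bound + 2 * size_bound / \<kappa>) < N * \<eta>" using \<eta> reals_Archimedean3 by blast
  obtain K :: nat where K: "size_bound < K * width" using width_pos reals_Archimedean3 by blast
  \<comment> \<open>The first \<open>N\<close> bounces force the direction to return; the remaining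
    length holds \<open>K\<close> periods, each of at most \<open>2 * T0\<close> letters, which
    makes the displacement per period smaller than the width.\<close>
  define L where "L = N + K * (2 * T0)"
  have main: "v (s + 2 * m) = v s \<and> (\<forall>l. \<alpha> (s + 2 * m + l) = \<alpha> (s + l))"
    if m: "1 \<le> m" "m \<le> T0" and run: "\<forall>l\<le>L. \<alpha> (s + 2 * m + l) = \<alpha> (s + l)" for s m
  proof -
    define S where "S = (\<Sum>l<N. tx (s + l))"
    have q: "0 < 2 * size_bound / \<kappa>" using \<kappa> size_bound(1) by simp
    have S: "2 * size_bound + 2 * size_bound / \<kappa> < S" using len[of N s] N by (simp add: S_def mult.commute)
    have S1: "2 * size_bound < S" using S q by linarith
    have "2 * size_bound / \<kappa> < S" using S size_bound(1) by linarith
    hence S2: "2 * size_bound < \<kappa> * S" using \<kappa> by (simp add: field_simps)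
    have runN: "\<forall>l\<le>N. \<alpha> (s + 2 * m + l) = \<alpha> (s + l)" using run by (simp add: L_def)
    have v: "v (s + 2 * m) = v s" by (rule run_direction[OF runN turn[OF m(2)] S1[unfolded S_def] S2[unfolded S_def]])
    have Km: "K * (2 * m) \<le> L" using m(2) by (simp add: L_def trans_le_add2)
    have "real K * \<bar>wedge (x (s + 2 * m) - x s) (v s)\<bar> \<le> size_bound"
      by (rule run_drift_bound[OF run v _ Km]) simp
    hence "real K * \<bar>wedge (x (s + 2 * m) - x s) (v s)\<bar> < real K * width" using K by linarith
    hence M: "\<bar>wedge (x (s + 2 * m) - x s) (v s)\<bar> < width" by (rule mult_left_less_imp_less) simp
    have "\<forall>l\<le>n. \<alpha> (s + 2 * m + l) = \<alpha> (s + l)" if "L \<le> n" for n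
      using that
    proof (induction n rule: nat_induct_at_least)
      case base
      show ?case by (rule run)
    next
      case (Suc n)
      have vn: "v (s + 2 * m + n) = v (s + n)" by (rule run_same_directions[OF Suc.IH v order_refl])
      have "\<bar>wedge (x (s + 2 * m + n) - x (s + n)) (v (s + n))\<bar> < width"
        unfolding run_offset[OF Suc.IH v order_refl] using M by (simp add: abs_mult power_abs)
      hence o: "\<bar>wedge (x (s + 2 * m + n) - x (s + n)) (v (s + 2 * m + n))\<bar> < width" by (simp only: vn)
      \<comment> \<open>An even shift does not exchange the sides of the rod, so the two positions
        are equally oriented.\<close>
      have "(-1::real) ^ (s + 2 * m + n) = (-1) ^ (s + n)" by (simp add: power_add power_mult)
      hence w: "wedge (y (s + 2 * m + n) - x (s + 2 * m + n)) (v (s + 2 * m + n)) = wedge (y (s + n) - x (s + n)) (v (s + n))"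
        using offset_signed[of "s + 2 * m + n"] offset_signed[of "s + n"] by presburger
      have "\<alpha> (s + 2 * m + n) = \<alpha> (s + n)" using Suc.IH by simp
      from close_rods_do_not_split[OF this vn w o]
      have "\<alpha> (s + 2 * m + Suc n) = \<alpha> (s + Suc n)" by simp
      thus ?case using Suc.IH by (auto simp: le_Suc_eq)
    qed
    hence "\<alpha> (s + 2 * m + l) = \<alpha> (s + l)" for l by (meson nle_le)
    thus ?thesis using v by blast
  qed
  show ?thesis by (rule exI[of _ L], intro allI impI, rule main)
qed

text \<open>The common bounce point determines its edge, and reflecting there recovers the incoming
  direction. Of two flights arriving along the same line the longer one would pass through the
  starting point of the shorter one, which lies on the boundary.\<close>

lemma previous_bounce:
  assumes "x (Suc i) = x (Suc j)" "v (Suc i) = v (Suc j)"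
  shows "x i = x j \<and> v i = v j"
proof -
  note X = trajectoryD[OF \<alpha> Tx]
  have "\<alpha> (Suc i) = \<alpha> (Suc j)"
    using interior_only_edge[OF \<alpha> \<alpha> X(1)] X(2)[of "Suc j"] assms(1) by metis
  hence v: "v i = v j"
    using assms(2) reflect_dir_reflect[OF \<alpha>] X(6) by metis
  have shorter: "\<not> tx i < tx j" if h: "x (Suc i) = x (Suc j)" "v i = v j" for i j
  proof
    assume l: "tx i < tx j"
    have "x i = x j + (tx j - tx i) *\<^sub>R v j" using h X(5)[of i] X(5)[of j] by (simp add: algebra_simps)
    moreover have "x j + (tx j - tx i) *\<^sub>R v j \<notin> boundary A e" by (rule X(7)) (use l X(4)[of i] in simp_all)
    moreover have "x i \<in> boundary A e" using X(2)[of i] \<alpha> by (auto simp: boundary_def)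
    ultimately show False by simp
  qed
  have "tx i = tx j" using shorter[OF assms(1) v] shorter[OF assms(1)[symmetric] v[symmetric]] by linarith
  thus ?thesis using v X(5)[of i] X(5)[of j] assms(1) by simp
qed

theorem coding_periodic: "periodic \<alpha>"
proof -
  note X = trajectoryD[OF \<alpha> Tx]
  obtain T0 where T0: "\<forall>n. \<exists>s T. 1 \<le> T \<and> T \<le> T0 \<and> (\<forall>l\<le>n. \<alpha> (s + T + l) = \<alpha> (s + l))"
    using long_periodic_runs by (elim exE)
  obtain L where L: "\<forall>s m. 1 \<le> m \<longrightarrow> m \<le> T0 \<longrightarrow> (\<forall>l\<le>L. \<alpha> (s + 2 * m + l) = \<alpha> (s + l)) \<longrightarrow>
    v (s + 2 * m) = v s \<and> (\<forall>l. \<alpha> (s + 2 * m + l) = \<alpha> (s + l))"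
    using long_runs_never_end[of T0] by (elim exE)
  obtain s T where T: "1 \<le> T" "T \<le> T0" "\<forall>l\<le>L + T0. \<alpha> (s + T + l) = \<alpha> (s + l)"
    using spec[OF T0, of "L + T0"] by (elim exE conjE)
  \<comment> \<open>Two consecutive shifts by \<open>T\<close> give the even period
    \<open>2 * T\<close>; the extra \<open>T0\<close> letters in the run make room for the second
    shift.\<close>
  have run0: "\<alpha> (s + 2 * T + l) = \<alpha> (s + l)" if "l \<le> L" for l
  proof -
    have "\<alpha> (s + T + (T + l)) = \<alpha> (s + (T + l))" "\<alpha> (s + T + l) = \<alpha> (s + l)" using T that by simp_all
    thus ?thesis by (simp add: add.assoc mult_2)
  qed
  define P where "P = 2 * T"
  have v: "v (s + P) = v s" and run: "\<And>l. \<alpha> (s + P + l) = \<alpha> (s + l)"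
    using L[rule_format, OF T(1,2) run0] by (simp_all add: P_def)
  \<comment> \<open>The run is infinite, so the bound on the accumulated offset holds for every
    number of periods; the offset per period is therefore zero.\<close>
  have "wedge (x (s + P) - x s) (v s) = 0"
  proof (rule ccontr)
    assume "wedge (x (s + P) - x s) (v s) \<noteq> 0"
    hence "0 < \<bar>wedge (x (s + P) - x s) (v s)\<bar>" by simp
    then obtain k :: nat where k: "size_bound < k * \<bar>wedge (x (s + P) - x s) (v s)\<bar>" using reals_Archimedean3 by blast
    have "real k * \<bar>wedge (x (s + P) - x s) (v s)\<bar> \<le> size_bound"
      by (rule run_drift_bound[of "k * P"]) (use run v in \<open>simp_all add: P_def\<close>)
    thus False using k by simp
  qed
  moreover have "x (s + P) \<in> edge_seg e (\<alpha> s)" using X(2)[of "s + P"] run[of 0] by simp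
  ultimately have xs: "x (s + P) = x s"
    using same_offset_eq[OF _ X(2) _ trajectory_nontangent(1)[OF \<alpha> Tx]] by blast
  \<comment> \<open>The state at \<open>s\<close> recurs exactly, so tracing both occurrences back
    bounce by bounce extends the periodicity to the beginning.\<close>
  have before: "x (s - k + P) = x (s - k) \<and> v (s - k + P) = v (s - k)" if "k \<le> s" for k
    using that
  proof (induction k)
    case 0
    show ?case using xs v by simp
  next
    case (Suc k)
    have e: "s - k = Suc (s - Suc k)" using Suc.prems by simp
    show ?case using Suc previous_bounce[of "s - Suc k + P" "s - Suc k"] unfolding e by simp
  qed
  have "\<alpha> (n + P) = \<alpha> n" for n
  proof (cases "n \<le> s")
    case True
    hence "x (n + P) = x n" using before[of "s - n"] by simp
    thus ?thesis using interior_only_edge[OF \<alpha> \<alpha> X(1)] X(2)[of n] by metis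
  next
    case False
    thus ?thesis using run[of "n - s"] by (simp add: add.commute)
  qed
  moreover have "1 \<le> P" using T(1) by (simp add: P_def)
  ultimately show ?thesis unfolding periodic_def by blast
qed

end

section \<open>Uniqueness of the phase point with a given coding\<close>

theorem mainTheorem1:
  fixes A :: "'i set" and e :: "'i \<Rightarrow> (real^2) \<times> (real^2)" and Q :: "(real^2) set"
    and \<alpha> :: "nat \<Rightarrow> 'i"
  assumes "is_polygon A e Q"
    and "\<forall>H\<in>holes A e Q. minimal_diameter H \<noteq> 0"
    and "\<forall>n. \<alpha> n \<in> A"
    and "\<not> periodic \<alpha>"
  shows "\<forall>p\<in>coding_set A e Q \<alpha>. \<forall>q\<in>coding_set A e Q \<alpha>. p = q"
proof (intro ballI)
  fix p q assume p: "p \<in> coding_set A e Q \<alpha>" and q: "q \<in> coding_set A e Q \<alpha>"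
  have \<alpha>: "\<alpha> n \<in> A" for n using assms(3) by blast
  interpret edge_system A e
    using assms(1) by unfold_locales (auto simp: is_polygon_def)
  obtain x v t where x: "trajectory A e \<alpha> x v t" "p = (x 0, v 0)"
    using coding_trajectory[OF assms(1) p \<alpha>] by blast
  obtain y w s where y: "trajectory A e \<alpha> y w s" "q = (y 0, w 0)"
    using coding_trajectory[OF assms(1) q \<alpha>] by blast
  have "w n = v n" for n by (rule same_coding_same_direction[OF \<alpha> y(1) x(1)])
  hence w: "w = v" by (rule ext)
  have "wedge (y 0 - x 0) (v 0) = 0"
  proof (rule ccontr)
    assume "wedge (y 0 - x 0) (v 0) \<noteq> 0"
    then interpret parallel_orbits A e \<alpha> x y v t s
      using \<alpha> x(1) y(1) unfolding w by unfold_locales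
    show False using coding_periodic assms(4) by blast
  qed
  hence "y 0 = x 0"
    by (rule same_offset_eq[OF trajectoryD(2)[OF \<alpha> y(1)] trajectoryD(2)[OF \<alpha> x(1)] _ trajectory_nontangent(1)[OF \<alpha> x(1)]])
  thus "p = q" using x(2) y(2) w by simp
qed

end
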